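(* Let $p\ge7$ be a prime. Let $s=b+c(p-1)$ with integers $2\le b\le p$, $0\le c\le p-2$, and $r=s+p^t(p-1)d$ with positive integers $t,d$ and $p\nmid d$; let $k'=r+2$. Let $a_p\in\bar{\mathbb{Q}}_p$ with $s>2\nu(a_p)$ and $c<\nu(a_p)<\min\{\frac p2+c-\epsilon,\ p-1\}$, with $\epsilon$ as in the context. Assume $t\ge2\nu(a_p)$ if $b\ge 2c-1$ and $t>2\nu(a_p)+\epsilon-1$ if $b\le 2c-2$. Then: (I) If $(b,c)\ne(p,0)$, the map $P$ induces a surjection $\mathrm{ind}_{KZ}^G\big(V_r^{(c-\epsilon)}/V_r^{(c+1-\epsilon)}\big)\to\bar\Theta_{k',a_p}$ (i.e. $P$ vanishes on $\mathrm{ind}_{KZ}^GV_r^{(c+1-\epsilon)}$ and maps $\mathrm{ind}_{KZ}^GV_r^{(c-\epsilon)}$ onto $\bar\Theta_{k',a_p}$). (II) If $(b,c)=(p,0)$ and $\nu(a_p)>1$, the map $P$ induces a surjection $\mathrm{ind}_{KZ}^G\big(V_r^{(1)}/V_r^{(2)}\big)\to\bar\Theta_{k',a_p}$.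
   Context: $\nu$ is the valuation on $\bar{\mathbb{Q}}_p$ with $\nu(p)=1$. $\epsilon=0$ if $2c-1\le b\le p$; $\epsilon=1$ if $2(c-1)-p\le b\le 2(c-1)$; $\epsilon=2$ if $2\le b\le 2(c-1)-(p+1)$. $G=\mathrm{GL}_2(\mathbb{Q}_p)$, $K=\mathrm{GL}_2(\mathbb{Z}_p)$, $Z$ the center of $G$. For a $\mathbb{Z}_p$-algebra $R$, $\mathrm{Sym}^rR^2$ is the space of homogeneous degree-$r$ polynomials in $x,y$ over $R$, with $\gamma=\begin{pmatrix}a&b\\c&d\end{pmatrix}$ acting by $\gamma\cdot F(x,y)=F(ax+cy,bx+dy)$ and $p\in Z$ acting trivially; $V_r=\mathrm{Sym}^r\bar{\mathbb{F}}_p^2$. $\mathrm{ind}_{KZ}^G$ is compact induction; $[g,v]$ denotes the function supported on $KZg^{-1}$ with $[g,v](g')=g'g\cdot v$. The Hecke operator $T$ on $\mathrm{ind}_{KZ}^G\mathrm{Sym}^r\bar{\mathbb{Q}}_p^2$ is $T([g,v])=\sum_{\lambda\in\mathbb{F}_p}\big[g\begin{pmatrix}p&[\lambda]\\0&1\end{pmatrix},\begin{pmatrix}1&-[\lambda]\\0&p\end{pmatrix}\cdot v\big]+\big[g\begin{pmatrix}1&0\\0&p\end{pmatrix},\begin{pmatrix}p&0\\0&1\end{pmatrix}\cdot v\big]$ ($[\lambda]$ Teichmüller lift), extended $G$-equivariantly. $\Theta_{k',a_p}$ is the image of $\mathrm{ind}_{KZ}^G\mathrm{Sym}^r\bar{\mathbb{Z}}_p^2$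 in $\mathrm{ind}_{KZ}^G\mathrm{Sym}^r\bar{\mathbb{Q}}_p^2/(T-a_p)$, $\bar\Theta_{k',a_p}=\Theta_{k',a_p}\otimes\bar{\mathbb{F}}_p$, and $P:\mathrm{ind}_{KZ}^GV_r\to\bar\Theta_{k',a_p}$ the natural surjection. $\theta=x^py-xy^p$, $V_r^{(m)}=\{f\in V_r:\theta^m\mid f\}$. *)

theory Defs
  imports
    "HOL-Analysis.Analysis"
    "HOL-Computational_Algebra.Computational_Algebra"
    "HOL-Algebra.Coset"
    "HOL-Algebra.Generated_Groups"
begin

section \<open>The field of coefficients\<close>

text \<open>
  There is no library type for \<open>p\<close>-adic numbers. The algebraic closure of the field of
  \<open>p\<close>-adic numbers is a type \<open>'k\<close> with a valuation \<open>\<nu>\<close>, characterised up to isomorphism by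
  the locale \<open>padic_alg_closure\<close> below: \<open>'k\<close> is algebraically closed, the topological closure
  of \<open>\<rat>\<close> in \<open>'k\<close> is complete, and \<open>'k\<close> is algebraic over it. Since \<open>\<nu> p = 1\<close>, the
  restriction of \<open>\<nu>\<close> to \<open>\<rat>\<close> is the \<open>p\<close>-adic valuation, so this closure is the field of
  \<open>p\<close>-adic numbers. The residue field is a type \<open>'f\<close> with the reduction map \<open>red\<close>, of which only
  the values on the valuation ring (and its kernel there, the maximal ideal) are meaningful.
\<close>

definition Qp :: "('k::field_char_0 \<Rightarrow> ereal) \<Rightarrow> 'k set" where
  "Qp \<nu> = {x. \<forall>N::nat. \<exists>q\<in>\<rat>. ereal (real N) \<le> \<nu> (x - q)}"

definition Zpbar :: "('k::field_char_0 \<Rightarrow> ereal) \<Rightarrow> 'k set" where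
  "Zpbar \<nu> = {x. 0 \<le> \<nu> x}"

definition Zp :: "('k::field_char_0 \<Rightarrow> ereal) \<Rightarrow> 'k set" where
  "Zp \<nu> = Qp \<nu> \<inter> Zpbar \<nu>"

locale padic_alg_closure =
  fixes p :: nat
    and \<nu> :: "'k::{alg_closed_field, field_char_0} \<Rightarrow> ereal"
    and red :: "'k \<Rightarrow> 'f::field"
  assumes prime_p: "prime p"
    and val_not_MInf: "\<nu> x \<noteq> -\<infinity>"
    and val_eq_PInf: "\<nu> x = \<infinity> \<longleftrightarrow> x = 0"
    and val_mult: "\<nu> (x * y) = \<nu> x + \<nu> y"
    and val_add: "min (\<nu> x) (\<nu> y) \<le> \<nu> (x + y)"
    and val_p: "\<nu> (of_nat p) = 1"
    and Qp_complete:
      "\<And>u :: nat \<Rightarrow> 'k.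
        \<lbrakk>\<And>n. u n \<in> \<rat>;
         \<And>N::nat. \<exists>M. \<forall>m\<ge>M. \<forall>n\<ge>M. ereal (real N) \<le> \<nu> (u m - u n)\<rbrakk>
        \<Longrightarrow> \<exists>x. \<forall>N::nat. \<exists>M. \<forall>n\<ge>M. ereal (real N) \<le> \<nu> (u n - x)"
    and algebraic_over_Qp: "\<exists>f. f \<noteq> 0 \<and> (\<forall>i. coeff f i \<in> Qp \<nu>) \<and> poly f x = 0"
    and red_one: "red 1 = 1"
    and red_add: "\<lbrakk>x \<in> Zpbar \<nu>; y \<in> Zpbar \<nu>\<rbrakk> \<Longrightarrow> red (x + y) = red x + red y"
    and red_mult: "\<lbrakk>x \<in> Zpbar \<nu>; y \<in> Zpbar \<nu>\<rbrakk> \<Longrightarrow> red (x * y) = red x * red y"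
    and red_eq_0: "x \<in> Zpbar \<nu> \<Longrightarrow> red x = 0 \<longleftrightarrow> 0 < \<nu> x"
    and red_surj: "red ` Zpbar \<nu> = UNIV"

definition prime_field :: "'f::field set" where
  "prime_field = range of_nat"

definition teichmueller ::
    "nat \<Rightarrow> ('k::field_char_0 \<Rightarrow> ereal) \<Rightarrow> ('k \<Rightarrow> 'f::field) \<Rightarrow> 'f \<Rightarrow> 'k" where
  "teichmueller p \<nu> red l = (THE z. z \<in> Zp \<nu> \<and> z ^ p = z \<and> red z = l)"


section \<open>The groups\<close>

definition mat2 :: "'a::zero \<Rightarrow> 'a \<Rightarrow> 'a \<Rightarrow> 'a \<Rightarrow> 'a ^ 2 ^ 2" where
  "mat2 a b c d = vector [vector [a, b], vector [c, d]]"

definition GL2 :: "'a::comm_ring_1 set \<Rightarrow> ('a ^ 2 ^ 2) set" where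
  "GL2 R = {g. (\<forall>i j. g $ i $ j \<in> R) \<and> (\<exists>u\<in>R. det g * u = 1)}"

definition group_center :: "('a::comm_ring_1 ^ 2 ^ 2) set \<Rightarrow> ('a ^ 2 ^ 2) set" where
  "group_center G = {z\<in>G. \<forall>g\<in>G. z ** g = g ** z}"

definition KZ :: "('k::field_char_0 \<Rightarrow> ereal) \<Rightarrow> ('k ^ 2 ^ 2) set" where
  "KZ \<nu> = {k ** z | k z. k \<in> GL2 (Zp \<nu>) \<and> z \<in> group_center (GL2 (Qp \<nu>))}"


section \<open>Symmetric powers\<close>

text \<open>
  Polynomials in \<open>x\<close>, \<open>y\<close> are elements of \<open>'r poly poly\<close>; the inner variable is \<open>x\<close>, the outer
  one is \<open>y\<close>, so \<open>coeff (coeff F j) i\<close> is the coefficient of \<open>x^i y^j\<close>.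
\<close>

definition const2 :: "'r::comm_ring_1 \<Rightarrow> 'r poly poly" where
  "const2 a = [:[:a:]:]"

definition varx :: "'r::comm_ring_1 poly poly" where
  "varx = [:[:0, 1:]:]"

definition vary :: "'r::comm_ring_1 poly poly" where
  "vary = [:0, 1:]"

definition subst2 :: "'r::comm_ring_1 poly poly \<Rightarrow> 'r poly poly \<Rightarrow> 'r poly poly \<Rightarrow> 'r poly poly" where
  "subst2 F A B = poly (map_poly (\<lambda>q. poly (map_poly const2 q) A) F) B"

definition Sym :: "nat \<Rightarrow> 'r::comm_ring_1 set \<Rightarrow> 'r poly poly set" where
  "Sym r R = {F. (\<forall>i j. coeff (coeff F j) i \<noteq> 0 \<longrightarrow> i + j = r) \<and> (\<forall>i j. coeff (coeff F j) i \<in> R)}"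

text \<open>
  The action of matrices on \<open>Sym r R\<close>, where \<open>\<rho>\<close> maps the matrix entries into \<open>R\<close>:
  it is the identity for coefficients in \<open>'k\<close> and \<open>red\<close> for coefficients in \<open>'f\<close>.
\<close>

definition mat_act :: "('k \<Rightarrow> 'r::comm_ring_1) \<Rightarrow> 'k ^ 2 ^ 2 \<Rightarrow> 'r poly poly \<Rightarrow> 'r poly poly" where
  "mat_act \<rho> g F =
     subst2 F (const2 (\<rho> (g $ 1 $ 1)) * varx + const2 (\<rho> (g $ 2 $ 1)) * vary)
              (const2 (\<rho> (g $ 1 $ 2)) * varx + const2 (\<rho> (g $ 2 $ 2)) * vary)"

text \<open>
  The action of \<open>KZ\<close>: as \<open>KZ\<close> is the direct product of \<open>K\<close> and the powers of the scalar matrix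
  \<open>p\<close>, which acts trivially, an element acts through its \<open>K\<close>-component. In contrast, the matrices
  of determinant \<open>p\<close> in the formula for the Hecke operator act by the plain substitution
  \<^const>\<open>mat_act\<close>.
\<close>

definition K_part :: "nat \<Rightarrow> ('k::field_char_0 \<Rightarrow> ereal) \<Rightarrow> 'k ^ 2 ^ 2 \<Rightarrow> 'k ^ 2 ^ 2" where
  "K_part p \<nu> g = (THE k. k \<in> GL2 (Zp \<nu>) \<and> (\<exists>n::int. g = mat (of_nat p powi n) ** k))"

definition KZ_act :: "nat \<Rightarrow> ('k::field_char_0 \<Rightarrow> ereal) \<Rightarrow> ('k \<Rightarrow> 'r::comm_ring_1) \<Rightarrow>
    'k ^ 2 ^ 2 \<Rightarrow> 'r poly poly \<Rightarrow> 'r poly poly" where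
  "KZ_act p \<nu> \<rho> g F = mat_act \<rho> (K_part p \<nu> g) F"

definition theta_poly :: "nat \<Rightarrow> 'r::comm_ring_1 poly poly" where
  "theta_poly p = varx ^ p * vary - varx * vary ^ p"

definition V_theta :: "nat \<Rightarrow> nat \<Rightarrow> nat \<Rightarrow> 'f::field poly poly set" where
  "V_theta p r m = {F \<in> Sym r UNIV. theta_poly p ^ m dvd F}"


section \<open>Compact induction and the Hecke operator\<close>

text \<open>
  Functions on \<open>G\<close> are extended by \<open>0\<close> to all matrices. Compact support modulo the center means
  support in finitely many cosets \<open>KZ g\<close>, as \<open>KZ\<close> is open and compact modulo the center. No
  continuity is imposed beyond the equivariance under \<open>KZ\<close>, so that \<open>c_ind\<close> is the
  span of the functions \<open>bracket g v\<close>.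
\<close>

definition c_ind :: "nat \<Rightarrow> ('k::field_char_0 \<Rightarrow> ereal) \<Rightarrow> ('k \<Rightarrow> 'r::comm_ring_1) \<Rightarrow>
    'r poly poly set \<Rightarrow> ('k ^ 2 ^ 2 \<Rightarrow> 'r poly poly) set" where
  "c_ind p \<nu> \<rho> M = {f.
     (\<forall>g. g \<notin> GL2 (Qp \<nu>) \<longrightarrow> f g = 0) \<and>
     (\<forall>g\<in>GL2 (Qp \<nu>). f g \<in> M) \<and>
     (\<forall>h\<in>KZ \<nu>. \<forall>g\<in>GL2 (Qp \<nu>). f (h ** g) = KZ_act p \<nu> \<rho> h (f g)) \<and>
     (\<exists>S. finite S \<and> S \<subseteq> GL2 (Qp \<nu>) \<and> {g. f g \<noteq> 0} \<subseteq> (\<Union>s\<in>S. {h ** s | h. h \<in> KZ \<nu>}))}"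

definition bracket :: "nat \<Rightarrow> ('k::field_char_0 \<Rightarrow> ereal) \<Rightarrow> 'k ^ 2 ^ 2 \<Rightarrow> 'k poly poly \<Rightarrow>
    'k ^ 2 ^ 2 \<Rightarrow> 'k poly poly" where
  "bracket p \<nu> g v = (\<lambda>g'. if g' ** g \<in> KZ \<nu> then KZ_act p \<nu> (\<lambda>a. a) (g' ** g) v else 0)"

definition hecke_bracket :: "nat \<Rightarrow> ('k::field_char_0 \<Rightarrow> ereal) \<Rightarrow> ('k \<Rightarrow> 'f::field) \<Rightarrow>
    'k ^ 2 ^ 2 \<Rightarrow> 'k poly poly \<Rightarrow> 'k ^ 2 ^ 2 \<Rightarrow> 'k poly poly" where
  "hecke_bracket p \<nu> red g v = (\<lambda>g'.
     (\<Sum>l\<in>prime_field.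
        bracket p \<nu> (g ** mat2 (of_nat p) (teichmueller p \<nu> red l) 0 1)
          (mat_act (\<lambda>a. a) (mat2 1 (- teichmueller p \<nu> red l) 0 (of_nat p)) v) g') +
     bracket p \<nu> (g ** mat2 1 0 0 (of_nat p))
       (mat_act (\<lambda>a. a) (mat2 (of_nat p) 0 0 1) v) g')"

text \<open>
  The additive extension of \<open>[h, v] \<mapsto> hecke_bracket h v\<close> to the compact induction: every
  \<open>f\<close> is the sum of \<open>[h, f (h\<inverse>)]\<close> over representatives \<open>h\<close> of the finitely many cosets \<open>h KZ\<close>
  on which \<open>f (h\<inverse>) \<noteq> 0\<close>. The summands do not depend on the choice of the representatives.
\<close>

definition hecke :: "nat \<Rightarrow> ('k::field_char_0 \<Rightarrow> ereal) \<Rightarrow> ('k \<Rightarrow> 'f::field) \<Rightarrow>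
    ('k ^ 2 ^ 2 \<Rightarrow> 'k poly poly) \<Rightarrow> 'k ^ 2 ^ 2 \<Rightarrow> 'k poly poly" where
  "hecke p \<nu> red f = (\<lambda>g'.
     \<Sum>C\<in>{(**) h ` KZ \<nu> | h. h \<in> GL2 (Qp \<nu>) \<and> f (matrix_inv h) \<noteq> 0}.
       let h = (SOME h. h \<in> C) in hecke_bracket p \<nu> red h (f (matrix_inv h)) g')"


section \<open>The quotient \<open>\<Theta>\<close> and its reduction\<close>

abbreviation ind_Qpbar :: "nat \<Rightarrow> ('k::field_char_0 \<Rightarrow> ereal) \<Rightarrow> nat \<Rightarrow>
    ('k ^ 2 ^ 2 \<Rightarrow> 'k poly poly) set" where
  "ind_Qpbar p \<nu> r \<equiv> c_ind p \<nu> (\<lambda>a. a) (Sym r UNIV)"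

abbreviation ind_Zpbar :: "nat \<Rightarrow> ('k::field_char_0 \<Rightarrow> ereal) \<Rightarrow> nat \<Rightarrow>
    ('k ^ 2 ^ 2 \<Rightarrow> 'k poly poly) set" where
  "ind_Zpbar p \<nu> r \<equiv> c_ind p \<nu> (\<lambda>a. a) (Sym r (Zpbar \<nu>))"

definition ind_group :: "nat \<Rightarrow> ('k::field_char_0 \<Rightarrow> ereal) \<Rightarrow> nat \<Rightarrow>
    ('k ^ 2 ^ 2 \<Rightarrow> 'k poly poly) monoid" where
  "ind_group p \<nu> r = \<lparr>carrier = ind_Qpbar p \<nu> r, mult = (\<lambda>f h g. f g + h g), one = (\<lambda>g. 0)\<rparr>"

definition hecke_image :: "nat \<Rightarrow> ('k::field_char_0 \<Rightarrow> ereal) \<Rightarrow> ('k \<Rightarrow> 'f::field) \<Rightarrow> nat \<Rightarrow> 'k \<Rightarrow>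
    ('k ^ 2 ^ 2 \<Rightarrow> 'k poly poly) set" where
  "hecke_image p \<nu> red r ap =
     (\<lambda>f g. hecke p \<nu> red f g - const2 ap * f g) ` ind_Qpbar p \<nu> r"

definition Theta_class :: "nat \<Rightarrow> ('k::field_char_0 \<Rightarrow> ereal) \<Rightarrow> ('k \<Rightarrow> 'f::field) \<Rightarrow> nat \<Rightarrow> 'k \<Rightarrow>
    ('k ^ 2 ^ 2 \<Rightarrow> 'k poly poly) \<Rightarrow> ('k ^ 2 ^ 2 \<Rightarrow> 'k poly poly) set" where
  "Theta_class p \<nu> red r ap f = hecke_image p \<nu> red r ap #>\<^bsub>ind_group p \<nu> r\<^esub> f"

definition Theta :: "nat \<Rightarrow> ('k::field_char_0 \<Rightarrow> ereal) \<Rightarrow> ('k \<Rightarrow> 'f::field) \<Rightarrow> nat \<Rightarrow> 'k \<Rightarrow>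
    ('k ^ 2 ^ 2 \<Rightarrow> 'k poly poly) set monoid" where
  "Theta p \<nu> red r ap =
     (ind_group p \<nu> r Mod hecke_image p \<nu> red r ap)
       \<lparr>carrier := Theta_class p \<nu> red r ap ` ind_Zpbar p \<nu> r\<rparr>"

text \<open>
  The base change of \<open>\<Theta>\<close> along the reduction map of the valuation ring, with maximal ideal
  \<open>\<mm>\<close>, is \<open>\<Theta> / \<mm> \<Theta>\<close>.
\<close>

definition max_ideal_Theta :: "nat \<Rightarrow> ('k::field_char_0 \<Rightarrow> ereal) \<Rightarrow> ('k \<Rightarrow> 'f::field) \<Rightarrow> nat \<Rightarrow> 'k \<Rightarrow>
    ('k ^ 2 ^ 2 \<Rightarrow> 'k poly poly) set set" where
  "max_ideal_Theta p \<nu> red r ap =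
     generate (Theta p \<nu> red r ap)
       {Theta_class p \<nu> red r ap (\<lambda>g. const2 a * f g) | a f. 0 < \<nu> a \<and> f \<in> ind_Zpbar p \<nu> r}"

definition Theta_bar :: "nat \<Rightarrow> ('k::field_char_0 \<Rightarrow> ereal) \<Rightarrow> ('k \<Rightarrow> 'f::field) \<Rightarrow> nat \<Rightarrow> 'k \<Rightarrow>
    ('k ^ 2 ^ 2 \<Rightarrow> 'k poly poly) set set monoid" where
  "Theta_bar p \<nu> red r ap = Theta p \<nu> red r ap Mod max_ideal_Theta p \<nu> red r ap"

text \<open>
  The natural surjection \<open>P\<close> from the compact induction of \<open>V\<^sub>r\<close>: lift a function to integral
  coefficients and take its class, which does not depend on the lift.
\<close>

definition P_map :: "nat \<Rightarrow> ('k::field_char_0 \<Rightarrow> ereal) \<Rightarrow> ('k \<Rightarrow> 'f::field) \<Rightarrow> nat \<Rightarrow> 'k \<Rightarrow>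
    ('k ^ 2 ^ 2 \<Rightarrow> 'f poly poly) \<Rightarrow> ('k ^ 2 ^ 2 \<Rightarrow> 'k poly poly) set set" where
  "P_map p \<nu> red r ap f =
     (THE X. \<exists>F\<in>ind_Zpbar p \<nu> r.
        (\<forall>g. map_poly (map_poly red) (F g) = f g) \<and>
        X = max_ideal_Theta p \<nu> red r ap #>\<^bsub>Theta p \<nu> red r ap\<^esub> Theta_class p \<nu> red r ap F)"

text \<open>
  \<open>P\<close> induces a surjection from the compact induction of \<open>V\<^sub>r\<^sup>(\<^sup>m\<^sup>) / V\<^sub>r\<^sup>(\<^sup>n\<^sup>)\<close>, for \<open>m \<le> n\<close>.
\<close>

definition P_induces_surjection :: "nat \<Rightarrow> ('k::field_char_0 \<Rightarrow> ereal) \<Rightarrow> ('k \<Rightarrow> 'f::field) \<Rightarrow>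
    nat \<Rightarrow> 'k \<Rightarrow> nat \<Rightarrow> nat \<Rightarrow> bool" where
  "P_induces_surjection p \<nu> red r ap m n \<longleftrightarrow>
     (\<forall>f\<in>c_ind p \<nu> red (V_theta p r n). P_map p \<nu> red r ap f = \<one>\<^bsub>Theta_bar p \<nu> red r ap\<^esub>) \<and>
     P_map p \<nu> red r ap ` c_ind p \<nu> red (V_theta p r m) = carrier (Theta_bar p \<nu> red r ap)"


section \<open>The number \<open>\<epsilon>\<close>\<close>

text \<open>For \<open>2 \<le> b \<le> p\<close> the last case is \<open>b \<le> 2 (c - 1) - (p + 1)\<close>.\<close>

definition eps :: "nat \<Rightarrow> nat \<Rightarrow> nat \<Rightarrow> nat" where
  "eps p b c =
     (if 2 * int c - 1 \<le> int b \<and> b \<le> p then 0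
      else if 2 * (int c - 1) - int p \<le> int b \<and> int b \<le> 2 * (int c - 1) then 1
      else 2)"

end

theory Submission
  imports Defs
begin

text \<open>
  Write \<open>v = \<nu> ap\<close>, \<open>n = r - s\<close> and \<open>m = \<lfloor>(s + 1) / (p + 1)\<rfloor>\<close>; this \<open>m\<close> is \<open>c - \<epsilon>\<close> in case (I) and \<open>1\<close> in
  case (II). As \<open>n\<close> is divisible by \<open>p\<^sup>t (p - 1)\<close>, there is a form \<open>H\<close> of degree \<open>n\<close> that is
  congruent to \<open>1\<close> modulo \<open>p\<^sup>t\<close> on all primitive vectors, and it splits into pieces supported on the
  residue discs of the projective line. If \<open>h\<close> is the piece at \<open>y = 0\<close>, then \<open>T [1, h x\<^bsup>s-j\<^esup> y\<^sup>j]\<close> is,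
  modulo \<open>p\<^sup>t\<close>, a translate of \<open>p\<^sup>j [1, x\<^bsup>r-j\<^esup> y\<^sup>j]\<close>. As \<open>T\<close> acts on \<open>\<Theta>\<close> as \<open>ap\<close>, this gives two things:
  \<open>p\<^sup>j H x\<^bsup>s-j\<^esup> y\<^sup>j\<close> is divisible by \<open>ap\<close> in \<open>\<Theta>\<close>, and any further divisibility of it passes on to
  \<open>h x\<^bsup>s-j\<^esup> y\<^sup>j\<close>.

  The lattice spanned by the \<open>K\<close>-translates of all \<open>p\<^sup>j x\<^bsup>s-j\<^esup> y\<^sup>j\<close> contains \<open>p\<^sup>m Sym\<^sup>s\<close>. Hence \<open>H Sym\<^sup>s\<close>
  is divisible by \<open>ap / p\<^sup>m\<close>, so it dies in the reduction as \<open>m < v\<close>, and \<open>h x\<^bsup>s-i\<^esup> y\<^sup>i\<close> is divisible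
  essentially by \<open>p\<^bsup>i-m\<^esup>\<close>, so it dies for \<open>i > m\<close>. Modulo \<open>p\<close>, the latter form lies in \<open>V\<^sup>(\<^sup>i\<^sup>)\<close> and is the
  indicator of one point in \<open>V\<^sup>(\<^sup>i\<^sup>) / V\<^sup>(\<^sup>i\<^sup>+\<^sup>1\<^sup>)\<close>, so its translates generate this quotient. Together
  with the direct argument for \<open>i > v\<close> this kills \<open>V\<^sup>(\<^sup>m\<^sup>+\<^sup>1\<^sup>)\<close>, while \<open>V\<^sub>r = H V\<^sub>s + V\<^sup>(\<^sup>m\<^sup>)\<close> gives the
  surjectivity.
\<close>

section \<open>Bivariate polynomials\<close>

text \<open>The integer m is pinned from both sides. V_r/V_r^(m) has dimension m(p + 1), so H V_s,
  of dimension s + 1, can cover it only if m(p + 1) \<le> s + 1. Conversely s + 1 < (m + 1)(p + 1)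
  leaves at most m + 1 exponents of a residue class modulo p - 1 strictly between m and s - m, which
  is what interpolation can separate at the price of p^m. The Hecke relation produces p^j x^(n+s-j)
  y^j, not p^j H x^(s-j) y^j. The two differ by p^j times the piece of H at x = 0 times x^(s-j) y^j;
  T gives this piece a factor p^min(t, s-j), so that after division by \<open>ap\<close> the
  valuation is at least min(t, s) - v. This has to reach v, which is where 2v < s and 2v \<le> t
  come from. Finally, H is K-invariant modulo p^t only on primitive vectors, not coefficientwise.
  Invariance must therefore be tested after applying T, which costs v once more: a congruence modulo
  p^t becomes divisibility of order t - v \<ge> v.\<close>

lemma const2_0 [simp]: "const2 0 = 0"
  and const2_1 [simp]: "const2 1 = 1"
  and const2_add: "const2 (a + b) = const2 a + const2 b"
  and const2_mult: "const2 (a * b) = const2 a * const2 b"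
  and const2_minus: "const2 (- a) = - const2 a"
  by (simp_all add: const2_def one_pCons)

lemma const2_power: "const2 (a ^ n) = const2 a ^ n"
  by (induction n) (simp_all add: const2_mult)

lemma const2_of_nat: "const2 (of_nat n) = of_nat n"
  by (induction n) (simp_all add: const2_add)

lemma const2_sum: "const2 (sum f A) = (\<Sum>x\<in>A. const2 (f x))"
  by (induction A rule: infinite_finite_induct) (simp_all add: const2_add)

text \<open>Constants and the two variables generate the ring, so identities between ring
  homomorphisms such as the matrix actions need checking on generators only.\<close>

lemma poly2_induct [case_names const varx vary add mult]:
  assumes "\<And>a. P (const2 a)" "P varx" "P vary"
    and add: "\<And>F G. P F \<Longrightarrow> P G \<Longrightarrow> P (F + G)" and mult: "\<And>F G. P F \<Longrightarrow> P G \<Longrightarrow> P (F * G)"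
  shows "P F"
proof -
  have P0: "P 0" using assms(1)[of 0] by simp
  have q: "P [:q:]" for q
  proof (induction q)
    case 0
    then show ?case using P0 by simp
  next
    case (pCons a q)
    have "[:pCons a q:] = const2 a + varx * [:q:]"
      by (simp add: const2_def varx_def)
    with pCons show ?case by (metis add mult assms(1,2))
  qed
  show ?thesis
  proof (induction F)
    case 0
    then show ?case using P0 by simp
  next
    case (pCons q F)
    have "pCons q F = [:q:] + vary * F"
      by (simp add: vary_def)
    with pCons show ?case by (metis q add mult assms(3))
  qed
qed

lemma poly_map_poly_add:
  assumes "f 0 = 0" "\<And>a b. f (a + b) = f a + f b"
  shows "poly (map_poly f (p + q)) x = poly (map_poly f p) x + poly (map_poly f q) x"
proof -
  have "map_poly f (p + q) = map_poly f p + map_poly f q"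
    by (rule poly_eqI) (simp add: coeff_map_poly assms)
  thus ?thesis by simp
qed

lemma map_poly_hom_mult:
  assumes "f 0 = 0" "\<And>a b. f (a + b) = f a + f b" "\<And>a b. f (a * b) = f a * f b"
  shows "map_poly f (p * q) = map_poly f p * map_poly f q"
proof (rule poly_eqI)
  have s: "f (sum g A) = (\<Sum>x\<in>A. f (g x))" for g and A :: "nat set"
    by (induction A rule: infinite_finite_induct) (simp_all add: assms)
  show "coeff (map_poly f (p * q)) n = coeff (map_poly f p * map_poly f q) n" for n
    by (simp add: coeff_map_poly coeff_mult assms s)
qed

lemma poly_map_poly_mult:
  assumes "f 0 = 0" "\<And>a b. f (a + b) = f a + f b" "\<And>a b. f (a * b) = f a * f b"
  shows "poly (map_poly f (p * q)) x = poly (map_poly f p) x * poly (map_poly f q) x"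
  by (simp add: map_poly_hom_mult assms)

section \<open>Substitution and the action of matrices as ring homomorphisms\<close>

lemma subst2_add: "subst2 (F + G) A B = subst2 F A B + subst2 G A B"
  unfolding subst2_def
  by (intro poly_map_poly_add) (simp_all add: poly_map_poly_add const2_add)

lemma subst2_mult: "subst2 (F * G) A B = subst2 F A B * subst2 G A B"
  unfolding subst2_def
  by (intro poly_map_poly_mult) (simp_all add: poly_map_poly_add poly_map_poly_mult const2_add const2_mult)

lemma subst2_const2 [simp]: "subst2 (const2 a) A B = const2 a"
  by (simp add: subst2_def const2_def map_poly_pCons)

lemma subst2_varx [simp]: "subst2 varx A B = A"
  by (simp add: subst2_def varx_def map_poly_pCons flip: const2_def)

lemma subst2_vary [simp]: "subst2 vary A B = B"
  by (simp add: subst2_def vary_def map_poly_pCons flip: const2_def)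

lemma mat_act_add: "mat_act \<rho> g (F + G) = mat_act \<rho> g F + mat_act \<rho> g G"
  and mat_act_mult: "mat_act \<rho> g (F * G) = mat_act \<rho> g F * mat_act \<rho> g G"
  and mat_act_const2 [simp]: "mat_act \<rho> g (const2 a) = const2 a"
  and mat_act_varx: "mat_act \<rho> g varx = const2 (\<rho> (g $ 1 $ 1)) * varx + const2 (\<rho> (g $ 2 $ 1)) * vary"
  and mat_act_vary: "mat_act \<rho> g vary = const2 (\<rho> (g $ 1 $ 2)) * varx + const2 (\<rho> (g $ 2 $ 2)) * vary"
  by (simp_all add: mat_act_def subst2_add subst2_mult)

lemma mat_act_0 [simp]: "mat_act \<rho> g 0 = 0"
  using mat_act_const2[of \<rho> g 0] by simp

lemma mat_act_1 [simp]: "mat_act \<rho> g 1 = 1"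
  using mat_act_const2[of \<rho> g 1] by simp

lemma mat_act_minus: "mat_act \<rho> g (- F) = - mat_act \<rho> g F"
  by (metis add_eq_0_iff mat_act_0 mat_act_add)

lemma mat_act_diff: "mat_act \<rho> g (F - G) = mat_act \<rho> g F - mat_act \<rho> g G"
  by (metis diff_conv_add_uminus mat_act_add mat_act_minus)

lemma mat_act_power: "mat_act \<rho> g (F ^ n) = mat_act \<rho> g F ^ n"
  by (induction n) (simp_all add: mat_act_mult)

lemma mat_act_sum: "mat_act \<rho> g (sum f A) = (\<Sum>x\<in>A. mat_act \<rho> g (f x))"
  by (induction A rule: infinite_finite_induct) (simp_all add: mat_act_add)

lemmas mat_act_simps = mat_act_add mat_act_mult mat_act_varx mat_act_vary mat_act_minus
  mat_act_diff mat_act_power mat_act_sum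

text \<open>The images of the variables are read off the columns of the matrix, which makes this a
  left action.\<close>

lemma mat_act_compose: "mat_act (\<lambda>a. a) g (mat_act (\<lambda>a. a) h F) = mat_act (\<lambda>a. a) (g ** h) F"
proof (induction F rule: poly2_induct)
  case varx
  show ?case
    by (simp add: mat_act_simps matrix_matrix_mult_def sum_2 const2_add const2_mult algebra_simps)
next
  case vary
  show ?case
    by (simp add: mat_act_simps matrix_matrix_mult_def sum_2 const2_add const2_mult algebra_simps)
qed (simp_all add: mat_act_simps)

lemma mat_act_mat_1: "mat_act (\<lambda>a. a) (mat 1) F = F"
  by (induction F rule: poly2_induct) (simp_all add: mat_act_simps mat_def)

lemma monom2: "const2 a * varx ^ i * vary ^ j = monom (monom a i) j"
proof -
  have 1: "varx ^ i = [:monom 1 i:]" for i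
    by (induction i) (simp_all add: varx_def monom_Suc one_pCons)
  have 2: "vary ^ j = monom (1 :: 'a poly) j" for j
    by (induction j) (simp_all add: vary_def monom_Suc one_poly_eq_simps smult_monom flip: monom_0)
  show ?thesis
    by (simp add: const2_def 1 2 smult_monom)
qed

lemma coeff_coeff_monom2:
  "coeff (coeff (const2 a * varx ^ i * vary ^ j) j') i' = (if i = i' \<and> j = j' then a else 0)"
  by (simp add: monom2 coeff_monom)

lemma coeff_coeff_const2_mult: "coeff (coeff (const2 a * F) j) i = a * coeff (coeff F j) i"
  by (simp add: const2_def)

lemma coeff_coeff_mult:
  "coeff (coeff (F * G) j) i =
     (\<Sum>b\<le>j. \<Sum>a\<le>i. coeff (coeff F b) a * coeff (coeff G (j - b)) (i - a))"
  by (simp add: coeff_mult coeff_sum)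

section \<open>Homogeneous forms\<close>

lemma Sym_iff: "F \<in> Sym r R \<longleftrightarrow> F \<in> Sym r UNIV \<and> (\<forall>i j. coeff (coeff F j) i \<in> R)"
  by (auto simp: Sym_def)

lemma Sym_0: "0 \<in> Sym r UNIV"
  by (simp add: Sym_def)

lemma Sym_add: "F \<in> Sym r UNIV \<Longrightarrow> G \<in> Sym r UNIV \<Longrightarrow> F + G \<in> Sym r UNIV"
  unfolding Sym_def by auto (metis add.right_neutral)

lemma Sym_uminus: "F \<in> Sym r UNIV \<Longrightarrow> - F \<in> Sym r UNIV"
  by (auto simp: Sym_def)

lemma Sym_diff: "F \<in> Sym r UNIV \<Longrightarrow> G \<in> Sym r UNIV \<Longrightarrow> F - G \<in> Sym r UNIV"
  using Sym_add[OF _ Sym_uminus, of F r G] by simp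

lemma Sym_sum: "(\<And>x. x \<in> A \<Longrightarrow> f x \<in> Sym r UNIV) \<Longrightarrow> sum f A \<in> Sym r UNIV"
  by (induction A rule: infinite_finite_induct) (auto intro: Sym_add Sym_0)

lemma Sym_mult:
  assumes "F \<in> Sym r UNIV" "G \<in> Sym s UNIV"
  shows "F * G \<in> Sym (r + s) UNIV"
proof -
  have "i + j = r + s" if nz: "coeff (coeff (F * G) j) i \<noteq> 0" for i j
  proof -
    from nz obtain b where b: "b \<le> j" "(\<Sum>a\<le>i. coeff (coeff F b) a * coeff (coeff G (j - b)) (i - a)) \<noteq> 0"
      unfolding coeff_coeff_mult by (meson sum.not_neutral_contains_not_neutral atMost_iff)
    then obtain a where a: "a \<le> i" "coeff (coeff F b) a * coeff (coeff G (j - b)) (i - a) \<noteq> 0"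
      by (meson sum.not_neutral_contains_not_neutral atMost_iff)
    hence "coeff (coeff F b) a \<noteq> 0" "coeff (coeff G (j - b)) (i - a) \<noteq> 0" by auto
    hence "a + b = r" "i - a + (j - b) = s" using assms by (auto simp: Sym_def)
    thus ?thesis using a b by linarith
  qed
  thus ?thesis by (auto simp: Sym_def)
qed

lemma Sym_1: "1 \<in> Sym 0 UNIV"
  using coeff_coeff_monom2[of 1 0 0] by (auto simp: Sym_def)

lemma Sym_power: "F \<in> Sym r UNIV \<Longrightarrow> F ^ n \<in> Sym (n * r) UNIV"
  by (induction n) (auto simp: Sym_1 intro: Sym_mult)

lemma Sym_const2_mult: "F \<in> Sym r UNIV \<Longrightarrow> const2 a * F \<in> Sym r UNIV"
  unfolding Sym_def by (auto simp: coeff_coeff_const2_mult dest: mult_not_zero)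

lemma Sym_monom: "i + j = r \<Longrightarrow> varx ^ i * vary ^ j \<in> Sym r (UNIV :: 'a::comm_ring_1 set)"
  using coeff_coeff_monom2[of "1 :: 'a" i j] by (auto simp: Sym_def split: if_splits)

lemma Sym_varx: "varx \<in> Sym 1 UNIV" and Sym_vary: "vary \<in> Sym 1 UNIV"
  using Sym_monom[of 1 0 1] Sym_monom[of 0 1 1] by simp_all

lemma Sym_decomp:
  assumes "F \<in> Sym r UNIV"
  shows "F = (\<Sum>j\<le>r. const2 (coeff (coeff F j) (r - j)) * varx ^ (r - j) * vary ^ j)"
proof (rule poly_eqI, rule poly_eqI)
  fix j i
  have "coeff (coeff (\<Sum>j\<le>r. const2 (coeff (coeff F j) (r - j)) * varx ^ (r - j) * vary ^ j) j) i
        = (\<Sum>j'\<le>r. if r - j' = i \<and> j' = j then coeff (coeff F j') (r - j') else 0)"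
    by (simp add: coeff_sum coeff_coeff_monom2)
  also have "\<dots> = (\<Sum>j'\<le>r. if j' = j then (if r - j = i then coeff (coeff F j) (r - j) else 0) else 0)"
    by (intro sum.cong) auto
  also have "\<dots> = (if j \<le> r \<and> r - j = i then coeff (coeff F j) (r - j) else 0)"
    by simp
  also have "\<dots> = coeff (coeff F j) i"
    using assms by (auto simp: Sym_def) (metis diff_add_inverse2 le_add2)+
  finally show "coeff (coeff F j) i = coeff (coeff (\<Sum>j\<le>r. const2 (coeff (coeff F j) (r - j)) * varx ^ (r - j) * vary ^ j) j) i"
    by simp
qed

lemma Sym_mat_act:
  fixes F :: "'r::comm_ring_1 poly poly"
  assumes "F \<in> Sym r UNIV"
  shows "mat_act \<rho> g F \<in> Sym r UNIV"
proof -
  have lin: "const2 a * varx + const2 b * vary \<in> Sym 1 UNIV" for a b :: 'r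
    by (intro Sym_add Sym_const2_mult Sym_varx Sym_vary)
  have "mat_act \<rho> g (const2 a * varx ^ (r - j) * vary ^ j) \<in> Sym r UNIV" if "j \<le> r" for a j
    using Sym_const2_mult[OF Sym_mult[OF Sym_power[OF lin, where n = "r - j"] Sym_power[OF lin, where n = j]]] that
    by (simp add: mat_act_simps mult.assoc)
  thus ?thesis
    by (subst Sym_decomp[OF assms]) (auto simp: mat_act_sum intro!: Sym_sum)
qed

text \<open>Setting x = 1 turns a form of known degree into a polynomial in y without loss. A power
  of x dividing the form reappears as a drop of the degree below r.\<close>

definition dehom :: "'a::comm_ring_1 poly poly \<Rightarrow> 'a poly" where
  "dehom F = map_poly (\<lambda>q. poly q 1) F"

definition homog :: "nat \<Rightarrow> 'a::comm_ring_1 poly \<Rightarrow> 'a poly poly" where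
  "homog r f = (\<Sum>j\<le>r. const2 (coeff f j) * varx ^ (r - j) * vary ^ j)"

lemma dehom_add: "dehom (F + G) = dehom F + dehom G"
  by (rule poly_eqI) (simp add: dehom_def coeff_map_poly)

lemma dehom_mult: "dehom (F * G) = dehom F * dehom G"
  unfolding dehom_def by (rule map_poly_hom_mult) auto

lemma dehom_const2 [simp]: "dehom (const2 a) = [:a:]"
  and dehom_varx [simp]: "dehom varx = 1"
  and dehom_vary [simp]: "dehom vary = [:0, 1:]"
  by (simp_all add: dehom_def const2_def varx_def vary_def map_poly_pCons one_pCons)

lemma dehom_0 [simp]: "dehom 0 = 0"
  by (simp add: dehom_def)

lemma dehom_1 [simp]: "dehom 1 = 1"
  using dehom_const2[of 1] by (simp add: one_pCons)

lemma dehom_minus: "dehom (- F) = - dehom F"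
  by (metis add_eq_0_iff dehom_0 dehom_add)

lemma dehom_diff: "dehom (F - G) = dehom F - dehom G"
  by (metis diff_conv_add_uminus dehom_add dehom_minus)

lemma dehom_power: "dehom (F ^ n) = dehom F ^ n"
  by (induction n) (simp_all add: dehom_mult)

lemma dehom_sum: "dehom (sum f A) = (\<Sum>x\<in>A. dehom (f x))"
  by (induction A rule: infinite_finite_induct) (simp_all add: dehom_add)

lemmas dehom_simps = dehom_add dehom_mult dehom_minus dehom_diff dehom_power dehom_sum

lemma dehom_monom2: "dehom (const2 a * varx ^ i * vary ^ j) = monom a j"
  by (simp add: dehom_simps monom_altdef)

lemma coeff_dehom:
  assumes "F \<in> Sym r UNIV"
  shows "coeff (dehom F) j = (if j \<le> r then coeff (coeff F j) (r - j) else 0)"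
proof -
  have "coeff (dehom F) j = (\<Sum>j'\<le>r. if j' = j then coeff (coeff F j) (r - j) else 0)"
    by (subst Sym_decomp[OF assms])
      (auto simp: dehom_sum dehom_monom2 coeff_sum coeff_monom intro!: sum.cong)
  thus ?thesis by simp
qed

lemma dehom_inject:
  assumes "F \<in> Sym r UNIV" "G \<in> Sym r UNIV" "dehom F = dehom G"
  shows "F = G"
proof -
  have "coeff (coeff F j) (r - j) = coeff (coeff G j) (r - j)" if "j \<le> r" for j
    using assms coeff_dehom that by metis
  thus ?thesis
    by (subst Sym_decomp[OF assms(1)], subst Sym_decomp[OF assms(2)]) (auto intro: sum.cong)
qed

lemma Sym_homog: "homog r f \<in> Sym r UNIV"
  unfolding homog_def
  by (intro Sym_sum) (simp add: mult.assoc Sym_const2_mult Sym_monom)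

lemma dehom_homog:
  assumes "degree f \<le> r"
  shows "dehom (homog r f) = f"
proof -
  have "coeff (dehom (homog r f)) j = coeff f j" for j
  proof -
    have "coeff (coeff (homog r f) j) (r - j) = (\<Sum>j'\<le>r. if j' = j then coeff f j else 0)"
      unfolding homog_def coeff_sum coeff_coeff_monom2 by (intro sum.cong) auto
    thus ?thesis using assms
      by (cases "j \<le> r") (simp_all add: coeff_dehom[OF Sym_homog] coeff_eq_0)
  qed
  thus ?thesis by (simp add: poly_eqI)
qed

section \<open>The valuation and Teichmueller lifts\<close>

lemma power_Suc_diff:
  "(x :: 'a::comm_ring_1) ^ Suc m - y ^ Suc m = (x - y) * (\<Sum>i<Suc m. x ^ i * y ^ (m - i))"
  unfolding power_diff_sumr2 by (intro arg_cong[where f = "(*) (x - y)"] sum.cong) (auto simp: mult.commute)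

lemma const2_diff: "const2 (a - b) = const2 a - const2 b"
  by (simp add: const2_def)

context padic_alg_closure
begin

lemma nu_0 [simp]: "\<nu> 0 = \<infinity>"
  by (simp add: val_eq_PInf)

lemma nu_ereal: "x \<noteq> 0 \<Longrightarrow> \<exists>a. \<nu> x = ereal a"
  using val_not_MInf[of x] val_eq_PInf[of x] by (cases "\<nu> x") auto

lemma nu_1 [simp]: "\<nu> 1 = 0"
  using val_mult[of 1 1] nu_ereal[of 1] by (auto simp: zero_ereal_def)

lemma nu_minus [simp]: "\<nu> (- x) = \<nu> x"
proof -
  have "\<nu> (- 1) + \<nu> (- 1) = 0"
    using val_mult[of "-1" "-1"] by simp
  hence "\<nu> (- 1) = 0"
    using nu_ereal[of "-1"] by (auto simp: zero_ereal_def)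
  thus ?thesis using val_mult[of "-1" x] by simp
qed

lemma nu_add_ge: "e \<le> \<nu> x \<Longrightarrow> e \<le> \<nu> y \<Longrightarrow> e \<le> \<nu> (x + y)"
  using val_add[of x y] by (meson min.boundedI order_trans)

lemma nu_add_gt: "e < \<nu> x \<Longrightarrow> e < \<nu> y \<Longrightarrow> e < \<nu> (x + y)"
  using val_add[of x y] by (meson min_less_iff_conj order_less_le_trans)

lemma nu_diff_ge: "e \<le> \<nu> x \<Longrightarrow> e \<le> \<nu> y \<Longrightarrow> e \<le> \<nu> (x - y)"
  using nu_add_ge[of e x "-y"] by simp

lemma nu_sum_ge: "(\<And>x. x \<in> A \<Longrightarrow> e \<le> \<nu> (f x)) \<Longrightarrow> e \<le> \<nu> (sum f A)"
  by (induction A rule: infinite_finite_induct) (auto intro: nu_add_ge)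

lemma nu_mult_ge: "ereal a \<le> \<nu> x \<Longrightarrow> ereal b \<le> \<nu> y \<Longrightarrow> ereal (a + b) \<le> \<nu> (x * y)"
  using add_mono[of "ereal a" "\<nu> x" "ereal b" "\<nu> y"] by (simp add: val_mult)

lemma nu_eqI:
  assumes "\<nu> x < \<nu> y"
  shows "\<nu> (x + y) = \<nu> x"
proof (rule antisym)
  show "\<nu> x \<le> \<nu> (x + y)"
    using assms by (intro nu_add_ge) auto
  show "\<nu> (x + y) \<le> \<nu> x"
    using assms val_add[of "x + y" "- y"] by (auto simp: min_def split: if_splits)
qed

lemma nu_power: "\<nu> x = ereal a \<Longrightarrow> \<nu> (x ^ n) = ereal (n * a)"
  by (induction n) (auto simp: val_mult algebra_simps zero_ereal_def)

lemma nu_inverse: "\<nu> x = ereal a \<Longrightarrow> \<nu> (inverse x) = ereal (- a)"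
proof -
  assume a: "\<nu> x = ereal a"
  hence "x \<noteq> 0" by auto
  hence "\<nu> x + \<nu> (inverse x) = 0" by (simp flip: val_mult)
  moreover obtain b where "\<nu> (inverse x) = ereal b"
    using \<open>x \<noteq> 0\<close> nu_ereal[of "inverse x"] by auto
  ultimately show ?thesis using a by (simp add: zero_ereal_def)
qed

lemma nu_divide: "\<nu> x = ereal a \<Longrightarrow> \<nu> y = ereal b \<Longrightarrow> \<nu> (x / y) = ereal (a - b)"
  by (simp add: divide_inverse val_mult nu_inverse)

lemma nu_p_power: "\<nu> (of_nat p ^ n) = ereal n"
  using nu_power[of "of_nat p" 1 n] val_p by (simp add: one_ereal_def)

lemma nu_of_nat_ge: "0 \<le> \<nu> (of_nat n)"
  by (induction n) (auto intro: nu_add_ge)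

lemma nu_of_int_ge: "0 \<le> \<nu> (of_int n)"
  by (cases n rule: int_cases2) (auto simp: nu_of_nat_ge)

lemma p_gt_1: "p > 1"
  using prime_p prime_gt_1_nat by blast

lemma nu_of_int_eq_0:
  assumes "\<not> int p dvd n"
  shows "\<nu> (of_int n) = 0"
proof (rule ccontr)
  assume "\<nu> (of_int n) \<noteq> 0"
  hence pos: "0 < \<nu> (of_int n)" using nu_of_int_ge[of n] by auto
  have "coprime (int p) n"
    using assms prime_p by (intro prime_imp_coprime) auto
  then obtain u w where uw: "u * int p + w * n = 1"
    using bezout_int[of "int p" n] by (auto simp: coprime_iff_gcd_eq_1)
  have "(of_int u :: 'k) * of_nat p + of_int w * of_int n = of_int (u * int p + w * n)"
    by simp
  hence "(of_int u :: 'k) * of_nat p + of_int w * of_int n = 1"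
    by (simp only: uw of_int_1)
  moreover have "0 < \<nu> (of_int u * of_nat p + of_int w * of_int n)"
    using pos nu_of_int_ge[of u] nu_of_int_ge[of w]
    by (intro nu_add_gt) (auto simp: val_mult val_p intro: add_nonneg_pos)
  ultimately show False by simp
qed

lemma nu_of_nat_eq_0: "\<not> p dvd n \<Longrightarrow> \<nu> (of_nat n) = 0"
  using nu_of_int_eq_0[of "int n"] by simp

lemma nu_of_int_ge_1:
  assumes "0 < \<nu> (of_int n)"
  shows "1 \<le> \<nu> (of_int n)"
proof -
  have "int p dvd n" using nu_of_int_eq_0[of n] assms by (cases "int p dvd n") auto
  then obtain k where "n = int p * k" by auto
  thus ?thesis using nu_of_int_ge[of k] add_mono[of 1 1 0 "\<nu> (of_int k)"] by (simp add: val_mult val_p)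
qed

lemma nu_of_nat_nat: "n > 0 \<Longrightarrow> \<exists>k. \<nu> (of_nat n) = ereal (real k)"
proof (induction n rule: less_induct)
  case (less n)
  show ?case
  proof (cases "p dvd n")
    case True
    then obtain k where k: "n = p * k" by auto
    hence "k > 0" "k < n" using less.prems p_gt_1 by (auto simp: gr0I)
    then obtain j where "\<nu> (of_nat k) = ereal (real j)" using less.IH by auto
    hence "\<nu> (of_nat n) = ereal (real (Suc j))"
      by (simp add: k val_mult val_p one_ereal_def)
    thus ?thesis by blast
  next
    case False
    thus ?thesis using nu_of_nat_eq_0[of n] by (intro exI[of _ 0]) (simp add: zero_ereal_def)
  qed
qed

lemma nu_Rats:
  assumes "q \<in> \<rat>" "q \<noteq> 0"
  shows "\<exists>k::int. \<nu> q = ereal (real_of_int k)"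
proof -
  obtain a b where ab: "b > 0" "q = of_int a / of_int b"
    using Rats_cases'[OF assms(1)] by metis
  obtain k where k: "\<nu> (of_nat (nat \<bar>a\<bar>)) = ereal (real k)"
    using nu_of_nat_nat[of "nat \<bar>a\<bar>"] assms(2) ab by auto
  have "\<nu> (of_int a) = ereal (real k)"
    using k by (auto simp: abs_if split: if_splits)
  moreover obtain l where "\<nu> (of_nat (nat b)) = ereal (real l)"
    using nu_of_nat_nat[of "nat b"] ab by auto
  hence "\<nu> (of_int b) = ereal (real l)" using ab by simp
  ultimately have "\<nu> q = ereal (real_of_int (int k - int l))"
    unfolding ab by (simp add: nu_divide)
  thus ?thesis by blast
qed

text \<open>A sufficiently close rational has the same valuation. Discreteness of the values is what
  turns positive valuation into valuation at least 1 on p-adic integers.\<close>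

lemma nu_Qp:
  assumes "z \<in> Qp \<nu>" "z \<noteq> 0"
  shows "\<exists>k::int. \<nu> z = ereal (real_of_int k)"
proof -
  obtain a where a: "\<nu> z = ereal a" using nu_ereal assms(2) by blast
  obtain N :: nat where N: "real N > a" using reals_Archimedean2 by blast
  obtain q where q: "q \<in> \<rat>" "ereal (real N) \<le> \<nu> (z - q)"
    using assms(1) by (auto simp: Qp_def)
  have lt: "\<nu> z < \<nu> (q - z)"
    using q(2) N a nu_minus[of "z - q"] by (simp add: less_le_trans[of _ "ereal (real N)"])
  hence eq: "\<nu> q = \<nu> z" using nu_eqI[of z "q - z"] by simp
  hence "q \<noteq> 0" using a by auto
  thus ?thesis using nu_Rats[OF q(1)] eq by simp
qed

section \<open>The valuation ring, its residue field and the prime field\<close>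

lemma Zpbar_iff: "x \<in> Zpbar \<nu> \<longleftrightarrow> 0 \<le> \<nu> x"
  by (simp add: Zpbar_def)

lemma Zpbar_add: "x \<in> Zpbar \<nu> \<Longrightarrow> y \<in> Zpbar \<nu> \<Longrightarrow> x + y \<in> Zpbar \<nu>"
  and Zpbar_mult: "x \<in> Zpbar \<nu> \<Longrightarrow> y \<in> Zpbar \<nu> \<Longrightarrow> x * y \<in> Zpbar \<nu>"
  and Zpbar_minus: "x \<in> Zpbar \<nu> \<Longrightarrow> - x \<in> Zpbar \<nu>"
  and Zpbar_of_nat: "of_nat n \<in> Zpbar \<nu>"
  and Zpbar_0: "0 \<in> Zpbar \<nu>"
  and Zpbar_1: "1 \<in> Zpbar \<nu>"
  by (simp_all add: Zpbar_iff nu_add_ge val_mult nu_of_nat_ge nu_of_int_ge)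

lemma Zpbar_diff: "x \<in> Zpbar \<nu> \<Longrightarrow> y \<in> Zpbar \<nu> \<Longrightarrow> x - y \<in> Zpbar \<nu>"
  using Zpbar_add[OF _ Zpbar_minus] by fastforce

lemma Zpbar_power: "x \<in> Zpbar \<nu> \<Longrightarrow> x ^ n \<in> Zpbar \<nu>"
  by (induction n) (auto intro: Zpbar_mult Zpbar_1)

lemma Zpbar_sum: "(\<And>x. x \<in> A \<Longrightarrow> f x \<in> Zpbar \<nu>) \<Longrightarrow> sum f A \<in> Zpbar \<nu>"
  by (induction A rule: infinite_finite_induct) (auto intro: Zpbar_add Zpbar_0)

lemma red_0 [simp]: "red 0 = 0"
  using red_eq_0[of 0] by (simp add: Zpbar_0)

lemma red_minus: "x \<in> Zpbar \<nu> \<Longrightarrow> red (- x) = - red x"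
  using red_add[of x "- x"] by (simp add: Zpbar_minus eq_neg_iff_add_eq_0 add.commute)

lemma red_diff: "x \<in> Zpbar \<nu> \<Longrightarrow> y \<in> Zpbar \<nu> \<Longrightarrow> red (x - y) = red x - red y"
  using red_add[of x "- y"] by (simp add: Zpbar_minus red_minus)

lemma red_power: "x \<in> Zpbar \<nu> \<Longrightarrow> red (x ^ n) = red x ^ n"
  by (induction n) (auto simp: red_one red_mult Zpbar_power)

lemma red_sum: "(\<And>x. x \<in> A \<Longrightarrow> f x \<in> Zpbar \<nu>) \<Longrightarrow> red (sum f A) = (\<Sum>x\<in>A. red (f x))"
  by (induction A rule: infinite_finite_induct) (auto simp: red_add Zpbar_sum)

lemma red_of_nat: "red (of_nat n) = of_nat n"
  by (induction n) (auto simp: red_add Zpbar_of_nat Zpbar_1 red_one)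

lemma red_eq_iff: "x \<in> Zpbar \<nu> \<Longrightarrow> y \<in> Zpbar \<nu> \<Longrightarrow> red x = red y \<longleftrightarrow> 0 < \<nu> (x - y)"
  using red_eq_0[of "x - y"] by (simp add: red_diff Zpbar_diff)

lemma of_nat_res_eq_0: "(of_nat n :: 'f) = 0 \<longleftrightarrow> p dvd n"
proof
  assume "(of_nat n :: 'f) = 0"
  hence "0 < \<nu> (of_nat n)" using red_eq_0[of "of_nat n"] by (simp add: red_of_nat Zpbar_of_nat)
  thus "p dvd n" using nu_of_nat_eq_0[of n] by (cases "p dvd n") auto
next
  assume "p dvd n"
  then obtain k where "n = p * k" by auto
  moreover have "(of_nat p :: 'f) = 0"
    using red_eq_0[of "of_nat p"] by (simp add: red_of_nat Zpbar_of_nat val_p)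
  ultimately show "(of_nat n :: 'f) = 0" by simp
qed

lemma CHAR_res: "CHAR('f) = p"
  by (rule CHAR_eqI) (auto simp: of_nat_res_eq_0)

lemma of_nat_res_power_p: "(of_nat n :: 'f) ^ p = of_nat n"
proof (induction n)
  case (Suc n)
  have "(1 + of_nat n :: 'f) ^ p = 1 ^ p + of_nat n ^ p"
    by (rule freshmans_dream) (simp_all add: CHAR_res prime_p)
  thus ?case using Suc by simp
qed (use p_gt_1 in simp)

lemma prime_field_power_p: "l \<in> prime_field \<Longrightarrow> l ^ p = (l :: 'f)"
  by (auto simp: prime_field_def of_nat_res_power_p)

lemma of_nat_res_mod: "(of_nat (n mod p) :: 'f) = of_nat n"
proof -
  have "(of_nat n :: 'f) = of_nat (n div p * p + n mod p)" by simp
  also have "\<dots> = of_nat (n mod p)"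
    unfolding of_nat_add using of_nat_res_eq_0[of "n div p * p"] by simp
  finally show ?thesis by simp
qed

lemma prime_field_eq: "(prime_field :: 'f set) = of_nat ` {..<p}"
proof -
  have "(of_nat n :: 'f) \<in> of_nat ` {..<p}" for n
    using of_nat_res_mod[of n] p_gt_1 by (intro rev_image_eqI[of "n mod p"]) auto
  thus ?thesis by (auto simp: prime_field_def)
qed

lemma inj_of_nat_res: "inj_on (of_nat :: nat \<Rightarrow> 'f) {..<p}"
proof (rule linorder_inj_onI')
  fix i j :: nat assume ij: "i \<in> {..<p}" "j \<in> {..<p}" "i < j"
  hence "\<not> p dvd j - i" by (auto dest: dvd_imp_le)
  moreover have "(of_nat j :: 'f) - of_nat i = of_nat (j - i)" using ij by (simp add: of_nat_diff)
  ultimately show "(of_nat i :: 'f) \<noteq> of_nat j"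
    using of_nat_res_eq_0[of "j - i"] by auto
qed

lemma finite_prime_field [simp]: "finite (prime_field :: 'f set)"
  and card_prime_field: "card (prime_field :: 'f set) = p"
  using inj_of_nat_res by (simp_all add: prime_field_eq card_image)

lemma zero_in_prime_field [simp]: "(0 :: 'f) \<in> prime_field"
  unfolding prime_field_def using of_nat_0 by (metis rangeI)

section \<open>The closure of the rationals and its valuation ring\<close>

lemma Qp_Rats: "q \<in> \<rat> \<Longrightarrow> q \<in> Qp \<nu>"
  unfolding Qp_def by (auto intro!: bexI[of _ q])

lemma Qp_add:
  assumes "x \<in> Qp \<nu>" "y \<in> Qp \<nu>"
  shows "x + y \<in> Qp \<nu>"
  unfolding Qp_def
proof (clarify)
  fix N :: nat
  obtain q where q: "q \<in> \<rat>" "ereal N \<le> \<nu> (x - q)"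
    using assms unfolding Qp_def by blast
  obtain q' where q': "q' \<in> \<rat>" "ereal N \<le> \<nu> (y - q')"
    using assms unfolding Qp_def by blast
  from q q' show "\<exists>q\<in>\<rat>. ereal N \<le> \<nu> (x + y - q)"
    using nu_add_ge[of N "x - q" "y - q'"]
    by (intro bexI[of _ "q + q'"]) (auto simp: algebra_simps)
qed

lemma Qp_minus:
  assumes "x \<in> Qp \<nu>"
  shows "- x \<in> Qp \<nu>"
  unfolding Qp_def
proof (clarify)
  fix N :: nat
  obtain q where q: "q \<in> \<rat>" "ereal N \<le> \<nu> (x - q)"
    using assms unfolding Qp_def by auto
  thus "\<exists>q\<in>\<rat>. ereal N \<le> \<nu> (- x - q)"
    using nu_minus[of "x - q"] by (intro bexI[of _ "- q"]) auto
qed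

lemma Qp_diff: "x \<in> Qp \<nu> \<Longrightarrow> y \<in> Qp \<nu> \<Longrightarrow> x - y \<in> Qp \<nu>"
  using Qp_add[OF _ Qp_minus] by fastforce

lemma nu_ge_nat: "\<exists>M::nat. ereal (- real M) \<le> \<nu> x"
proof (cases "x = 0")
  case False
  then obtain a where "\<nu> x = ereal a" using nu_ereal by blast
  moreover obtain M :: nat where "- a < M" using reals_Archimedean2 by blast
  ultimately show ?thesis by (intro exI[of _ M]) auto
qed auto

lemma Qp_mult:
  assumes "x \<in> Qp \<nu>" "y \<in> Qp \<nu>"
  shows "x * y \<in> Qp \<nu>"
  unfolding Qp_def
proof (clarify)
  fix N :: nat
  obtain A B :: nat where A: "ereal (- real A) \<le> \<nu> x" and B: "ereal (- real B) \<le> \<nu> y"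
    using nu_ge_nat by blast
  obtain q where q: "q \<in> \<rat>" "ereal (N + B) \<le> \<nu> (x - q)"
    using assms(1) unfolding Qp_def by blast
  obtain q' where q': "q' \<in> \<rat>" "ereal (N + A + B) \<le> \<nu> (y - q')"
    using assms(2) unfolding Qp_def by blast
  have "ereal (- real (A + B)) \<le> \<nu> (x - q)" "ereal (- real (A + B)) \<le> \<nu> x"
    using q(2) A by (auto intro: order_trans[rotated])
  hence "ereal (- real (A + B)) \<le> \<nu> q"
    using nu_diff_ge[of _ x "x - q"] by simp
  hence "ereal (- real (A + B) + (N + A + B)) \<le> \<nu> (q * (y - q'))"
    using q'(2) by (intro nu_mult_ge) auto
  moreover have "ereal (N + B + - real B) \<le> \<nu> ((x - q) * y)"
    using q(2) B by (intro nu_mult_ge)  auto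
  ultimately have "ereal N \<le> \<nu> ((x - q) * y + q * (y - q'))"
    by (intro nu_add_ge) auto
  thus "\<exists>q\<in>\<rat>. ereal N \<le> \<nu> (x * y - q)"
    using q q' by (intro bexI[of _ "q * q'"]) (auto simp: algebra_simps)
qed

lemma Zp_iff: "x \<in> Zp \<nu> \<longleftrightarrow> x \<in> Qp \<nu> \<and> 0 \<le> \<nu> x"
  by (auto simp: Zp_def Zpbar_iff)

lemma Zp_Zpbar: "x \<in> Zp \<nu> \<Longrightarrow> x \<in> Zpbar \<nu>"
  by (simp add: Zp_def)

lemma Zp_Qp: "x \<in> Zp \<nu> \<Longrightarrow> x \<in> Qp \<nu>"
  by (simp add: Zp_def)

lemma Qp_of_nat: "of_nat n \<in> Qp \<nu>"
  and Qp_0: "0 \<in> Qp \<nu>" and Qp_1: "1 \<in> Qp \<nu>"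
  by (auto intro: Qp_Rats)

lemma Zp_add: "x \<in> Zp \<nu> \<Longrightarrow> y \<in> Zp \<nu> \<Longrightarrow> x + y \<in> Zp \<nu>"
  and Zp_diff: "x \<in> Zp \<nu> \<Longrightarrow> y \<in> Zp \<nu> \<Longrightarrow> x - y \<in> Zp \<nu>"
  and Zp_mult: "x \<in> Zp \<nu> \<Longrightarrow> y \<in> Zp \<nu> \<Longrightarrow> x * y \<in> Zp \<nu>"
  and Zp_minus: "x \<in> Zp \<nu> \<Longrightarrow> - x \<in> Zp \<nu>"
  and Zp_of_nat: "of_nat n \<in> Zp \<nu>"
  and Zp_0: "0 \<in> Zp \<nu>"
  and Zp_1: "1 \<in> Zp \<nu>"
  unfolding Zp_def
  by (auto intro: Qp_add Qp_diff Qp_mult Qp_minus Qp_of_nat Qp_0 Qp_1 Zpbar_add Zpbar_diff Zpbar_mult Zpbar_minus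
      Zpbar_of_nat Zpbar_0 Zpbar_1)

text \<open>The residue field of the p-adic integers is the prime field: modulo p such an element is
  a fraction with denominator prime to p, hence an integer.\<close>

lemma red_Zp:
  assumes "z \<in> Zp \<nu>"
  shows "red z \<in> prime_field"
proof -
  have z: "z \<in> Qp \<nu>" "0 \<le> \<nu> z" using assms by (auto simp: Zp_iff)
  then obtain q where q: "q \<in> \<rat>" "ereal (real 1) \<le> \<nu> (z - q)" unfolding Qp_def by blast
  have q0: "0 \<le> \<nu> q" using nu_diff_ge[of 0 z "z - q"] z q(2) order_trans[of 0 "ereal 1" "\<nu> (z - q)"] by simp
  obtain a b where ab: "b > 0" "coprime a b" "q = of_int a / of_int b"
    using Rats_cases'[OF q(1)] by metis
  have nb: "\<not> int p dvd b"
  proof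
    assume *: "int p dvd b"
    have "\<not> int p dvd a"
    proof
      assume "int p dvd a"
      hence "int p dvd 1" using * ab(2) coprime_common_divisor by blast
      thus False using p_gt_1 by simp
    qed
    hence a0: "\<nu> (of_int a) = ereal 0" using nu_of_int_eq_0 by (simp add: zero_ereal_def)
    obtain k where k: "b = int p * k" using * by auto
    have "of_int b \<noteq> (0 :: 'k)" using ab(1) by simp
    then obtain \<beta> where \<beta>: "\<nu> (of_int b) = ereal \<beta>" using nu_ereal by blast
    have "1 \<le> \<nu> (of_int b)" using nu_of_int_ge_1[of b] nu_of_int_ge[of k]
      by (simp add: k val_mult val_p add_pos_nonneg)
    hence "\<beta> \<ge> 1" using \<beta> by (simp add: one_ereal_def)
    thus False using q0 nu_divide[OF a0 \<beta>] ab(3) by (simp add: zero_ereal_def)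
  qed
  have "coprime (int p) b"
    using nb prime_p by (intro prime_imp_coprime) auto
  then obtain u w where uw: "u * int p + w * b = 1"
    using bezout_int[of "int p" b] by (auto simp: coprime_iff_gcd_eq_1)
  \<comment> \<open>As w inverts b modulo p, the fraction a / b is congruent to the integer a
    w.\<close>
  define n where "n = nat ((a * w) mod int p)"
  have "int n = (a * w) mod int p" using p_gt_1 by (simp add: n_def)
  then obtain k where k: "int n = a * w + int p * k"
    by (metis mod_eqE mod_mod_trivial)
  have "a - int n * b = int p * (a * u - k * b)"
  proof -
    have "a - int n * b = a * (1 - w * b) - int p * k * b" unfolding k by (simp add: algebra_simps)
    also have "1 - w * b = u * int p" using uw by linarith
    finally show ?thesis by (simp add: algebra_simps)
  qed
  hence "(of_int (a - int n * b) :: 'k) = of_nat p * of_int (a * u - k * b)"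
    by (metis of_int_mult of_int_of_nat_eq)
  moreover have "q - of_nat n = of_int (a - int n * b) * inverse (of_int b)"
    using ab(1) by (simp add: ab(3) field_simps)
  ultimately have "q - of_nat n = of_nat p * of_int (a * u - k * b) * inverse (of_int b)" by simp
  moreover have "\<nu> (inverse (of_int b)) = 0"
    using nu_inverse[of "of_int b" 0] nu_of_int_eq_0[OF nb] by (simp add: zero_ereal_def)
  ultimately have "0 < \<nu> (q - of_nat n)"
    using nu_of_int_ge[of "a * u - k * b"] by (simp add: val_mult val_p add_pos_nonneg)
  moreover have "0 < \<nu> (z - q)" using q(2) by (simp add: one_ereal_def[symmetric] less_le_trans[of 0 1])
  ultimately have "0 < \<nu> ((z - q) + (q - of_nat n))" by (intro nu_add_gt)
  hence "red z = red (of_nat n)" using red_eq_iff[of z "of_nat n"] Zp_Zpbar[OF assms] by (simp add: Zpbar_of_nat)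
  thus ?thesis by (simp add: red_of_nat prime_field_def)
qed

text \<open>A lower bound for the Gauss valuation, that is, for the minimum of the valuations of the
  coefficients. The bound is real because \<open>ap\<close> may have fractional valuation.\<close>

definition vge :: "real \<Rightarrow> 'k poly poly \<Rightarrow> bool" where
  "vge e F \<longleftrightarrow> (\<forall>i j. ereal e \<le> \<nu> (coeff (coeff F j) i))"

lemma vge_0 [simp]: "vge e 0"
  by (simp add: vge_def)

lemma vge_add: "vge e F \<Longrightarrow> vge e G \<Longrightarrow> vge e (F + G)"
  by (simp add: vge_def nu_add_ge)

lemma vge_minus: "vge e F \<Longrightarrow> vge e (- F)"
  by (simp add: vge_def)

lemma vge_diff: "vge e F \<Longrightarrow> vge e G \<Longrightarrow> vge e (F - G)"
  by (simp add: vge_def nu_diff_ge)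

lemma vge_sum: "(\<And>x. x \<in> A \<Longrightarrow> vge e (f x)) \<Longrightarrow> vge e (sum f A)"
  by (induction A rule: infinite_finite_induct) (auto intro: vge_add)

lemma vge_mult: "vge e F \<Longrightarrow> vge e' G \<Longrightarrow> vge (e + e') (F * G)"
  unfolding vge_def coeff_coeff_mult by (auto intro!: nu_sum_ge nu_mult_ge)

lemma vge_mono: "vge e F \<Longrightarrow> e' \<le> e \<Longrightarrow> vge e' F"
  unfolding vge_def by (meson ereal_less_eq(3) order_trans)

lemma vge_mult0: "vge e F \<Longrightarrow> vge 0 G \<Longrightarrow> vge e (F * G)"
  and vge_0mult: "vge 0 F \<Longrightarrow> vge e G \<Longrightarrow> vge e (F * G)"
  using vge_mult[of e F 0 G] vge_mult[of 0 F e G] by simp_all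

lemma vge_const2: "vge e (const2 a) \<longleftrightarrow> ereal e \<le> \<nu> a"
proof -
  have "coeff (coeff (const2 a) j) i = (if i = 0 \<and> j = 0 then a else 0)" for i j
    using coeff_coeff_monom2[of a 0 0 j i] by auto
  thus ?thesis unfolding vge_def by (auto split: if_splits)
qed

lemma vge_monom: "vge 0 (varx ^ i * vary ^ j)"
proof -
  have "coeff (coeff (varx ^ i * vary ^ j) b) a = (if i = a \<and> j = b then 1 else 0 :: 'k)" for a b
    using coeff_coeff_monom2[of 1 i j b a] by auto
  thus ?thesis by (auto simp: vge_def zero_ereal_def[symmetric])
qed

lemma vge_varx: "vge 0 varx" and vge_vary: "vge 0 vary"
  using vge_monom[of 1 0] vge_monom[of 0 1] by simp_all

lemma vge_1: "vge 0 1"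
  using vge_monom[of 0 0] by simp

lemma vge_power: "vge e F \<Longrightarrow> vge (real n * e) (F ^ n)"
proof (induction n)
  case (Suc n)
  thus ?case using vge_mult[of e F "real n * e" "F ^ n"] by (simp add: algebra_simps)
qed (simp add: vge_1)

lemma vge_power0: "vge 0 F \<Longrightarrow> vge 0 (F ^ n)"
  using vge_power[of 0 F n] by simp

lemmas vge_intros = vge_add vge_minus vge_diff vge_sum vge_mult0 vge_1 vge_varx vge_vary vge_power0

lemma Sym_Zpbar_iff: "F \<in> Sym r (Zpbar \<nu>) \<longleftrightarrow> F \<in> Sym r UNIV \<and> vge 0 F"
  unfolding Sym_iff[of F r "Zpbar \<nu>"] by (auto simp: vge_def Zpbar_iff zero_ereal_def)

lemma vge_power_diff:
  assumes "vge 0 F" "vge 0 G" "vge e (F - G)"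
  shows "vge e (F ^ n - G ^ n)"
proof (cases n)
  case (Suc m)
  have "vge e ((F - G) * (\<Sum>i<Suc m. F ^ i * G ^ (m - i)))"
    using assms by (intro vge_mult0 vge_sum) (auto intro: vge_power0)
  thus ?thesis by (simp only: Suc power_Suc_diff)
qed simp

text \<open>In F^p - G^p = (F - G) S, the factor S has p summands, all congruent to G^(p-1) modulo
  p. So S is divisible by p, and one unit of valuation is gained.\<close>

lemma vge_power_p_diff:
  assumes "vge 0 F" "vge 0 G" "vge e (F - G)" "1 \<le> e"
  shows "vge (e + 1) (F ^ p - G ^ p)"
proof -
  obtain m where m: "p = Suc m" using p_gt_1 by (cases p) auto
  have "vge 1 (\<Sum>i<Suc m. F ^ i * G ^ (m - i) - G ^ i * G ^ (m - i))"
    using assms vge_mono[OF assms(3,4)]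
    by (intro vge_sum) (auto simp flip: left_diff_distrib intro!: vge_mult0 vge_power_diff intro: vge_power0)
  moreover have "(\<Sum>i<Suc m. G ^ i * G ^ (m - i)) = (\<Sum>i<Suc m. G ^ m)"
    by (intro sum.cong) (auto simp flip: power_add)
  hence "(\<Sum>i<Suc m. G ^ i * G ^ (m - i)) = const2 (of_nat p) * G ^ m"
    by (simp only: m const2_of_nat sum_constant card_lessThan)
  moreover have "vge 1 (const2 (of_nat p) * G ^ m)"
    using assms by (intro vge_mult0) (auto simp: vge_const2 val_p one_ereal_def[symmetric] intro: vge_power0)
  ultimately have "vge 1 (\<Sum>i<Suc m. F ^ i * G ^ (m - i))"
    using vge_add by (fastforce simp: sum_subtractf)
  hence "vge (e + 1) ((F - G) * (\<Sum>i<Suc m. F ^ i * G ^ (m - i)))"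
    using assms by (intro vge_mult)
  thus ?thesis by (simp only: m power_Suc_diff)
qed

lemma vge_power_p_power_diff:
  assumes "vge 0 F" "vge 0 G" "vge 1 (F - G)"
  shows "vge (real t + 1) (F ^ (p ^ t) - G ^ (p ^ t))"
proof (induction t)
  case (Suc t)
  have "vge (real t + 1 + 1) ((F ^ (p ^ t)) ^ p - (G ^ (p ^ t)) ^ p)"
    using Suc assms by (intro vge_power_p_diff vge_power0) auto
  thus ?case by (simp add: algebra_simps flip: power_mult)
qed (use assms in simp)

section \<open>Teichmueller lifts and their power sums\<close>

abbreviation teich :: "'f \<Rightarrow> 'k" where
  "teich \<equiv> teichmueller p \<nu> red"

text \<open>Otherwise z - z' cancels from z^p - z'^p = z - z'. What remains says that 1 equals a sum
  whose reduction is p times a power, that is 0.\<close>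

lemma teich_unique:
  assumes "z ^ p = z" "z' ^ p = z'" "z \<in> Zpbar \<nu>" "z' \<in> Zpbar \<nu>" "red z = red z'"
  shows "z = z'"
proof (rule ccontr)
  assume ne: "z \<noteq> z'"
  obtain m where m: "p = Suc m" using p_gt_1 by (cases p) auto
  have "z - z' = (z - z') * (\<Sum>i<Suc m. z ^ i * z' ^ (m - i))"
    using power_Suc_diff[of z m z'] assms(1,2) unfolding m by metis
  hence 1: "(\<Sum>i<Suc m. z ^ i * z' ^ (m - i)) = 1" using ne by simp
  have "red (\<Sum>i<Suc m. z ^ i * z' ^ (m - i)) = (\<Sum>i<Suc m. red z' ^ i * red z' ^ (m - i))"
    using assms(3-5) by (subst red_sum) (auto simp: red_mult red_power Zpbar_power intro: Zpbar_mult)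
  also have "\<dots> = (\<Sum>i<Suc m. red z' ^ m)"
    by (intro sum.cong) (auto simp flip: power_add)
  also have "\<dots> = of_nat p * red z' ^ m" by (simp add: m)
  also have "\<dots> = 0" using of_nat_res_eq_0[of p] by simp
  finally show False unfolding 1 red_one by simp
qed

text \<open>The lift of n is the limit of the integers n^(p^k). Consecutive terms agree modulo
  p^(k+1), so the sequence is Cauchy and the limit exists by completeness.\<close>

lemma teich_ex:
  assumes "l \<in> prime_field"
  shows "\<exists>z. z \<in> Zp \<nu> \<and> z ^ p = z \<and> red z = l"
proof -
  obtain n where n: "l = of_nat n" using assms by (auto simp: prime_field_def)
  define u where "u k = (of_nat (n ^ (p ^ k)) :: 'k)" for k
  have red_u: "red (u k) = l" for k
    unfolding u_def red_of_nat by (induction k) (simp_all add: n power_mult of_nat_res_power_p mult.commute flip: power_Suc2)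
  have u0: "0 \<le> \<nu> (u k)" for k unfolding u_def by (rule nu_of_nat_ge)
  have uR: "u k \<in> \<rat>" for k by (simp add: u_def)
  have uSuc: "u (Suc k) = u k ^ p" for k
    by (simp add: u_def flip: power_mult) (simp add: mult.commute)
  have step: "ereal (real k + 1) \<le> \<nu> (u (Suc k) - u k)" for k
  proof -
    have "0 < \<nu> (u 1 - u 0)"
      using red_eq_iff[of "u 1" "u 0"] red_u u0 by (simp add: Zpbar_iff)
    moreover have "u 1 - u 0 = of_int (int (n ^ p) - int n)" by (simp add: u_def)
    ultimately have "1 \<le> \<nu> (u 1 - u 0)" using nu_of_int_ge_1 by metis
    hence "vge 1 (const2 (u 1) - const2 (u 0))"
      by (simp add: vge_const2 one_ereal_def flip: const2_diff)
    hence "vge (real k + 1) (const2 (u 1) ^ (p ^ k) - const2 (u 0) ^ (p ^ k))"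
      using u0 by (intro vge_power_p_power_diff) (simp_all add: vge_const2 zero_ereal_def[symmetric])
    moreover have "u 1 ^ (p ^ k) = u (Suc k)" "u 0 ^ (p ^ k) = u k"
      by (simp_all add: u_def flip: power_mult)
    ultimately show ?thesis
      by (simp add: vge_const2 flip: const2_diff const2_power)
  qed
  have cauchy: "ereal (real k) \<le> \<nu> (u (k + m) - u k)" for k m
  proof (induction m)
    case (Suc m)
    have "ereal (real k) \<le> \<nu> (u (Suc (k + m)) - u (k + m))"
      using step[of "k + m"] by (rule order_trans[rotated]) simp
    from nu_add_ge[OF this Suc] show ?case by simp
  qed simp
  have cauchy': "ereal (real N) \<le> \<nu> (u m - u n)" if "m \<ge> N" "n \<ge> N" for m n N
  proof -
    from le_Suc_ex[OF that(1)] le_Suc_ex[OF that(2)] obtain a b where ab: "m = N + a" "n = N + b" by blast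
    have "ereal (real N) \<le> \<nu> ((u m - u N) - (u n - u N))"
      unfolding ab by (intro nu_diff_ge cauchy)
    thus ?thesis by simp
  qed
  obtain x where x: "\<And>N::nat. \<exists>M. \<forall>n\<ge>M. ereal (real N) \<le> \<nu> (u n - x)"
    using Qp_complete[of u] uR cauchy' by blast
  have x': "\<nu> (x - u n) = \<nu> (u n - x)" for n
    using nu_minus[of "x - u n"] by simp
  have xQ: "x \<in> Qp \<nu>"
    unfolding Qp_def
  proof (clarify)
    fix N :: nat
    obtain M where "\<forall>n\<ge>M. ereal (real N) \<le> \<nu> (u n - x)" using x by blast
    thus "\<exists>q\<in>\<rat>. ereal (real N) \<le> \<nu> (x - q)" using uR x' by (intro bexI[of _ "u M"]) auto
  qed
  obtain M where M: "ereal (real 1) \<le> \<nu> (u M - x)" using x[of 1] by blast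
  have x0: "0 \<le> \<nu> x"
  proof -
    have "0 \<le> \<nu> (u M - x)" using M by (rule order_trans[rotated]) (simp add: zero_ereal_def)
    from nu_diff_ge[OF u0[of M] this] show ?thesis by simp
  qed
  have xp: "x ^ p = x"
  proof (rule ccontr)
    assume "x ^ p \<noteq> x"
    then obtain a where a: "\<nu> (x ^ p - x) = ereal a" using nu_ereal[of "x ^ p - x"] by auto
    obtain N :: nat where N: "a < real N" using reals_Archimedean2 by blast
    obtain M where M: "\<And>n. n \<ge> M \<Longrightarrow> ereal (real N) \<le> \<nu> (u n - x)" using x[of N] by blast
    have "vge (real N) (const2 x ^ p - const2 (u M) ^ p)"
      using M[of M] x0 u0 x' by (intro vge_power_diff)
        (simp_all add: vge_const2 zero_ereal_def[symmetric] flip: const2_diff)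
    hence "ereal (real N) \<le> \<nu> (x ^ p - u (Suc M))"
      by (simp add: vge_const2 uSuc flip: const2_diff const2_power)
    from nu_add_ge[OF this M[of "Suc M"]] a N show False by simp
  qed
  have "0 < \<nu> (x - u M)" unfolding x' using M by (rule less_le_trans[rotated]) simp
  hence "red x = red (u M)" using red_eq_iff[of x "u M"] x0 u0 by (simp add: Zpbar_iff)
  thus ?thesis using xQ x0 xp red_u by (auto simp: Zp_iff)
qed

lemma
  assumes "l \<in> prime_field"
  shows teich_Zp: "teich l \<in> Zp \<nu>" and teich_power_p: "teich l ^ p = teich l"
    and red_teich: "red (teich l) = l"
proof -
  have "\<exists>!z. z \<in> Zp \<nu> \<and> z ^ p = z \<and> red z = l"
    using teich_ex[OF assms] by (metis teich_unique Zp_Zpbar)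
  hence "teich l \<in> Zp \<nu> \<and> teich l ^ p = teich l \<and> red (teich l) = l"
    unfolding teichmueller_def by (rule theI')
  thus "teich l \<in> Zp \<nu>" "teich l ^ p = teich l" "red (teich l) = l" by auto
qed

lemma teich_Zpbar: "l \<in> prime_field \<Longrightarrow> teich l \<in> Zpbar \<nu>"
  using teich_Zp Zp_Zpbar by blast

lemma teich_eqI: "z \<in> Zp \<nu> \<Longrightarrow> z ^ p = z \<Longrightarrow> teich (red z) = z"
  using red_Zp[of z]
  by (metis teich_unique teich_power_p teich_Zpbar Zp_Zpbar red_teich)

lemma teich_0 [simp]: "teich 0 = 0"
  using teich_eqI[of 0] p_gt_1 by (simp add: Zp_0)

lemma inj_teich: "inj_on teich prime_field"
  using red_teich by (metis inj_onI)

lemma teich_nz: "l \<in> prime_field \<Longrightarrow> l \<noteq> 0 \<Longrightarrow> teich l \<noteq> 0"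
  using red_teich[of l] by auto

lemma teich_power_p1:
  assumes "l \<in> prime_field" "l \<noteq> 0"
  shows "teich l ^ (p - 1) = 1"
proof -
  have "teich l ^ (p - 1) * teich l = 1 * teich l"
    using teich_power_p[OF assms(1)] p_gt_1 by (simp flip: power_Suc2)
  thus ?thesis using teich_nz[OF assms] by simp
qed

lemma teich_mult:
  assumes "l \<in> prime_field" "l' \<in> prime_field"
  shows "teich l * teich l' = teich (l * l')"
  using teich_eqI[of "teich l * teich l'"] assms
  by (simp add: Zp_mult teich_Zp power_mult_distrib teich_power_p red_mult red_teich teich_Zpbar)

lemma prime_field_mult: "l \<in> prime_field \<Longrightarrow> l' \<in> prime_field \<Longrightarrow> l * l' \<in> (prime_field :: 'f set)"
  by (auto simp: prime_field_def simp flip: of_nat_mult)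

lemma sum_teich_power_dvd:
  assumes "(p - 1) dvd k"
  shows "(\<Sum>l\<in>prime_field - {0}. teich l ^ k) = of_nat (p - 1)"
proof -
  obtain q where q: "k = (p - 1) * q" using assms by auto
  have "(\<Sum>l\<in>prime_field - {0}. teich l ^ k) = (\<Sum>l\<in>prime_field - {0 :: 'f}. 1)"
    by (intro sum.cong) (auto simp: q power_mult teich_power_p1 simp del: One_nat_def)
  thus ?thesis by (simp add: card_prime_field)
qed

text \<open>Multiplication by a fixed l0 permutes the summands and multiplies the sum by the j-th
  power of the lift of l0. Some l0 makes this factor different from 1, as X^j - 1 has at most j < p
  - 1 roots.\<close>

lemma sum_teich_power_not_dvd:
  assumes "\<not> (p - 1) dvd k"
  shows "(\<Sum>l\<in>prime_field - {0}. teich l ^ k) = 0"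
proof -
  define j where "j = k mod (p - 1)"
  have j: "0 < j" "j < p - 1" using assms p_gt_1 by (auto simp: j_def mod_greater_zero_iff_not_dvd)
  have red_j: "teich l ^ k = teich l ^ j" if "l \<in> prime_field - {0}" for l
  proof -
    have "teich l ^ k = (teich l ^ (p - 1)) ^ (k div (p - 1)) * teich l ^ j"
      by (simp add: j_def flip: power_mult power_add)
    thus ?thesis using that by (simp add: teich_power_p1 del: One_nat_def)
  qed
  have "\<exists>l0\<in>prime_field - {0}. teich l0 ^ j \<noteq> 1"
  proof (rule ccontr)
    assume "\<not> ?thesis"
    hence sub: "teich ` (prime_field - {0}) \<subseteq> {x. poly (monom 1 j - 1) x = 0}"
      by (auto simp: poly_monom)
    have "coeff (monom 1 j - 1 :: 'k poly) j = 1"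
      using j by (simp add: coeff_1)
    hence nz: "monom 1 j - 1 \<noteq> (0 :: 'k poly)" by (metis coeff_0 zero_neq_one)
    have "degree (monom 1 j - 1 :: 'k poly) \<le> j"
      by (rule order_trans[OF degree_diff_le_max]) (simp add: degree_monom_eq)
    moreover have "card (teich ` (prime_field - {0})) = p - 1"
      using inj_on_subset[OF inj_teich] by (subst card_image) (auto simp: card_prime_field)
    ultimately show False
      using card_mono[OF poly_roots_finite[OF nz] sub] card_poly_roots_bound[OF nz] j by simp
  qed
  then obtain l0 where l0: "l0 \<in> prime_field" "l0 \<noteq> 0" "teich l0 ^ j \<noteq> 1" by auto
  define S where "S = (\<Sum>l\<in>prime_field - {0}. teich l ^ j)"
  \<comment> \<open>By Fermat, l0^(p-2) is the inverse of l0, which keeps the inverse visibly in the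
    prime field.\<close>
  have inv: "l0 ^ (p - 2) \<in> prime_field" "l0 ^ (p - 2) * l0 = 1"
  proof -
    show "l0 ^ (p - 2) \<in> prime_field" using l0(1) by (auto simp: prime_field_def simp flip: of_nat_power)
    have "l0 ^ (p - 2) * l0 * l0 = 1 * l0"
      using prime_field_power_p[OF l0(1)] p_gt_1
      by (simp flip: power_Suc2 add: numeral_2_eq_2 Suc_diff_Suc)
    thus "l0 ^ (p - 2) * l0 = 1" using l0(2) by simp
  qed
  have "teich l0 ^ j * S = (\<Sum>l\<in>prime_field - {0}. teich (l0 * l) ^ j)"
    unfolding S_def sum_distrib_left using l0
    by (intro sum.cong) (auto simp flip: teich_mult simp: power_mult_distrib)
  also have "\<dots> = S" unfolding S_def
    using l0 inv by (intro sum.reindex_bij_witness[of _ "\<lambda>l. l0 ^ (p - 2) * l" "\<lambda>l. l0 * l"])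
      (auto simp: prime_field_mult mult.assoc[symmetric] mult.commute[of l0])
  finally have "S = 0" using l0(3) by simp
  thus ?thesis using red_j by (simp add: S_def)
qed

end

section \<open>Matrices and the action of \<open>KZ\<close>\<close>

text \<open>With this second infix \<open>$\<close> in scope, every matrix entry would parse in two ways.\<close>

no_notation fps_nth (infixl "$" 75)

lemma mat2_nth [simp]: "mat2 a b c d $ 1 $ 1 = a" "mat2 a b c d $ 1 $ 2 = b"
  "mat2 a b c d $ 2 $ 1 = c" "mat2 a b c d $ 2 $ 2 = d"
  by (simp_all add: mat2_def)

lemma mat_nth [simp]: "mat z $ (1::2) $ (1::2) = z" "mat z $ (1::2) $ (2::2) = 0"
  "mat z $ (2::2) $ (1::2) = 0" "mat z $ (2::2) $ (2::2) = z"
  by (simp_all add: mat_def)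

lemma mat2_eq_iff:
  fixes A B :: "'a ^ 2 ^ 2"
  shows "A = B \<longleftrightarrow> A $ 1 $ 1 = B $ 1 $ 1 \<and> A $ 1 $ 2 = B $ 1 $ 2 \<and>
    A $ 2 $ 1 = B $ 2 $ 1 \<and> A $ 2 $ 2 = B $ 2 $ 2"
  by (auto simp: vec_eq_iff forall_2)

lemma mult2_nth: "((A :: 'a::semiring_1 ^ 2 ^ 2) ** B) $ i $ j = A $ i $ 1 * B $ 1 $ j + A $ i $ 2 * B $ 2 $ j"
  by (simp add: matrix_matrix_mult_def sum_2)

lemma mat_mult_commute: "mat z ** A = A ** mat z" for A :: "'a::comm_ring_1 ^ 2 ^ 2"
  by (simp add: mat2_eq_iff mult2_nth mult.commute)

lemma mat_mult_mat: "mat y ** mat z = (mat (y * z) :: 'a::comm_ring_1 ^ 2 ^ 2)"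
  by (simp add: mat2_eq_iff mult2_nth)

lemma det_mat2: "det (mat z :: 'a::comm_ring_1 ^ 2 ^ 2) = z * z"
  by (simp add: det_2)

definition subring_set :: "'a::comm_ring_1 set \<Rightarrow> bool" where
  "subring_set R \<longleftrightarrow> 0 \<in> R \<and> 1 \<in> R \<and> (\<forall>a\<in>R. \<forall>b\<in>R. a + b \<in> R \<and> a * b \<in> R \<and> - a \<in> R)"

lemma GL2_iff: "g \<in> GL2 R \<longleftrightarrow> g $ 1 $ 1 \<in> R \<and> g $ 1 $ 2 \<in> R \<and> g $ 2 $ 1 \<in> R \<and> g $ 2 $ 2 \<in> R \<and>
  (\<exists>u\<in>R. det g * u = 1)"
  by (auto simp: GL2_def forall_2)

lemma GL2_mult:
  assumes "subring_set R" "g \<in> GL2 R" "h \<in> GL2 R"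
  shows "g ** h \<in> GL2 R"
proof -
  obtain u v where "u \<in> R" "det g * u = 1" "v \<in> R" "det h * v = 1"
    using assms by (auto simp: GL2_iff)
  moreover from this have "(det g * u) * (det h * v) = 1" by simp
  hence "det (g ** h) * (u * v) = 1" by (simp add: det_mul mult_ac)
  ultimately have "\<exists>w\<in>R. det (g ** h) * w = 1"
    using assms(1) by (intro bexI[of _ "u * v"]) (auto simp: subring_set_def)
  thus ?thesis using assms by (simp add: GL2_iff mult2_nth subring_set_def)
qed

lemma GL2_mat_1: "subring_set R \<Longrightarrow> mat 1 \<in> GL2 R"
  by (auto simp: GL2_iff subring_set_def)

lemma GL2_inverse:
  assumes "subring_set R" "g \<in> GL2 R"
  shows "matrix_inv g \<in> GL2 R \<and> g ** matrix_inv g = mat 1 \<and> matrix_inv g ** g = mat 1"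
proof -
  obtain u where u: "u \<in> R" "det g * u = 1" using assms by (auto simp: GL2_iff)
  define h where "h = mat2 (u * g $ 2 $ 2) (- (u * g $ 1 $ 2)) (- (u * g $ 2 $ 1)) (u * g $ 1 $ 1)"
  have u': "(g $ 1 $ 1 * g $ 2 $ 2 - g $ 1 $ 2 * g $ 2 $ 1) * u = 1" using u by (simp add: det_2)
  have hg: "g ** h = mat 1" "h ** g = mat 1"
    using u' by (simp_all add: mat2_eq_iff mult2_nth h_def algebra_simps)
  have inv: "g ** matrix_inv g = mat 1 \<and> matrix_inv g ** g = mat 1"
    unfolding matrix_inv_def by (rule someI[of _ h]) (simp add: hg)
  have "matrix_inv g = matrix_inv g ** (g ** h)" by (simp add: hg)
  also have "\<dots> = h" by (simp add: matrix_mul_assoc inv)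
  finally have "matrix_inv g = h" .
  moreover have "h \<in> GL2 R"
  proof -
    have "det h * det g = 1" using hg(2) by (metis det_mul det_I)
    moreover have "det g \<in> R" using assms by (auto simp: GL2_iff det_2 subring_set_def) (metis (no_types, lifting) diff_conv_add_uminus)
    ultimately have "\<exists>w\<in>R. det h * w = 1" by blast
    thus ?thesis using assms u(1) by (auto simp: GL2_iff h_def subring_set_def)
  qed
  ultimately show ?thesis using inv by simp
qed

definition red2 :: "('k::zero \<Rightarrow> 'f::zero) \<Rightarrow> 'k poly poly \<Rightarrow> 'f poly poly" where
  "red2 f F = map_poly (map_poly f) F"

context padic_alg_closure
begin

abbreviation G0 where "G0 \<equiv> GL2 (Qp \<nu>)"
abbreviation K0 where "K0 \<equiv> GL2 (Zp \<nu>)"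
abbreviation pk :: 'k where "pk \<equiv> of_nat p"

section \<open>\<open>KZ\<close> as the product of K and the powers of the scalar p\<close>

lemma subring_Qp: "subring_set (Qp \<nu>)" and subring_Zp: "subring_set (Zp \<nu>)"
  by (auto simp: subring_set_def Qp_0 Qp_1 Qp_add Qp_mult Qp_minus Zp_0 Zp_1 Zp_add Zp_mult Zp_minus)

lemma pk_nz [simp]: "pk \<noteq> 0"
  using p_gt_1 by simp

lemma p_pos [simp]: "0 < p"
  using p_gt_1 by simp

lemma powi_p_nz [simp]: "pk powi n \<noteq> 0"
  by simp

lemma powi_p_cancel: "pk powi n * pk powi (- n) = 1" "pk powi (- n) * pk powi n = 1"
  using powi_p_nz[of n] by (simp_all add: power_int_minus del: powi_p_nz)

lemma unit_square: "(x :: 'k) * u = 1 \<Longrightarrow> x * x * (u * u) = 1"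
  by (metis mult.assoc mult.left_commute mult_1_right)

lemma K0_G0: "k \<in> K0 \<Longrightarrow> k \<in> G0"
  by (auto simp: GL2_iff Zp_Qp)

lemmas G0_mult = GL2_mult[OF subring_Qp] and K0_mult = GL2_mult[OF subring_Zp]
  and G0_1 = GL2_mat_1[OF subring_Qp] and K0_1 = GL2_mat_1[OF subring_Zp]
lemmas G0_inv = GL2_inverse[OF subring_Qp] and K0_inv = GL2_inverse[OF subring_Zp]

lemma nu_det_K0: "k \<in> K0 \<Longrightarrow> \<nu> (det k) = 0"
proof -
  assume k: "k \<in> K0"
  then obtain u where u: "u \<in> Zp \<nu>" "det k * u = 1" by (auto simp: GL2_iff)
  have d: "det k \<in> Zp \<nu>" using k by (simp add: GL2_iff det_2 Zp_diff Zp_mult)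
  have "\<nu> (det k) + \<nu> u = 0" using u(2) by (simp flip: val_mult)
  moreover have "0 \<le> \<nu> (det k)" "0 \<le> \<nu> u" using u(1) d by (auto simp: Zp_iff)
  ultimately show ?thesis by (cases "\<nu> (det k)"; cases "\<nu> u") (auto simp: zero_ereal_def)
qed

lemma Zp_inverse:
  assumes "z \<in> Qp \<nu>" "u \<in> Qp \<nu>" "z * u = 1" "\<nu> z = 0"
  shows "z \<in> Zp \<nu>" "u \<in> Zp \<nu>"
proof -
  have "\<nu> z + \<nu> u = 0" using assms(3) by (simp flip: val_mult)
  thus "z \<in> Zp \<nu>" "u \<in> Zp \<nu>" using assms by (auto simp: Zp_iff)
qed

lemma K0I:
  assumes "g \<in> G0" "g $ 1 $ 1 \<in> Zp \<nu>" "g $ 1 $ 2 \<in> Zp \<nu>" "g $ 2 $ 1 \<in> Zp \<nu>" "g $ 2 $ 2 \<in> Zp \<nu>" "\<nu> (det g) = 0"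
  shows "g \<in> K0"
proof -
  obtain u where "u \<in> Qp \<nu>" "det g * u = 1" using assms(1) by (auto simp: GL2_iff)
  moreover have "det g \<in> Qp \<nu>" using assms by (simp add: det_2 Zp_diff Zp_mult Zp_Qp)
  ultimately show ?thesis using assms Zp_inverse[of "det g" u] by (auto simp: GL2_iff)
qed

lemma mat_K0: "z \<in> Zp \<nu> \<Longrightarrow> u \<in> Zp \<nu> \<Longrightarrow> z * u = 1 \<Longrightarrow> mat z \<in> K0"
  by (auto simp: GL2_iff det_mat2 Zp_0 Zp_mult unit_square intro!: bexI[of _ "u * u"])

lemma powi_p_Rats: "pk powi n \<in> \<rat>"
  by (auto simp: power_int_def)

lemma nu_powi_p: "\<nu> (pk powi n) = ereal (real_of_int n)"
  by (cases "n \<ge> 0") (auto simp: power_int_def nu_p_power power_inverse nu_inverse)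

lemma mat_powi_G0: "mat (pk powi n) \<in> G0"
proof -
  show ?thesis using Qp_Rats[OF powi_p_Rats[of n]] Qp_Rats[OF powi_p_Rats[of "- n"]]
    by (auto simp: GL2_iff det_mat2 Qp_0 Qp_mult unit_square powi_p_cancel
        intro!: bexI[of _ "pk powi (- n) * pk powi (- n)"])
qed

lemma center_G0: "z \<in> group_center G0 \<longleftrightarrow> (\<exists>\<zeta>. z = mat \<zeta> \<and> \<zeta> \<in> Qp \<nu> \<and> (\<exists>u\<in>Qp \<nu>. \<zeta> * u = 1))"
proof
  assume z: "z \<in> group_center G0"
  \<comment> \<open>Commuting with these two unipotent matrices already forces a matrix to be
    scalar.\<close>
  have "mat2 1 1 0 1 \<in> G0" "mat2 1 0 1 1 \<in> G0" by (auto simp: GL2_iff Qp_0 Qp_1 det_2)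
  hence c: "z ** mat2 1 1 0 1 = mat2 1 1 0 1 ** z" "z ** mat2 1 0 1 1 = mat2 1 0 1 1 ** z" and zG: "z \<in> G0"
    using z by (auto simp: group_center_def)
  hence "z = mat (z $ 1 $ 1)" by (simp add: mat2_eq_iff mult2_nth)
  moreover from this obtain u where "u \<in> Qp \<nu>" "z $ 1 $ 1 * z $ 1 $ 1 * u = 1"
    using zG by (metis GL2_iff det_mat2)
  ultimately show "\<exists>\<zeta>. z = mat \<zeta> \<and> \<zeta> \<in> Qp \<nu> \<and> (\<exists>u\<in>Qp \<nu>. \<zeta> * u = 1)"
    using zG by (intro exI[of _ "z $ 1 $ 1"]) (auto simp: GL2_iff Qp_mult mult.assoc intro!: bexI[of _ "z $ 1 $ 1 * u"])
next
  assume "\<exists>\<zeta>. z = mat \<zeta> \<and> \<zeta> \<in> Qp \<nu> \<and> (\<exists>u\<in>Qp \<nu>. \<zeta> * u = 1)"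
  then obtain \<zeta> u where "z = mat \<zeta>" "\<zeta> \<in> Qp \<nu>" "u \<in> Qp \<nu>" "\<zeta> * u = 1" by auto
  thus "z \<in> group_center G0"
    by (auto simp: group_center_def mat_mult_commute GL2_iff Qp_0 det_mat2 Qp_mult unit_square
        intro!: bexI[of _ "u * u"])
qed

text \<open>A central scalar has integral valuation n, so it is p^n times a unit, and the unit is
  absorbed into K.\<close>

lemma KZ_iff: "g \<in> KZ \<nu> \<longleftrightarrow> (\<exists>n k. g = mat (pk powi n) ** k \<and> k \<in> K0)"
proof
  assume "g \<in> KZ \<nu>"
  then obtain k z where kz: "g = k ** z" "k \<in> K0" "z \<in> group_center G0" by (auto simp: KZ_def)
  then obtain \<zeta> u where z: "z = mat \<zeta>" "\<zeta> \<in> Qp \<nu>" "u \<in> Qp \<nu>" "\<zeta> * u = 1" using center_G0 by auto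
  then have "\<zeta> \<noteq> 0" by auto
  then obtain n where n: "\<nu> \<zeta> = ereal (real_of_int n)" using nu_Qp z(2) by blast
  define \<eta> where "\<eta> = pk powi (- n) * \<zeta>"
  have eta: "pk powi n * \<eta> = \<zeta>" unfolding \<eta>_def by (simp add: powi_p_cancel flip: mult.assoc)
  have "\<nu> \<eta> = 0" by (simp add: \<eta>_def val_mult nu_powi_p n zero_ereal_def)
  moreover have "\<eta> * (u * pk powi n) = 1" unfolding z(4)[symmetric] eta[symmetric] by (simp add: mult_ac)
  moreover have "\<eta> \<in> Qp \<nu>" "u * pk powi n \<in> Qp \<nu>"
    unfolding \<eta>_def by (intro Qp_mult z Qp_Rats powi_p_Rats)+
  ultimately have "mat \<eta> \<in> K0" using Zp_inverse[of \<eta> "u * pk powi n"] by (intro mat_K0) auto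
  hence "k ** mat \<eta> \<in> K0" using kz K0_mult by blast
  moreover have "g = mat (pk powi n) ** (k ** mat \<eta>)"
    unfolding kz z eta[symmetric] mat_mult_mat[symmetric] matrix_mul_assoc
    by (simp add: mat_mult_commute[of _ k])
  ultimately show "\<exists>n k. g = mat (pk powi n) ** k \<and> k \<in> K0" by blast
next
  assume "\<exists>n k. g = mat (pk powi n) ** k \<and> k \<in> K0"
  then obtain n k where nk: "g = mat (pk powi n) ** k" "k \<in> K0" by blast
  have "mat (pk powi n) \<in> group_center G0"
    unfolding center_G0 using Qp_Rats[OF powi_p_Rats[of n]] Qp_Rats[OF powi_p_Rats[of "- n"]]
    by (intro exI[of _ "pk powi n"]) (auto simp: powi_p_cancel intro!: bexI[of _ "pk powi (- n)"])
  thus "g \<in> KZ \<nu>" using nk by (auto simp: KZ_def mat_mult_commute)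
qed

text \<open>The determinant has valuation 2n, which determines the power of p and with it the
  K-component, so the description in \<open>K_part\<close> has a unique solution.\<close>

lemma K_part_eq: "k \<in> K0 \<Longrightarrow> K_part p \<nu> (mat (pk powi n) ** k) = k"
  unfolding K_part_def
proof (rule the_equality)
  fix k' assume k: "k \<in> K0" and "k' \<in> K0 \<and> (\<exists>m. mat (pk powi n) ** k = mat (pk powi m) ** k')"
  then obtain m where k': "k' \<in> K0" and eq: "mat (pk powi n) ** k = mat (pk powi m) ** k'" by blast
  have "\<nu> (det (mat (pk powi n) ** k)) = ereal (2 * real_of_int n)"
    and "\<nu> (det (mat (pk powi m) ** k')) = ereal (2 * real_of_int m)"
    using nu_det_K0[OF k] nu_det_K0[OF k'] by (simp_all add: det_mul det_mat2 val_mult nu_powi_p)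
  hence nm: "n = m" using eq by simp
  have "k = mat (pk powi (- n)) ** (mat (pk powi n) ** k)"
    by (simp add: matrix_mul_assoc mat_mult_mat powi_p_cancel)
  also have "\<dots> = k'"
    unfolding eq unfolding nm by (simp add: matrix_mul_assoc mat_mult_mat powi_p_cancel)
  finally show "k' = k" by simp
qed blast

lemma KZ_decomp: "g \<in> KZ \<nu> \<Longrightarrow> K_part p \<nu> g \<in> K0 \<and> (\<exists>n. g = mat (pk powi n) ** K_part p \<nu> g)"
  unfolding KZ_iff by (metis K_part_eq)

lemma K0_KZ: "k \<in> K0 \<Longrightarrow> k \<in> KZ \<nu>" and K_part_K0: "k \<in> K0 \<Longrightarrow> K_part p \<nu> k = k"
  using K_part_eq[of k 0] by (auto simp: KZ_iff intro!: exI[of _ "0 :: int"] exI[of _ k])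

lemma powi_KZ: "mat (pk powi n) \<in> KZ \<nu>" and K_part_powi: "K_part p \<nu> (mat (pk powi n)) = mat 1"
  using K_part_eq[OF K0_1, of n] K0_1 by (auto simp: KZ_iff intro!: exI[of _ n] exI[of _ "mat 1"])

lemma KZ_G0: "g \<in> KZ \<nu> \<Longrightarrow> g \<in> G0"
  by (metis KZ_iff G0_mult mat_powi_G0 K0_G0)

lemma
  assumes "g \<in> KZ \<nu>" "h \<in> KZ \<nu>"
  shows KZ_mult: "g ** h \<in> KZ \<nu>" and K_part_mult: "K_part p \<nu> (g ** h) = K_part p \<nu> g ** K_part p \<nu> h"
proof -
  obtain n m k k' where gh: "g = mat (pk powi n) ** k" "h = mat (pk powi m) ** k'" "k \<in> K0" "k' \<in> K0"
    using assms by (auto simp: KZ_iff)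
  have "g ** h = mat (pk powi n) ** (k ** mat (pk powi m)) ** k'"
    unfolding gh by (simp add: matrix_mul_assoc)
  also have "\<dots> = mat (pk powi n * pk powi m) ** (k ** k')"
    unfolding mat_mult_commute[of _ k, symmetric] by (simp add: matrix_mul_assoc mat_mult_mat)
  also have "pk powi n * pk powi m = pk powi (n + m)" by (simp add: power_int_add)
  finally have *: "g ** h = mat (pk powi (n + m)) ** (k ** k')" .
  show "g ** h \<in> KZ \<nu>" "K_part p \<nu> (g ** h) = K_part p \<nu> g ** K_part p \<nu> h"
    unfolding * using gh K0_mult by (auto simp: KZ_iff K_part_eq)
qed

lemma KZ_inv:
  assumes "g \<in> KZ \<nu>"
  shows "matrix_inv g \<in> KZ \<nu>"
proof -
  obtain n k where g: "g = mat (pk powi n) ** k" "k \<in> K0"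
    using assms by (auto simp: KZ_iff)
  have gG: "g \<in> G0" using assms KZ_G0 by blast
  have "g ** (mat (pk powi (- n)) ** matrix_inv k) = mat (pk powi n) ** (k ** mat (pk powi (- n))) ** matrix_inv k"
    unfolding g by (simp add: matrix_mul_assoc)
  also have "\<dots> = mat (pk powi n) ** mat (pk powi (- n)) ** (k ** matrix_inv k)"
    unfolding mat_mult_commute[of _ k, symmetric] by (simp add: matrix_mul_assoc)
  also have "\<dots> = mat 1"
    using K0_inv[OF g(2)] by (simp add: mat_mult_mat powi_p_cancel)
  finally have "g ** (mat (pk powi (- n)) ** matrix_inv k) = mat 1" .
  hence "matrix_inv g ** g ** (mat (pk powi (- n)) ** matrix_inv k) = matrix_inv g"
    by (metis matrix_mul_assoc matrix_mul_rid)
  hence "matrix_inv g = mat (pk powi (- n)) ** matrix_inv k"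
    using G0_inv[OF gG] by simp
  thus ?thesis using K0_inv[OF g(2)] KZ_iff by blast
qed

section \<open>The action of \<open>KZ\<close> on forms\<close>

abbreviation act :: "'k ^ 2 ^ 2 \<Rightarrow> 'k poly poly \<Rightarrow> 'k poly poly" where
  "act \<equiv> mat_act (\<lambda>a. a)"

abbreviation kzact :: "'k ^ 2 ^ 2 \<Rightarrow> 'k poly poly \<Rightarrow> 'k poly poly" where
  "kzact \<equiv> KZ_act p \<nu> (\<lambda>a. a)"

lemma kzact_mult: "g \<in> KZ \<nu> \<Longrightarrow> h \<in> KZ \<nu> \<Longrightarrow> kzact g (kzact h F) = kzact (g ** h) F"
  by (simp add: KZ_act_def K_part_mult mat_act_compose)

lemma kzact_1: "kzact (mat 1) F = F"
  by (simp add: KZ_act_def K_part_K0 K0_1 mat_act_mat_1)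

lemma kzact_inv: "g \<in> KZ \<nu> \<Longrightarrow> kzact g (kzact (matrix_inv g) F) = F"
  using G0_inv[of g] KZ_G0[of g] by (auto simp: kzact_mult KZ_inv kzact_1)

lemma kzact_0 [simp]: "kzact g 0 = 0"
  and kzact_add: "kzact g (F + F') = kzact g F + kzact g F'"
  and kzact_const2: "kzact g (const2 a * F) = const2 a * kzact g F"
  by (simp_all add: KZ_act_def mat_act_simps)

lemma vge_act:
  assumes "F \<in> Sym r UNIV" "vge e F" "\<And>i j. 0 \<le> \<nu> (g $ i $ j)"
  shows "vge e (act g F)"
proof -
  have g: "vge 0 (const2 (g $ i $ j))" for i j
    using assms(3) by (simp add: vge_const2 zero_ereal_def[symmetric])
  have "vge e (act g (const2 (coeff (coeff F j) i) * varx ^ i * vary ^ j))" for i j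
    using assms(2) unfolding mat_act_simps mat_act_const2 mult.assoc
    by (intro vge_intros g) (auto simp: vge_const2 vge_def[of e F])
  thus ?thesis
    by (subst Sym_decomp[OF assms(1)]) (auto simp: mat_act_sum intro!: vge_sum)
qed

lemma K0_nu: "k \<in> K0 \<Longrightarrow> 0 \<le> \<nu> (k $ i $ j)"
  by (auto simp: GL2_def Zp_iff)

lemma vge_kzact: "h \<in> KZ \<nu> \<Longrightarrow> F \<in> Sym r UNIV \<Longrightarrow> vge e F \<Longrightarrow> vge e (kzact h F)"
  unfolding KZ_act_def using KZ_decomp[of h] by (intro vge_act) (auto intro: K0_nu)

lemma Sym_kzact: "F \<in> Sym r UNIV \<Longrightarrow> kzact h F \<in> Sym r UNIV"
  unfolding KZ_act_def by (rule Sym_mat_act)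

section \<open>Reduction of forms modulo the maximal ideal\<close>

lemma coeff_red2: "coeff (coeff (red2 red F) j) i = red (coeff (coeff F j) i)"
  by (simp add: red2_def coeff_map_poly)

lemma vge0_Zpbar: "vge 0 F \<longleftrightarrow> (\<forall>i j. coeff (coeff F j) i \<in> Zpbar \<nu>)"
  by (simp add: vge_def Zpbar_iff zero_ereal_def)

lemma red2_0 [simp]: "red2 red 0 = 0"
  by (simp add: red2_def)

lemma poly2_eqI: "(\<And>i j. coeff (coeff F j) i = coeff (coeff G j) i) \<Longrightarrow> F = G"
  by (intro poly_eqI)

lemma red2_add: "vge 0 F \<Longrightarrow> vge 0 G \<Longrightarrow> red2 red (F + G) = red2 red F + red2 red G"
  by (rule poly2_eqI) (simp add: coeff_red2 vge0_Zpbar red_add)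

lemma red2_diff: "vge 0 F \<Longrightarrow> vge 0 G \<Longrightarrow> red2 red (F - G) = red2 red F - red2 red G"
  by (rule poly2_eqI) (simp add: coeff_red2 vge0_Zpbar red_diff)

lemma red2_mult: "vge 0 F \<Longrightarrow> vge 0 G \<Longrightarrow> red2 red (F * G) = red2 red F * red2 red G"
  by (rule poly2_eqI) (simp add: coeff_red2 vge0_Zpbar coeff_coeff_mult red_sum Zpbar_sum Zpbar_mult red_mult)

lemma red2_const2 [simp]: "red2 red (const2 a) = const2 (red a)"
  by (simp add: red2_def const2_def map_poly_pCons)

lemma red2_varx [simp]: "red2 red varx = varx" and red2_vary [simp]: "red2 red vary = vary"
  and red2_1 [simp]: "red2 red 1 = 1"
  using red2_const2[of 1] by (simp_all add: red2_def varx_def vary_def map_poly_pCons red_one)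

lemma red2_power: "vge 0 F \<Longrightarrow> red2 red (F ^ n) = red2 red F ^ n"
  by (induction n) (simp_all add: red2_mult vge_power0)

lemma red2_sum: "(\<And>x. x \<in> A \<Longrightarrow> vge 0 (f x)) \<Longrightarrow> red2 red (sum f A) = (\<Sum>x\<in>A. red2 red (f x))"
  by (induction A rule: infinite_finite_induct) (auto simp: red2_add vge_sum)

lemma red2_eq_0_iff: "vge 0 F \<Longrightarrow> red2 red F = 0 \<longleftrightarrow> (\<forall>i j. 0 < \<nu> (coeff (coeff F j) i))"
proof -
  assume F: "vge 0 F"
  have "red2 red F = 0 \<longleftrightarrow> (\<forall>i j. red (coeff (coeff F j) i) = 0)"
    by (auto simp: poly_eq_iff coeff_red2)
  thus ?thesis using F by (simp add: red_eq_0 vge0_Zpbar)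
qed

lemma Sym_red2: "F \<in> Sym r UNIV \<Longrightarrow> red2 red F \<in> Sym r UNIV"
  by (auto simp: Sym_def coeff_red2) (metis red_0)

lemma red2_act:
  assumes "F \<in> Sym r UNIV" "vge 0 F" "k \<in> K0"
  shows "red2 red (act k F) = mat_act red k (red2 red F)"
proof -
  have k: "vge 0 (const2 (k $ i $ j))" for i j
    using K0_nu[OF assms(3), of i j] by (simp add: vge_const2 zero_ereal_def[symmetric])
  have a: "vge 0 (const2 (coeff (coeff F j) i))" for i j
    using assms(2) by (simp add: vge_const2 vge_def[of 0 F])
  note i = vge_intros k a
  have "red2 red (act k F) = (\<Sum>j\<le>r. red2 red (act k (const2 (coeff (coeff F j) (r - j)) * varx ^ (r - j) * vary ^ j)))"
    by (subst Sym_decomp[OF assms(1)], unfold mat_act_sum, rule red2_sum) (simp add: mat_act_simps i)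
  also have "\<dots> = (\<Sum>j\<le>r. mat_act red k (red2 red (const2 (coeff (coeff F j) (r - j)) * varx ^ (r - j) * vary ^ j)))"
    by (intro sum.cong refl) (simp add: mat_act_simps red2_mult red2_power red2_add i)
  also have "\<dots> = mat_act red k (red2 red F)"
    by (subst (2) Sym_decomp[OF assms(1)], subst red2_sum) (simp_all add: i mat_act_sum)
  finally show ?thesis .
qed

lemma red2_kzact:
  "h \<in> KZ \<nu> \<Longrightarrow> F \<in> Sym r UNIV \<Longrightarrow> vge 0 F \<Longrightarrow> red2 red (kzact h F) = KZ_act p \<nu> red h (red2 red F)"
  unfolding KZ_act_def using KZ_decomp[of h] by (intro red2_act) auto

lemma red2_lift:
  assumes "F \<in> Sym r UNIV"
  shows "\<exists>F'. F' \<in> Sym r UNIV \<and> vge 0 F' \<and> red2 red F' = F"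
proof -
  have "\<forall>a. \<exists>x. x \<in> Zpbar \<nu> \<and> red x = a" using red_surj by (metis UNIV_I imageE)
  then obtain s where s: "\<And>a. s a \<in> Zpbar \<nu>" "\<And>a. red (s a) = a" by metis
  define F' where "F' = (\<Sum>j\<le>r. const2 (s (coeff (coeff F j) (r - j))) * varx ^ (r - j) * vary ^ j)"
  have c: "vge 0 (const2 (s a))" for a using s(1) by (simp add: vge_const2 Zpbar_iff zero_ereal_def)
  have "F' \<in> Sym r UNIV" unfolding F'_def
    by (intro Sym_sum) (simp add: mult.assoc Sym_const2_mult Sym_monom)
  moreover have "vge 0 F'" unfolding F'_def by (intro vge_intros c)
  moreover have "red2 red F' = F"
    unfolding F'_def by (subst (2) Sym_decomp[OF assms], subst red2_sum)
      (simp_all add: red2_mult red2_power vge_intros c s)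
  ultimately show ?thesis by blast
qed

end

section \<open>Compact induction\<close>

definition adj2 :: "'a::comm_ring_1 ^ 2 ^ 2 \<Rightarrow> 'a ^ 2 ^ 2" where
  "adj2 A = mat2 (A $ 2 $ 2) (- A $ 1 $ 2) (- A $ 2 $ 1) (A $ 1 $ 1)"

lemma adj2_mult: "adj2 A ** A = mat (det A)" "A ** adj2 A = mat (det A)"
  by (simp_all add: mat2_eq_iff mult2_nth adj2_def det_2 algebra_simps)

context padic_alg_closure
begin

abbreviation br :: "'k ^ 2 ^ 2 \<Rightarrow> 'k poly poly \<Rightarrow> 'k ^ 2 ^ 2 \<Rightarrow> 'k poly poly" where
  "br \<equiv> bracket p \<nu>"

lemma br_def: "br g v g' = (if g' ** g \<in> KZ \<nu> then kzact (g' ** g) v else 0)"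
  by (simp add: bracket_def)

lemma br_0 [simp]: "br g 0 = (\<lambda>_. 0)"
  by (auto simp: br_def)

lemma br_add: "br g (v + w) x = br g v x + br g w x"
  by (simp add: br_def kzact_add)

lemma br_const2: "br g (const2 a * v) x = const2 a * br g v x"
  by (simp add: br_def kzact_const2)

lemma KZ_cancel_right:
  assumes "h \<in> KZ \<nu>"
  shows "g ** h \<in> KZ \<nu> \<longleftrightarrow> g \<in> KZ \<nu>"
proof
  assume "g ** h \<in> KZ \<nu>"
  hence "g ** h ** matrix_inv h \<in> KZ \<nu>" using KZ_mult KZ_inv assms by blast
  moreover have "g ** h ** matrix_inv h = g"
    using G0_inv[OF KZ_G0[OF assms]] by (metis matrix_mul_assoc matrix_mul_rid)
  ultimately show "g \<in> KZ \<nu>" by simp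
qed (use KZ_mult assms in blast)

lemma br_KZ:
  assumes "h \<in> KZ \<nu>"
  shows "br (g ** h) v = br g (kzact h v)"
  using assms by (auto simp: br_def matrix_mul_assoc KZ_cancel_right kzact_mult)

text \<open>G acts on the compact induction by right translation of the argument; in this action x
  sends [g, v] to [xg, v].\<close>

lemma br_translate: "br (x ** g) v g' = br g v (g' ** x)"
  by (simp add: br_def matrix_mul_assoc)

abbreviation IQ :: "nat \<Rightarrow> ('k ^ 2 ^ 2 \<Rightarrow> 'k poly poly) set" where "IQ r \<equiv> ind_Qpbar p \<nu> r"
abbreviation IZ :: "nat \<Rightarrow> ('k ^ 2 ^ 2 \<Rightarrow> 'k poly poly) set" where "IZ r \<equiv> ind_Zpbar p \<nu> r"

lemma br_c_ind:
  assumes "g \<in> G0" "v \<in> M" "0 \<in> M" "\<And>h v. h \<in> KZ \<nu> \<Longrightarrow> v \<in> M \<Longrightarrow> kzact h v \<in> M"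
  shows "br g v \<in> c_ind p \<nu> (\<lambda>a. a) M"
proof -
  note gi = G0_inv[OF assms(1)]
  have cancel: "x ** g ** matrix_inv g = x" for x
    using gi by (metis matrix_mul_assoc matrix_mul_rid)
  have G: "x \<in> G0" if "x ** g \<in> KZ \<nu>" for x
    using cancel[of x] that KZ_G0 G0_mult gi by metis
  have eqv: "br g v (h ** x) = kzact h (br g v x)" if h: "h \<in> KZ \<nu>" for h x
  proof -
    have "h ** x ** g \<in> KZ \<nu> \<longleftrightarrow> x ** g \<in> KZ \<nu>"
    proof
      assume "h ** x ** g \<in> KZ \<nu>"
      hence "matrix_inv h ** (h ** x ** g) \<in> KZ \<nu>" using KZ_mult KZ_inv h by blast
      moreover have "matrix_inv h ** (h ** x ** g) = x ** g"
        using G0_inv[OF KZ_G0[OF h]] by (metis matrix_mul_assoc matrix_mul_lid)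
      ultimately show "x ** g \<in> KZ \<nu>" by simp
    qed (metis KZ_mult h matrix_mul_assoc)
    thus ?thesis using h by (auto simp: br_def kzact_mult matrix_mul_assoc)
  qed
  have "{x. br g v x \<noteq> 0} \<subseteq> (\<Union>s\<in>{matrix_inv g}. {h ** s | h. h \<in> KZ \<nu>})"
  proof
    fix x assume "x \<in> {x. br g v x \<noteq> 0}"
    hence "x ** g \<in> KZ \<nu>" by (auto simp: br_def split: if_splits)
    thus "x \<in> (\<Union>s\<in>{matrix_inv g}. {h ** s | h. h \<in> KZ \<nu>})" using cancel[of x] by force
  qed
  hence "\<exists>S. finite S \<and> S \<subseteq> G0 \<and> {x. br g v x \<noteq> 0} \<subseteq> (\<Union>s\<in>S. {h ** s | h. h \<in> KZ \<nu>})"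
    using gi by (intro exI[of _ "{matrix_inv g}"]) auto
  moreover have "\<forall>x\<in>G0. br g v x \<in> M" using assms by (auto simp: br_def)
  moreover have "\<forall>x. x \<notin> G0 \<longrightarrow> br g v x = 0" using G by (auto simp: br_def)
  ultimately show ?thesis unfolding c_ind_def using eqv by auto
qed

lemma Sym_Zpbar_kzact: "h \<in> KZ \<nu> \<Longrightarrow> F \<in> Sym r (Zpbar \<nu>) \<Longrightarrow> kzact h F \<in> Sym r (Zpbar \<nu>)"
  using Sym_Zpbar_iff Sym_kzact vge_kzact by blast

lemma br_IQ: "g \<in> G0 \<Longrightarrow> v \<in> Sym r UNIV \<Longrightarrow> br g v \<in> IQ r"
  by (rule br_c_ind) (auto simp: Sym_0 Sym_kzact)

lemma br_IZ: "g \<in> G0 \<Longrightarrow> v \<in> Sym r (Zpbar \<nu>) \<Longrightarrow> br g v \<in> IZ r"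
  by (rule br_c_ind) (auto intro: Sym_Zpbar_kzact simp: Sym_Zpbar_iff[of 0] Sym_0)

lemma c_ind_add:
  assumes "f \<in> c_ind p \<nu> (\<lambda>a. a) M" "f' \<in> c_ind p \<nu> (\<lambda>a. a) M" "\<And>v w. v \<in> M \<Longrightarrow> w \<in> M \<Longrightarrow> v + w \<in> M"
  shows "(\<lambda>x. f x + f' x) \<in> c_ind p \<nu> (\<lambda>a. a) M"
proof -
  obtain S S' where S: "finite S" "S \<subseteq> G0" "{x. f x \<noteq> 0} \<subseteq> (\<Union>s\<in>S. {h ** s | h. h \<in> KZ \<nu>})"
    "finite S'" "S' \<subseteq> G0" "{x. f' x \<noteq> 0} \<subseteq> (\<Union>s\<in>S'. {h ** s | h. h \<in> KZ \<nu>})"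
    using assms unfolding c_ind_def by auto
  have "{x. f x + f' x \<noteq> 0} \<subseteq> {x. f x \<noteq> 0} \<union> {x. f' x \<noteq> 0}" by auto
  also have "\<dots> \<subseteq> (\<Union>s\<in>S \<union> S'. {h ** s | h. h \<in> KZ \<nu>})"
    using S(3,6) unfolding UN_Un by (rule Un_mono)
  finally have "\<exists>S. finite S \<and> S \<subseteq> G0 \<and> {x. f x + f' x \<noteq> 0} \<subseteq> (\<Union>s\<in>S. {h ** s | h. h \<in> KZ \<nu>})"
    using S by (intro exI[of _ "S \<union> S'"]) auto
  thus ?thesis using assms by (auto simp: c_ind_def kzact_add)
qed

lemma IQ_0: "(\<lambda>_. 0) \<in> IQ r" and IZ_0: "(\<lambda>_. 0) \<in> IZ r"
  by (auto simp: c_ind_def Sym_0 Sym_iff[of 0 r "Zpbar \<nu>"] Zpbar_0)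

lemma IQ_add: "f \<in> IQ r \<Longrightarrow> f' \<in> IQ r \<Longrightarrow> (\<lambda>x. f x + f' x) \<in> IQ r"
  by (rule c_ind_add) (auto intro: Sym_add)

lemma IZ_add: "f \<in> IZ r \<Longrightarrow> f' \<in> IZ r \<Longrightarrow> (\<lambda>x. f x + f' x) \<in> IZ r"
  by (rule c_ind_add) (auto simp: Sym_Zpbar_iff intro: Sym_add vge_add)

lemma c_ind_const2:
  assumes "f \<in> c_ind p \<nu> (\<lambda>a. a) M" "\<And>v. v \<in> M \<Longrightarrow> const2 a * v \<in> M"
  shows "(\<lambda>x. const2 a * f x) \<in> c_ind p \<nu> (\<lambda>a. a) M"
proof -
  obtain S where S: "finite S" "S \<subseteq> G0" "{x. f x \<noteq> 0} \<subseteq> (\<Union>s\<in>S. {h ** s | h. h \<in> KZ \<nu>})"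
    using assms unfolding c_ind_def by auto
  have "{x. const2 a * f x \<noteq> 0} \<subseteq> {x. f x \<noteq> 0}" by auto
  hence "\<exists>S. finite S \<and> S \<subseteq> G0 \<and> {x. const2 a * f x \<noteq> 0} \<subseteq> (\<Union>s\<in>S. {h ** s | h. h \<in> KZ \<nu>})"
    using S(1,2) order_trans[OF _ S(3)] by (intro exI[of _ S]) simp
  thus ?thesis using assms by (auto simp: c_ind_def kzact_const2)
qed

lemma IQ_const2: "f \<in> IQ r \<Longrightarrow> (\<lambda>x. const2 a * f x) \<in> IQ r"
  by (rule c_ind_const2) (auto intro: Sym_const2_mult)

lemma IZ_const2: "f \<in> IZ r \<Longrightarrow> a \<in> Zpbar \<nu> \<Longrightarrow> (\<lambda>x. const2 a * f x) \<in> IZ r"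
  by (rule c_ind_const2)
    (auto simp: Sym_Zpbar_iff Zpbar_iff zero_ereal_def vge_const2 intro!: Sym_const2_mult vge_mult0)

lemma IQ_minus: "f \<in> IQ r \<Longrightarrow> (\<lambda>x. - f x) \<in> IQ r"
  using IQ_const2[of f r "-1"] by (simp add: const2_minus)

lemma IQ_diff: "f \<in> IQ r \<Longrightarrow> f' \<in> IQ r \<Longrightarrow> (\<lambda>x. f x - f' x) \<in> IQ r"
  using IQ_add[OF _ IQ_minus, of f r f'] by simp

lemma IZ_diff: "f \<in> IZ r \<Longrightarrow> f' \<in> IZ r \<Longrightarrow> (\<lambda>x. f x - f' x) \<in> IZ r"
  using IZ_add[OF _ IZ_const2, of f r f' "-1"] by (simp add: const2_minus Zpbar_minus Zpbar_1)

lemma IQ_sum: "(\<And>i. i \<in> A \<Longrightarrow> f i \<in> IQ r) \<Longrightarrow> (\<lambda>x. \<Sum>i\<in>A. f i x) \<in> IQ r"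
  by (induction A rule: infinite_finite_induct) (auto simp: IQ_0 intro: IQ_add)

lemma IZ_sum: "(\<And>i. i \<in> A \<Longrightarrow> f i \<in> IZ r) \<Longrightarrow> (\<lambda>x. \<Sum>i\<in>A. f i x) \<in> IZ r"
  by (induction A rule: infinite_finite_induct) (auto simp: IZ_0 intro: IZ_add)

lemma IZ_IQ: "f \<in> IZ r \<Longrightarrow> f \<in> IQ r"
  by (auto simp: c_ind_def Sym_iff[of _ r "Zpbar \<nu>"])

section \<open>Cosets of \<open>KZ\<close> and the decomposition of functions into brackets\<close>

abbreviation coset :: "'k ^ 2 ^ 2 \<Rightarrow> ('k ^ 2 ^ 2) set" where "coset h \<equiv> (**) h ` KZ \<nu>"
abbreviation rep :: "('k ^ 2 ^ 2) set \<Rightarrow> 'k ^ 2 ^ 2" where "rep C \<equiv> SOME h. h \<in> C"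
text \<open>The index set of the sum in \<open>hecke\<close>. Together with \<open>rep\<close> it
  writes a function as a finite sum of brackets [h, f(h^-1)].\<close>

definition cosets :: "('k ^ 2 ^ 2 \<Rightarrow> 'r::zero) \<Rightarrow> ('k ^ 2 ^ 2) set set" where
  "cosets f = {coset h | h. h \<in> G0 \<and> f (matrix_inv h) \<noteq> 0}"

lemma G0_cancel:
  assumes "g \<in> G0"
  shows "matrix_inv g ** (g ** x) = x" "g ** (matrix_inv g ** x) = x"
    "x ** g ** matrix_inv g = x" "x ** matrix_inv g ** g = x"
  using G0_inv[OF assms] by (metis matrix_mul_assoc matrix_mul_lid matrix_mul_rid)+

lemma matrix_inv_inv: "g \<in> G0 \<Longrightarrow> matrix_inv (matrix_inv g) = g"
  using G0_inv[of g] G0_inv[of "matrix_inv g"] by (metis G0_cancel(1) matrix_mul_rid)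

lemma matrix_inv_mult:
  assumes "g \<in> G0" "h \<in> G0"
  shows "matrix_inv (g ** h) = matrix_inv h ** matrix_inv g"
proof -
  have "g ** h ** (matrix_inv h ** matrix_inv g) = mat 1"
    using assms by (simp add: matrix_mul_assoc G0_cancel G0_inv)
  hence "matrix_inv (g ** h) ** (g ** h ** (matrix_inv h ** matrix_inv g)) = matrix_inv (g ** h)"
    by simp
  thus ?thesis using G0_cancel(1)[OF G0_mult[OF assms]] by simp
qed

lemma coset_eqI:
  assumes "g \<in> G0" "h \<in> coset g"
  shows "coset h = coset g"
proof -
  obtain k where k: "k \<in> KZ \<nu>" "h = g ** k" using assms by auto
  have "g ** x \<in> coset h" if "x \<in> KZ \<nu>" for x
    using that k KZ_mult[OF KZ_inv[OF k(1)] that] G0_cancel(2)[OF KZ_G0[OF k(1)]]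
    by (intro image_eqI[of _ _ "matrix_inv k ** x"]) (simp_all flip: matrix_mul_assoc)
  moreover have "h ** x \<in> coset g" if "x \<in> KZ \<nu>" for x
    using that k KZ_mult[OF k(1) that] by (auto simp flip: matrix_mul_assoc)
  ultimately show ?thesis by auto
qed

lemma coset_self: "h \<in> coset h"
  using K0_KZ[OF K0_1] by (intro image_eqI[of _ _ "mat 1"]) auto

lemma rep_coset: "h \<in> G0 \<Longrightarrow> rep (coset h) \<in> coset h"
  by (rule someI[of "\<lambda>x. x \<in> coset h" h]) (rule coset_self)

lemma rep_coset':
  assumes "C = coset h" "h \<in> G0"
  shows "rep C \<in> G0 \<and> coset (rep C) = C \<and> (\<exists>k\<in>KZ \<nu>. rep C = h ** k)"
proof -
  have "rep C \<in> coset h" using rep_coset assms by blast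
  moreover from this obtain k where "k \<in> KZ \<nu>" "rep C = h ** k" by auto
  moreover from this have "rep C \<in> G0" using G0_mult KZ_G0 assms by metis
  ultimately show ?thesis using coset_eqI[OF assms(2)] assms(1) by blast
qed

lemma coset_eq_iff:
  assumes "g \<in> G0" "h \<in> G0"
  shows "coset g = coset h \<longleftrightarrow> matrix_inv g ** h \<in> KZ \<nu>"
proof
  assume "coset g = coset h"
  hence "h \<in> coset g" using coset_self by metis
  then obtain k where "k \<in> KZ \<nu>" "h = g ** k" by auto
  thus "matrix_inv g ** h \<in> KZ \<nu>" using G0_cancel(1)[OF assms(1)] by simp
next
  assume "matrix_inv g ** h \<in> KZ \<nu>"
  moreover have "h = g ** (matrix_inv g ** h)" using G0_cancel(2)[OF assms(1)] by simp
  ultimately have "h \<in> coset g" by blast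
  thus "coset g = coset h" using coset_eqI[OF assms(1)] by blast
qed

lemma finite_cosets:
  assumes "f \<in> c_ind p \<nu> \<rho> M"
  shows "finite (cosets f)"
proof -
  obtain S where S: "finite S" "S \<subseteq> G0" "{x. f x \<noteq> 0} \<subseteq> (\<Union>s\<in>S. {h ** s | h. h \<in> KZ \<nu>})"
    using assms unfolding c_ind_def by auto
  have "cosets f \<subseteq> (\<lambda>s. coset (matrix_inv s)) ` S"
  proof
    fix C assume "C \<in> cosets f"
    then obtain h where h: "C = coset h" "h \<in> G0" "f (matrix_inv h) \<noteq> 0" by (auto simp: cosets_def)
    then obtain s k where s: "s \<in> S" "k \<in> KZ \<nu>" "matrix_inv h = k ** s" using S(3) by blast
    have "matrix_inv h ** matrix_inv s = k" using s S(2) G0_cancel(3) by (metis subsetD)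
    hence "coset h = coset (matrix_inv s)"
      using s S(2) h G0_inv by (subst coset_eq_iff) auto
    thus "C \<in> (\<lambda>s. coset (matrix_inv s)) ` S" using s h by blast
  qed
  thus ?thesis using S(1) finite_surj by blast
qed

lemma cosets_rep:
  assumes "C \<in> cosets f"
  shows "rep C \<in> G0" "coset (rep C) = C"
proof -
  obtain h where "C = coset h" "h \<in> G0" using assms by (auto simp: cosets_def)
  thus "rep C \<in> G0" "coset (rep C) = C" using rep_coset' by simp_all
qed

text \<open>Only the coset of x^-1 has a representative that x moves into \<open>KZ\<close>. The
  summands are left arbitrary so that the same count serves functions in characteristic 0 and
  reductions of brackets.\<close>

lemma sum_cosets:
  assumes f: "f \<in> c_ind p \<nu> \<rho> M" and M: "\<And>h. KZ_act p \<nu> \<rho> h 0 = 0"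
    and x: "x \<in> G0" and w: "\<And>C. C \<in> cosets f \<Longrightarrow> x ** rep C \<in> KZ \<nu> \<Longrightarrow> w C = f x"
      "\<And>C. C \<in> cosets f \<Longrightarrow> x ** rep C \<notin> KZ \<nu> \<Longrightarrow> w C = 0"
  shows "(\<Sum>C\<in>cosets f. w C) = f x"
proof -
  define C' where "C' = coset (matrix_inv x)"
  have xi: "matrix_inv x \<in> G0" using G0_inv x by blast
  have iff: "x ** rep C \<in> KZ \<nu> \<longleftrightarrow> C = C'" if "C \<in> cosets f" for C
    using coset_eq_iff[OF xi cosets_rep(1)[OF that]] cosets_rep(2)[OF that] matrix_inv_inv[OF x]
    unfolding C'_def by metis
  have "(\<Sum>C\<in>cosets f. w C) = (\<Sum>C\<in>cosets f. if C = C' then f x else 0)"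
    using w iff by (intro sum.cong) auto
  also have "\<dots> = (if C' \<in> cosets f then f x else 0)"
    using finite_cosets[OF f] by simp
  also have "\<dots> = f x"
  proof (cases "f x = 0")
    case False
    hence "C' \<in> cosets f" using xi matrix_inv_inv[OF x] unfolding cosets_def C'_def by auto
    thus ?thesis by simp
  qed auto
  finally show ?thesis .
qed

lemma c_ind_equivariant:
  "f \<in> c_ind p \<nu> \<rho> M \<Longrightarrow> h \<in> KZ \<nu> \<Longrightarrow> g \<in> G0 \<Longrightarrow> f (h ** g) = KZ_act p \<nu> \<rho> h (f g)"
  by (auto simp: c_ind_def)

lemma c_ind_value: "f \<in> c_ind p \<nu> \<rho> M \<Longrightarrow> g \<in> G0 \<Longrightarrow> f g \<in> M"
  and c_ind_outside: "f \<in> c_ind p \<nu> \<rho> M \<Longrightarrow> g \<notin> G0 \<Longrightarrow> f g = 0"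
  by (auto simp: c_ind_def)

lemma c_ind_at_rep:
  assumes "f \<in> c_ind p \<nu> \<rho> M" "C \<in> cosets f" "x \<in> G0" "x ** rep C \<in> KZ \<nu>"
  shows "KZ_act p \<nu> \<rho> (x ** rep C) (f (matrix_inv (rep C))) = f x"
proof -
  note r = cosets_rep[OF assms(2)]
  have "f (x ** rep C ** matrix_inv (rep C)) = KZ_act p \<nu> \<rho> (x ** rep C) (f (matrix_inv (rep C)))"
    using assms r G0_inv by (intro c_ind_equivariant) auto
  thus ?thesis using G0_cancel(3)[OF r(1)] by simp
qed

lemma c_ind_decomp:
  assumes "f \<in> c_ind p \<nu> (\<lambda>a. a) M"
  shows "f = (\<lambda>x. \<Sum>C\<in>cosets f. br (rep C) (f (matrix_inv (rep C))) x)"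
proof
  fix x
  show "f x = (\<Sum>C\<in>cosets f. br (rep C) (f (matrix_inv (rep C))) x)"
  proof (cases "x \<in> G0")
    case True
    thus ?thesis using assms c_ind_at_rep[OF assms]
      by (intro sum_cosets[symmetric]) (auto simp: br_def)
  next
    case False
    have "x ** rep C \<notin> KZ \<nu>" if "C \<in> cosets f" for C
    proof
      assume "x ** rep C \<in> KZ \<nu>"
      hence "x ** rep C ** matrix_inv (rep C) \<in> G0"
        using cosets_rep(1)[OF that] G0_inv G0_mult KZ_G0 by blast
      thus False using False G0_cancel(3)[OF cosets_rep(1)[OF that]] by simp
    qed
    hence "(\<Sum>C\<in>cosets f. br (rep C) (f (matrix_inv (rep C))) x) = 0"
      by (intro sum.neutral) (auto simp: br_def)
    thus ?thesis using c_ind_outside[OF assms False] by simp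
  qed
qed

end

section \<open>The Hecke operator\<close>

context padic_alg_closure
begin

text \<open>The matrices of the Hecke operator, indexed by the points of the projective line over the prime
  field. In the formula for \<open>T\<close>, the matrix that acts on \<open>v\<close> is the adjugate \<open>p (hrep i)\<inverse>\<close>.\<close>

definition hrep :: "'f option \<Rightarrow> 'k ^ 2 ^ 2" where
  "hrep i = (case i of Some l \<Rightarrow> mat2 pk (teich l) 0 1 | None \<Rightarrow> mat2 1 0 0 pk)"

definition hidx :: "'f option set" where
  "hidx = insert None (Some ` prime_field)"

abbreviation hb :: "'k ^ 2 ^ 2 \<Rightarrow> 'k poly poly \<Rightarrow> 'k ^ 2 ^ 2 \<Rightarrow> 'k poly poly" where
  "hb \<equiv> hecke_bracket p \<nu> red"

lemma finite_hidx [simp]: "finite hidx"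
  by (simp add: hidx_def)

lemma hb_eq: "hb g v x = (\<Sum>i\<in>hidx. br (g ** hrep i) (act (adj2 (hrep i)) v) x)"
proof -
  have "(\<Sum>i\<in>hidx. br (g ** hrep i) (act (adj2 (hrep i)) v) x) =
    (\<Sum>l\<in>prime_field. br (g ** hrep (Some l)) (act (adj2 (hrep (Some l))) v) x) + br (g ** hrep None) (act (adj2 (hrep None)) v) x"
    unfolding hidx_def by (subst sum.insert) (auto simp: sum.reindex)
  thus ?thesis by (simp add: hecke_bracket_def hrep_def adj2_def)
qed

lemma det_hrep: "det (hrep i) = pk"
  by (auto simp: hrep_def det_2 split: option.splits)

lemma hrep_Zp: "i \<in> hidx \<Longrightarrow> hrep i $ a $ b \<in> Zp \<nu>"
  using exhaust_2[of a] exhaust_2[of b]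
  by (auto simp: hidx_def hrep_def teich_Zp Zp_0 Zp_1 Zp_of_nat)

lemma inverse_pk_Qp: "inverse pk \<in> Qp \<nu>"
  by (intro Qp_Rats) simp

lemma hrep_G0: "i \<in> hidx \<Longrightarrow> hrep i \<in> G0"
  using hrep_Zp[THEN Zp_Qp, of i] by (auto simp: GL2_iff det_hrep intro!: bexI[OF _ inverse_pk_Qp])

lemma Zp_div_p:
  assumes "z \<in> Zp \<nu>" "red z = 0"
  shows "inverse pk * z \<in> Zp \<nu>"
proof (cases "z = 0")
  case False
  have "0 < \<nu> z" using assms red_eq_0[of z] Zp_Zpbar by auto
  moreover obtain k :: int where k: "\<nu> z = ereal (real_of_int k)" using nu_Qp[of z] False assms(1) Zp_Qp by blast
  ultimately have "k \<ge> 1" by simp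
  moreover have "\<nu> (inverse pk) = ereal (- 1)" using nu_inverse[of pk 1] by (simp add: val_p one_ereal_def)
  ultimately have "0 \<le> \<nu> (inverse pk * z)" using k by (simp add: val_mult)
  moreover have "inverse pk * z \<in> Qp \<nu>"
    using assms(1) by (intro Qp_mult Qp_Rats Zp_Qp) auto
  ultimately show ?thesis by (simp add: Zp_iff)
qed (simp add: Zp_0)

lemma red_Zp_hom:
  assumes "x \<in> Zp \<nu>" "y \<in> Zp \<nu>"
  shows "red (x + y) = red x + red y" "red (x - y) = red x - red y" "red (x * y) = red x * red y"
  using assms by (simp_all add: red_add red_diff red_mult Zp_Zpbar)

lemma prime_field_divide:
  assumes "a \<in> prime_field" "b \<in> prime_field" "(b :: 'f) \<noteq> 0"
  shows "a / b \<in> prime_field"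
proof -
  have "b ^ (p - 2) * b * b = 1 * b"
    using prime_field_power_p[OF assms(2)] p_gt_1
    by (simp flip: power_Suc2 add: numeral_2_eq_2 Suc_diff_Suc)
  hence "b ^ (p - 2) * b = 1" using assms(3) by simp
  hence "a / b = a * b ^ (p - 2)" using assms(3) by (simp add: field_simps)
  moreover have "b ^ (p - 2) \<in> prime_field" using assms(2) by (auto simp: prime_field_def simp flip: of_nat_power)
  ultimately show ?thesis using prime_field_mult assms(1) by simp
qed

text \<open>The determinant is divisible by p, so modulo p the rows of M are dependent: the second
  row vanishes (index \<open>None\<close>), or the first is l times the second (index
  \<open>Some l\<close>). For this index the adjugate of \<open>hrep i\<close> times M is divisible
  by p, and the quotient lies in K.\<close>

lemma hecke_decomp:
  assumes "\<And>i j. M $ i $ j \<in> Zp \<nu>" "M \<in> G0" "\<nu> (det M) = 1"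
  shows "\<exists>i\<in>hidx. \<exists>k\<in>K0. M = hrep i ** k"
proof -
  define a b c d where "a = M $ 1 $ 1" and "b = M $ 1 $ 2" and "c = M $ 2 $ 1" and "d = M $ 2 $ 2"
  have Z: "a \<in> Zp \<nu>" "b \<in> Zp \<nu>" "c \<in> Zp \<nu>" "d \<in> Zp \<nu>" using assms(1) by (simp_all add: a_def b_def c_def d_def)
  have det: "det M = a * d - b * c" by (simp add: det_2 a_def b_def c_def d_def)
  have red_det: "red a * red d = red b * red c"
  proof -
    have "red (det M) = 0" using assms(3) Z by (subst red_eq_0) (auto simp: det Zp_Zpbar Zp_diff Zp_mult)
    thus ?thesis using Z by (simp add: det red_Zp_hom Zp_mult)
  qed
  have *: "\<exists>k\<in>K0. M = hrep i ** k"
    if i: "i \<in> hidx" and k: "\<And>a b. (mat (inverse pk) ** (adj2 (hrep i) ** M)) $ a $ b \<in> Zp \<nu>" for i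
  proof -
    define k where "k = mat (inverse pk) ** (adj2 (hrep i) ** M)"
    have "hrep i ** k = mat (inverse pk) ** (hrep i ** adj2 (hrep i)) ** M"
      unfolding k_def matrix_mul_assoc mat_mult_commute[of _ "hrep i"] ..
    also have "\<dots> = M" by (simp add: adj2_mult det_hrep mat_mult_mat)
    finally have M: "M = hrep i ** k" by simp
    have "k = matrix_inv (hrep i) ** M" unfolding M by (simp add: G0_cancel hrep_G0 i)
    hence "k \<in> G0" using G0_mult G0_inv hrep_G0 i assms(2) by metis
    moreover have "\<nu> (det k) = 0"
    proof -
      have "\<nu> pk + \<nu> (det k) = 1" using assms(3) by (simp add: M det_mul det_hrep val_mult)
      thus ?thesis by (cases "\<nu> (det k)") (auto simp: val_p one_ereal_def zero_ereal_def)
    qed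
    ultimately have "k \<in> K0" using k unfolding k_def[symmetric] by (intro K0I) auto
    thus ?thesis using M by blast
  qed
  show ?thesis
  proof (cases "red c = 0 \<and> red d = 0")
    case True
    hence "inverse pk * c \<in> Zp \<nu>" "inverse pk * d \<in> Zp \<nu>" using Zp_div_p Z by auto
    hence "(mat (inverse pk) ** (adj2 (hrep None) ** M)) $ i $ j \<in> Zp \<nu>" for i j
      using Z exhaust_2[of i] exhaust_2[of j]
      by (auto simp: mult2_nth hrep_def adj2_def a_def b_def c_def d_def mult.assoc[symmetric])
    thus ?thesis using *[of None] by (auto simp: hidx_def)
  next
    case False
    have "\<exists>l\<in>prime_field. red a = l * red c \<and> red b = l * red d"
    proof (cases "red c = 0")
      case True
      hence "red d \<noteq> 0" using False by simp
      thus ?thesis using True red_det Z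
        by (intro bexI[of _ "red b / red d"]) (auto intro!: prime_field_divide red_Zp simp: field_simps)
    next
      case False
      thus ?thesis using red_det Z
        by (intro bexI[of _ "red a / red c"]) (auto intro!: prime_field_divide red_Zp simp: field_simps)
    qed
    then obtain l where l: "l \<in> prime_field" "red a = l * red c" "red b = l * red d" by blast
    have "inverse pk * (a - teich l * c) \<in> Zp \<nu>" "inverse pk * (b - teich l * d) \<in> Zp \<nu>"
      by (rule Zp_div_p; use l Z in \<open>simp add: Zp_diff red_Zp_hom Zp_mult teich_Zp red_teich\<close>)+
    hence "(mat (inverse pk) ** (adj2 (hrep (Some l)) ** M)) $ i $ j \<in> Zp \<nu>" for i j
      using Z exhaust_2[of i] exhaust_2[of j]
      by (auto simp: mult2_nth hrep_def adj2_def a_def b_def c_def d_def mult.assoc[symmetric])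
    thus ?thesis using *[of "Some l"] l by (auto simp: hidx_def)
  qed
qed

lemma hrep_unique:
  assumes "i \<in> hidx" "j \<in> hidx" "k \<in> K0" "hrep j = hrep i ** k"
  shows "i = j"
proof -
  have k: "k $ a $ b \<in> Zp \<nu>" for a b using assms(3) by (auto simp: GL2_def)
  have not: "pk * k $ a $ b \<noteq> 1" for a b
  proof
    assume "pk * k $ a $ b = 1"
    hence "\<nu> pk + \<nu> (k $ a $ b) = 0" by (simp flip: val_mult)
    thus False using k[of a b] by (cases "\<nu> (k $ a $ b)") (auto simp: Zp_iff val_p one_ereal_def zero_ereal_def)
  qed
  have e: "hrep j $ a $ b = hrep i $ a $ 1 * k $ 1 $ b + hrep i $ a $ 2 * k $ 2 $ b" for a b
    unfolding assms(4) mult2_nth ..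
  show ?thesis
  proof (cases i; cases j)
    fix l l' assume il: "i = Some l" "j = Some l'"
    have l: "l \<in> prime_field" "l' \<in> prime_field" using assms il by (auto simp: hidx_def)
    have "teich l' = pk * k $ 1 $ 2 + teich l * 1" using e[of 1 2] e[of 2 2] by (simp add: il hrep_def)
    hence "red (teich l') = red (pk * k $ 1 $ 2 + teich l)" by simp
    hence "l' = l" using l k
      using red_of_nat[of p] of_nat_res_eq_0[of p] by (simp add: red_Zp_hom Zp_mult Zp_of_nat teich_Zp red_teich)
    thus "i = j" using il by simp
  next
    fix l assume "i = None" "j = Some l"
    hence "pk * k $ 2 $ 2 = 1" using e[of 2 2] by (simp add: hrep_def)
    thus "i = j" using not by blast
  next
    fix l assume "i = Some l" "j = None"
    hence "pk * k $ 1 $ 1 = 1" using e[of 1 1] e[of 2 1] by (simp add: hrep_def)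
    thus "i = j" using not by blast
  qed simp
qed

text \<open>Left multiplication by an element of \<open>K\<close> permutes the cosets \<open>hrep i K\<close>, which makes the
  formula for \<open>T\<close> independent of the representative of a coset.\<close>

lemma hb_K0:
  assumes "g \<in> G0" "k \<in> K0" "v \<in> Sym r UNIV"
  shows "hb (g ** k) v = hb g (act k v)"
proof
  fix x
  have "\<forall>i\<in>hidx. \<exists>j k'. j \<in> hidx \<and> k' \<in> K0 \<and> k ** hrep i = hrep j ** k'"
  proof
    fix i assume i: "i \<in> hidx"
    have "(k ** hrep i) $ a $ b \<in> Zp \<nu>" for a b
      using hrep_Zp[OF i] assms(2) by (auto simp: mult2_nth GL2_def intro!: Zp_add Zp_mult)
    moreover have "k ** hrep i \<in> G0" using G0_mult K0_G0 hrep_G0 i assms(2) by blast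
    moreover have "\<nu> (det (k ** hrep i)) = 1" using nu_det_K0[OF assms(2)] by (simp add: det_mul det_hrep val_mult val_p)
    ultimately show "\<exists>j k'. j \<in> hidx \<and> k' \<in> K0 \<and> k ** hrep i = hrep j ** k'"
      using hecke_decomp[of "k ** hrep i"] by blast
  qed
  then obtain \<sigma> \<kappa> where \<sigma>: "\<And>i. i \<in> hidx \<Longrightarrow> \<sigma> i \<in> hidx" "\<And>i. i \<in> hidx \<Longrightarrow> \<kappa> i \<in> K0"
    "\<And>i. i \<in> hidx \<Longrightarrow> k ** hrep i = hrep (\<sigma> i) ** \<kappa> i" by metis
  have kG: "k \<in> G0" using K0_G0 assms(2) by blast
  have inj: "inj_on \<sigma> hidx"
  proof (rule inj_onI)
    fix i j assume ij: "i \<in> hidx" "j \<in> hidx" "\<sigma> i = \<sigma> j"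
    have *: "hrep (\<sigma> i) = k ** hrep i ** matrix_inv (\<kappa> i)"
      using \<sigma>(3)[OF ij(1)] G0_cancel(3)[OF K0_G0[OF \<sigma>(2)[OF ij(1)]]] by metis
    have "k ** hrep j = k ** hrep i ** matrix_inv (\<kappa> i) ** \<kappa> j"
      using \<sigma>(3)[OF ij(2)] * ij(3) by simp
    hence "matrix_inv k ** (k ** hrep j) = matrix_inv k ** (k ** (hrep i ** (matrix_inv (\<kappa> i) ** \<kappa> j)))"
      by (simp add: matrix_mul_assoc)
    hence "hrep j = hrep i ** (matrix_inv (\<kappa> i) ** \<kappa> j)" by (simp only: G0_cancel[OF kG])
    moreover have "matrix_inv (\<kappa> i) ** \<kappa> j \<in> K0" using \<sigma>(2) K0_inv K0_mult ij by blast
    ultimately show "i = j" using hrep_unique ij by blast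
  qed
  have img: "\<sigma> ` hidx = hidx"
    using inj \<sigma>(1) by (intro endo_inj_surj) auto
  have tm: "br (g ** k ** hrep i) (act (adj2 (hrep i)) v) x = br (g ** hrep (\<sigma> i)) (act (adj2 (hrep (\<sigma> i))) (act k v)) x"
    if i: "i \<in> hidx" for i
  proof -
    \<comment> \<open>The relation k \<open>hrep i\<close> = \<open>hrep (\<sigma> i)\<close>
      \<kappa> i is carried over to adjugates by multiplying with them on both sides and cancelling
      the factor p.\<close>
    have "mat pk ** (\<kappa> i ** adj2 (hrep i)) = adj2 (hrep (\<sigma> i)) ** (hrep (\<sigma> i) ** \<kappa> i) ** adj2 (hrep i)"
      by (simp add: matrix_mul_assoc adj2_mult det_hrep)
    also have "\<dots> = adj2 (hrep (\<sigma> i)) ** k ** (hrep i ** adj2 (hrep i))"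
      unfolding \<sigma>(3)[OF i, symmetric] by (simp add: matrix_mul_assoc)
    also have "\<dots> = mat pk ** (adj2 (hrep (\<sigma> i)) ** k)"
      by (simp add: adj2_mult det_hrep mat_mult_commute)
    finally have "mat (inverse pk) ** (mat pk ** (\<kappa> i ** adj2 (hrep i))) = mat (inverse pk) ** (mat pk ** (adj2 (hrep (\<sigma> i)) ** k))"
      by simp
    hence eq: "\<kappa> i ** adj2 (hrep i) = adj2 (hrep (\<sigma> i)) ** k"
      unfolding matrix_mul_assoc mat_mult_mat by simp
    have "br (g ** k ** hrep i) (act (adj2 (hrep i)) v) = br (g ** hrep (\<sigma> i) ** \<kappa> i) (act (adj2 (hrep i)) v)"
      using \<sigma>(3)[OF i] by (metis matrix_mul_assoc)
    also have "\<dots> = br (g ** hrep (\<sigma> i)) (act (\<kappa> i ** adj2 (hrep i)) v)"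
      using \<sigma>(2)[OF i] by (simp add: br_KZ K0_KZ KZ_act_def K_part_K0 mat_act_compose)
    finally show ?thesis unfolding eq by (simp add: mat_act_compose)
  qed
  show "hb (g ** k) v x = hb g (act k v) x"
    unfolding hb_eq using inj img tm
    by (intro sum.reindex_cong[of \<sigma> hidx, symmetric]) auto
qed

lemma hb_KZ:
  assumes "g \<in> G0" "h \<in> KZ \<nu>" "v \<in> Sym r UNIV"
  shows "hb (g ** h) v = hb g (kzact h v)"
proof -
  obtain n where h: "h = mat (pk powi n) ** K_part p \<nu> h" and k: "K_part p \<nu> h \<in> K0" using KZ_decomp assms(2) by blast
  have z: "hb (g ** mat (pk powi n)) w = hb g w" for g w
  proof
    fix x
    have "br (g ** mat (pk powi n) ** hrep i) w' = br (g ** hrep i) w'" for i w'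
    proof -
      have "g ** mat (pk powi n) ** hrep i = g ** hrep i ** mat (pk powi n)"
        by (metis mat_mult_commute matrix_mul_assoc)
      thus ?thesis using powi_KZ[of n] by (simp add: br_KZ KZ_act_def K_part_powi mat_act_mat_1)
    qed
    thus "hb (g ** mat (pk powi n)) w x = hb g w x" by (simp add: hb_eq)
  qed
  have "g ** h = g ** K_part p \<nu> h ** mat (pk powi n)"
    by (subst h) (metis mat_mult_commute matrix_mul_assoc)
  hence "hb (g ** h) v = hb (g ** K_part p \<nu> h) v" by (simp add: z)
  thus ?thesis using hb_K0[OF assms(1) k assms(3)] by (simp add: KZ_act_def)
qed

lemma hb_0 [simp]: "hb g 0 = (\<lambda>_. 0)"
  by (rule ext) (simp add: hb_eq)

lemma hb_add: "hb g (v + w) x = hb g v x + hb g w x"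
  by (simp add: hb_eq mat_act_add br_add sum.distrib)

lemma hb_const2: "hb g (const2 a * v) x = const2 a * hb g v x"
  by (simp add: hb_eq mat_act_mult br_const2 sum_distrib_left)

lemma hb_IQ: "g \<in> G0 \<Longrightarrow> v \<in> Sym r UNIV \<Longrightarrow> hb g v \<in> IQ r"
  unfolding hb_eq[abs_def] by (intro IQ_sum br_IQ G0_mult hrep_G0 Sym_mat_act)

lemma hb_translate: "hb (x ** g) v g' = hb g v (g' ** x)"
  unfolding hb_eq by (simp add: br_translate flip: matrix_mul_assoc)

section \<open>The Hecke operator as a linear map that commutes with G\<close>

abbreviation T :: "('k ^ 2 ^ 2 \<Rightarrow> 'k poly poly) \<Rightarrow> 'k ^ 2 ^ 2 \<Rightarrow> 'k poly poly" where
  "T \<equiv> hecke p \<nu> red"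

definition all_cosets :: "('k ^ 2 ^ 2) set set" where "all_cosets = coset ` G0"

text \<open>The sum may run over any finite set of cosets containing the support. Additivity of T
  needs this, since f, f' and f + f' have different supports.\<close>

lemma T_eq:
  assumes "finite A" "cosets f \<subseteq> A" "A \<subseteq> all_cosets"
  shows "T f x = (\<Sum>C\<in>A. hb (rep C) (f (matrix_inv (rep C))) x)"
proof -
  have "T f x = (\<Sum>C\<in>cosets f. hb (rep C) (f (matrix_inv (rep C))) x)"
    by (simp add: hecke_def cosets_def Let_def)
  also have "\<dots> = (\<Sum>C\<in>A. hb (rep C) (f (matrix_inv (rep C))) x)"
  proof (intro sum.mono_neutral_left assms ballI)
    fix C assume C: "C \<in> A - cosets f"
    then obtain h where "h \<in> G0" "C = coset h" using assms(3) by (auto simp: all_cosets_def)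
    hence r: "rep C \<in> G0" "coset (rep C) = C" using rep_coset' by auto
    have "f (matrix_inv (rep C)) = 0"
    proof (rule ccontr)
      assume "f (matrix_inv (rep C)) \<noteq> 0"
      hence "coset (rep C) \<in> cosets f" using r(1) unfolding cosets_def by blast
      thus False using C r by simp
    qed
    thus "hb (rep C) (f (matrix_inv (rep C))) x = 0" by simp
  qed
  finally show ?thesis .
qed

lemma cosets_all: "cosets f \<subseteq> all_cosets"
  by (auto simp: cosets_def all_cosets_def)

lemma T_add:
  assumes "f \<in> IQ r" "f' \<in> IQ r"
  shows "T (\<lambda>x. f x + f' x) x = T f x + T f' x"
proof -
  define A where "A = cosets f \<union> cosets f'"
  have A: "finite A" "A \<subseteq> all_cosets"
    using assms finite_cosets cosets_all[of f] cosets_all[of f'] by (auto simp: A_def)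
  note T = T_eq[OF A(1) _ A(2)]
  have "cosets (\<lambda>x. f x + f' x) \<subseteq> A" unfolding A_def cosets_def by auto
  moreover have "cosets f \<subseteq> A" "cosets f' \<subseteq> A" by (auto simp: A_def)
  ultimately show ?thesis by (simp add: T hb_add sum.distrib)
qed

lemma T_const2:
  assumes "f \<in> IQ r"
  shows "T (\<lambda>x. const2 a * f x) x = const2 a * T f x"
proof -
  have "cosets (\<lambda>x. const2 a * f x) \<subseteq> cosets f" unfolding cosets_def by auto
  note T = T_eq[OF finite_cosets[OF assms] this cosets_all] T_eq[OF finite_cosets[OF assms] order_refl cosets_all]
  show ?thesis by (simp add: T hb_const2 sum_distrib_left)
qed

lemma T_0: "T (\<lambda>_. 0) x = 0"
  using T_const2[OF IQ_0, of 0] by simp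

lemma T_sum:
  "(\<And>i. i \<in> A \<Longrightarrow> f i \<in> IQ r) \<Longrightarrow> T (\<lambda>x. \<Sum>i\<in>A. f i x) x = (\<Sum>i\<in>A. T (f i) x)"
proof (induction A rule: infinite_finite_induct)
  case (insert i A)
  thus ?case using T_add[OF _ IQ_sum, of "f i" r A f] by simp
qed (simp_all add: T_0)

text \<open>The definition of \<open>hecke\<close> picks an unknown representative g k of the coset;
  \<open>hb_KZ\<close> moves k into the vector, where it cancels.\<close>

lemma T_br:
  assumes "g \<in> G0" "v \<in> Sym r UNIV"
  shows "T (br g v) = hb g v"
proof
  fix x
  define C where "C = coset g"
  obtain k where k: "k \<in> KZ \<nu>" "rep C = g ** k" using rep_coset'[OF C_def assms(1)] by auto
  have sub: "cosets (br g v) \<subseteq> {C}"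
  proof
    fix D assume "D \<in> cosets (br g v)"
    then obtain h where h: "D = coset h" "h \<in> G0" "br g v (matrix_inv h) \<noteq> 0" by (auto simp: cosets_def)
    hence "matrix_inv h ** g \<in> KZ \<nu>" by (auto simp: br_def split: if_splits)
    thus "D \<in> {C}" using coset_eq_iff[of h g] h assms(1) by (simp add: C_def)
  qed
  have "matrix_inv (rep C) ** g = matrix_inv k"
    using k assms(1) KZ_G0 by (simp add: matrix_inv_mult G0_cancel)
  hence "br g v (matrix_inv (rep C)) = kzact (matrix_inv k) v"
    using KZ_inv[OF k(1)] by (simp add: br_def)
  hence "T (br g v) x = hb (g ** k) (kzact (matrix_inv k) v) x"
    using T_eq[OF _ sub, of x] assms(1) k(2) by (simp add: all_cosets_def C_def)
  also have "\<dots> = hb g v x"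
    using hb_KZ[OF assms(1) k(1) Sym_kzact[OF assms(2)]] kzact_inv[OF k(1)] by simp
  finally show "T (br g v) x = hb g v x" .
qed

lemma rep_G0: "C \<in> cosets f \<Longrightarrow> rep C \<in> G0" "C \<in> cosets f \<Longrightarrow> matrix_inv (rep C) \<in> G0"
  using cosets_rep G0_inv by blast+

lemma T_decomp:
  assumes "f \<in> IQ r"
  shows "T f x = (\<Sum>C\<in>cosets f. hb (rep C) (f (matrix_inv (rep C))) x)"
  using T_eq[OF finite_cosets[OF assms] order_refl cosets_all] .

lemma T_IQ: "f \<in> IQ r \<Longrightarrow> T f \<in> IQ r"
proof -
  assume f: "f \<in> IQ r"
  have "T f = (\<lambda>x. \<Sum>C\<in>cosets f. hb (rep C) (f (matrix_inv (rep C))) x)"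
    using T_decomp[OF f] by blast
  thus ?thesis using f by (simp only:) (intro IQ_sum hb_IQ rep_G0 c_ind_value[OF f])
qed

lemma translate_decomp:
  assumes "f \<in> IQ r" "x \<in> G0"
  shows "(\<lambda>g. f (g ** x)) = (\<lambda>g. \<Sum>C\<in>cosets f. br (x ** rep C) (f (matrix_inv (rep C))) g)"
  by (rule ext, subst c_ind_decomp[OF assms(1)]) (simp add: br_translate)

lemma translate_IQ:
  assumes "f \<in> IQ r" "x \<in> G0"
  shows "(\<lambda>g. f (g ** x)) \<in> IQ r"
  unfolding translate_decomp[OF assms] using assms
  by (intro IQ_sum br_IQ G0_mult rep_G0 c_ind_value) auto

lemma translate_IZ:
  assumes "f \<in> IZ r" "x \<in> G0"
  shows "(\<lambda>g. f (g ** x)) \<in> IZ r"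
  unfolding translate_decomp[OF IZ_IQ[OF assms(1)] assms(2)] using assms
  by (intro IZ_sum br_IZ G0_mult rep_G0 c_ind_value) auto

lemma T_translate:
  assumes "f \<in> IQ r" "x \<in> G0"
  shows "T (\<lambda>g. f (g ** x)) g' = T f (g' ** x)"
proof -
  have v: "f (matrix_inv (rep C)) \<in> Sym r UNIV" if "C \<in> cosets f" for C
    using that assms by (intro c_ind_value[OF assms(1)] rep_G0)
  have "T (\<lambda>g. f (g ** x)) g' = (\<Sum>C\<in>cosets f. T (br (x ** rep C) (f (matrix_inv (rep C)))) g')"
    unfolding translate_decomp[OF assms] using assms v
    by (intro T_sum[of _ _ r] br_IQ G0_mult rep_G0) auto
  also have "\<dots> = (\<Sum>C\<in>cosets f. hb (rep C) (f (matrix_inv (rep C))) (g' ** x))"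
    using assms v by (intro sum.cong refl) (subst T_br[of _ _ r]; simp add: G0_mult rep_G0 hb_translate)
  also have "\<dots> = T f (g' ** x)" using T_decomp[OF assms(1)] by simp
  finally show ?thesis .
qed

end

section \<open>Divisibility in \<open>\<Theta>\<close>\<close>

locale hecke_quotient = padic_alg_closure p \<nu> red
  for p :: nat and \<nu> :: "'k::{alg_closed_field, field_char_0} \<Rightarrow> ereal" and red :: "'k \<Rightarrow> 'f::field" +
  fixes r :: nat and ap :: 'k
begin

text \<open>\<open>LL e\<close> is the preimage in \<open>ind_Qpbar\<close> of the elements of \<open>\<Theta> \<otimes> \<rat>\<close> that are divisible, in the
  lattice \<open>\<Theta>\<close>, by a scalar of valuation at least \<open>e\<close>.\<close>

definition LL :: "real \<Rightarrow> ('k ^ 2 ^ 2 \<Rightarrow> 'k poly poly) set" where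
  "LL e = {f. \<exists>y g h. ereal e \<le> \<nu> y \<and> g \<in> IZ r \<and> h \<in> IQ r \<and>
                 f = (\<lambda>x. const2 y * g x + (T h x - const2 ap * h x))}"

lemma LL_I: "ereal e \<le> \<nu> y \<Longrightarrow> g \<in> IZ r \<Longrightarrow> h \<in> IQ r \<Longrightarrow>
    (\<And>x. f x = const2 y * g x + (T h x - const2 ap * h x)) \<Longrightarrow> f \<in> LL e"
  unfolding LL_def by blast

lemma LL_E:
  assumes "f \<in> LL e"
  obtains y g h where "ereal e \<le> \<nu> y" "g \<in> IZ r" "h \<in> IQ r"
    "f = (\<lambda>x. const2 y * g x + (T h x - const2 ap * h x))"
  using assms unfolding LL_def by blast

lemma LL_mono: "f \<in> LL e \<Longrightarrow> e' \<le> e \<Longrightarrow> f \<in> LL e'"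
  unfolding LL_def using order_trans[of "ereal e'" "ereal e"] by auto

text \<open>Of two scalars, the one of smaller valuation divides the other in the valuation ring and
  serves as the common scalar z. Two zero scalars need a separate argument because z is
  inverted.\<close>

lemma LL_add_aux:
  assumes "f \<in> LL e" "f' \<in> LL e"
  shows "(\<lambda>x. f x + f' x) \<in> LL e"
proof -
  obtain y g h where f: "ereal e \<le> \<nu> y" "g \<in> IZ r" "h \<in> IQ r"
    "f = (\<lambda>x. const2 y * g x + (T h x - const2 ap * h x))" using LL_E[OF assms(1)] .
  obtain y' g' h' where f': "ereal e \<le> \<nu> y'" "g' \<in> IZ r" "h' \<in> IQ r"
    "f' = (\<lambda>x. const2 y' * g' x + (T h' x - const2 ap * h' x))" using LL_E[OF assms(2)] .
  have *: "(\<lambda>x. f x + f' x) \<in> LL e" if "z \<noteq> 0" "ereal e \<le> \<nu> z" "y / z \<in> Zpbar \<nu>" "y' / z \<in> Zpbar \<nu>" for z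
  proof (rule LL_I[OF that(2)])
    show "(\<lambda>x. const2 (y / z) * g x + const2 (y' / z) * g' x) \<in> IZ r"
      using that f f' by (intro IZ_add IZ_const2)
    show "(\<lambda>x. h x + h' x) \<in> IQ r" using f f' by (intro IQ_add)
    have "const2 z * const2 (y / z) = const2 y" "const2 z * const2 (y' / z) = const2 y'"
      using that by (simp_all flip: const2_mult)
    hence z: "const2 z * (const2 (y / z) * g x + const2 (y' / z) * g' x) = const2 y * g x + const2 y' * g' x" for x
      by (simp add: distrib_left flip: mult.assoc)
    show "f x + f' x = const2 z * (const2 (y / z) * g x + const2 (y' / z) * g' x) +
        (T (\<lambda>x. h x + h' x) x - const2 ap * (h x + h' x))" for x
      unfolding z using T_add[OF f(3) f'(3)] by (simp add: f(4) f'(4) algebra_simps)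
  qed
  consider "y = 0" "y' = 0" | "y \<noteq> 0" "\<nu> y \<le> \<nu> y'" | "y' \<noteq> 0" "\<nu> y' \<le> \<nu> y"
    using val_eq_PInf nu_0 by (metis linear ereal_infty_less_eq(1))
  thus ?thesis
  proof cases
    case 1
    show ?thesis
      by (rule LL_I[of e 0 "\<lambda>_. 0" "\<lambda>x. h x + h' x"])
        (use 1 f f' in \<open>auto simp: IZ_0 T_add algebra_simps intro!: IQ_add\<close>)
  next
    case 2
    then obtain a where a: "\<nu> y = ereal a" using nu_ereal by blast
    hence "\<nu> (inverse y) = ereal (- a)" by (rule nu_inverse)
    hence "0 \<le> \<nu> (y' / y)" using 2 a by (cases "\<nu> y'") (auto simp: divide_inverse val_mult)
    thus ?thesis using 2 f by (intro *[of y]) (auto simp: Zpbar_iff)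
  next
    case 3
    then obtain a where a: "\<nu> y' = ereal a" using nu_ereal by blast
    hence "\<nu> (inverse y') = ereal (- a)" by (rule nu_inverse)
    hence "0 \<le> \<nu> (y / y')" using 3 a by (cases "\<nu> y") (auto simp: divide_inverse val_mult)
    thus ?thesis using 3 f' by (intro *[of y']) (auto simp: Zpbar_iff)
  qed
qed

lemma LL_add: "f \<in> LL e \<Longrightarrow> f' \<in> LL e' \<Longrightarrow> (\<lambda>x. f x + f' x) \<in> LL (min e e')"
  by (rule LL_add_aux) (auto intro: LL_mono)

lemma LL_0: "(\<lambda>_. 0) \<in> LL e"
  by (rule LL_I[of e 0 "\<lambda>_. 0" "\<lambda>_. 0"]) (simp_all add: IZ_0 IQ_0 T_0)

lemma LL_sum: "(\<And>i. i \<in> A \<Longrightarrow> f i \<in> LL e) \<Longrightarrow> (\<lambda>x. \<Sum>i\<in>A. f i x) \<in> LL e"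
  by (induction A rule: infinite_finite_induct) (auto simp: LL_0 intro: LL_add_aux)

lemma LL_const2:
  assumes "f \<in> LL e" "ereal b \<le> \<nu> a"
  shows "(\<lambda>x. const2 a * f x) \<in> LL (e + b)"
proof -
  obtain y g h where f: "ereal e \<le> \<nu> y" "g \<in> IZ r" "h \<in> IQ r"
    "f = (\<lambda>x. const2 y * g x + (T h x - const2 ap * h x))" using LL_E[OF assms(1)] .
  show ?thesis
    by (rule LL_I[of _ "y * a" g "\<lambda>x. const2 a * h x"])
      (use f assms(2) in \<open>auto intro!: nu_mult_ge IQ_const2 simp: T_const2 const2_mult algebra_simps\<close>)
qed

lemma LL_translate:
  assumes "f \<in> LL e" "g0 \<in> G0"
  shows "(\<lambda>x. f (x ** g0)) \<in> LL e"
proof -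
  obtain y g h where f: "ereal e \<le> \<nu> y" "g \<in> IZ r" "h \<in> IQ r"
    "f = (\<lambda>x. const2 y * g x + (T h x - const2 ap * h x))" using LL_E[OF assms(1)] .
  show ?thesis
    by (rule LL_I[of _ y "\<lambda>x. g (x ** g0)" "\<lambda>x. h (x ** g0)"])
      (use f assms(2) in \<open>simp_all add: translate_IZ translate_IQ T_translate\<close>)
qed

lemma LL_hecke: "h \<in> IQ r \<Longrightarrow> (\<lambda>x. T h x - const2 ap * h x) \<in> LL e"
  by (rule LL_I[of e 0 "\<lambda>_. 0" h]) (simp_all add: IZ_0)

text \<open>Divisibility of the class of [1, v], where v may have non-integral coefficients and
  \<open>e\<close> may be negative. By translation it is the same condition for every [g, v], so it
  is stable under K.\<close>

definition A :: "real \<Rightarrow> 'k poly poly \<Rightarrow> bool" where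
  "A e v \<longleftrightarrow> v \<in> Sym r UNIV \<and> br (mat 1) v \<in> LL e"

lemma A_Sym: "A e v \<Longrightarrow> v \<in> Sym r UNIV"
  by (simp add: A_def)

lemma A_mono: "A e v \<Longrightarrow> e' \<le> e \<Longrightarrow> A e' v"
  by (auto simp: A_def intro: LL_mono)

lemma A_add: "A e v \<Longrightarrow> A e w \<Longrightarrow> A e (v + w)"
  using LL_add_aux[of "br (mat 1) v" e "br (mat 1) w"]
  by (auto simp: A_def Sym_add br_add[abs_def])

lemma A_0: "A e 0"
  by (simp add: A_def Sym_0 LL_0)

lemma A_sum: "(\<And>i. i \<in> I \<Longrightarrow> A e (f i)) \<Longrightarrow> A e (sum f I)"
  by (induction I rule: infinite_finite_induct) (auto simp: A_0 intro: A_add)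

lemma A_const2: "A e v \<Longrightarrow> ereal b \<le> \<nu> a \<Longrightarrow> A (e + b) (const2 a * v)"
  using LL_const2[of "br (mat 1) v" e b a]
  by (auto simp: A_def Sym_const2_mult br_const2[abs_def])

lemma A_const2_0: "A e v \<Longrightarrow> 0 \<le> \<nu> a \<Longrightarrow> A e (const2 a * v)"
  using A_const2[of e v 0 a] by (simp add: zero_ereal_def)

lemma A_minus: "A e v \<Longrightarrow> A e (- v)"
  using A_const2_0[of e v "-1"] by (simp add: const2_minus)

lemma A_diff: "A e v \<Longrightarrow> A e w \<Longrightarrow> A e (v - w)"
  using A_add[OF _ A_minus, of e v w] by simp

text \<open>The function h in \<open>LL\<close> ranges over all of \<open>ind_Qpbar\<close>, so
  divisibility is measured inside a vector space and scalars can be cancelled.\<close>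

lemma A_divide:
  assumes "A e (const2 a * v)" "\<nu> a = ereal b"
  shows "A (e - b) v"
proof -
  have "a \<noteq> 0" using assms(2) by auto
  hence "const2 (inverse a) * const2 a = 1" by (simp flip: const2_mult)
  hence "const2 (inverse a) * (const2 a * v) = v" by (simp only: mult.assoc[symmetric]) simp
  moreover have "A (e + - b) (const2 (inverse a) * (const2 a * v))"
    using nu_inverse[OF assms(2)] by (intro A_const2[OF assms(1)]) simp
  ultimately show ?thesis by (simp only: diff_conv_add_uminus)
qed

lemma A_br:
  assumes "A e v" "g \<in> G0"
  shows "br g v \<in> LL e"
proof -
  have "(\<lambda>x. br (mat 1) v (x ** g)) \<in> LL e" using assms by (intro LL_translate) (auto simp: A_def)
  thus ?thesis by (simp flip: br_translate)
qed

lemma A_of_br: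
  assumes "br g v \<in> LL e" "g \<in> G0" "v \<in> Sym r UNIV"
  shows "A e v"
proof -
  have "(\<lambda>x. br g v (x ** matrix_inv g)) \<in> LL e" using assms G0_inv by (intro LL_translate) auto
  thus ?thesis using assms G0_inv by (simp add: A_def flip: br_translate)
qed

lemma A_act:
  assumes "A e v" "k \<in> K0"
  shows "A e (act k v)"
proof -
  have "br (mat 1) (act k v) = br (mat 1 ** k) v"
    using assms by (subst br_KZ) (auto simp: K0_KZ KZ_act_def K_part_K0)
  thus ?thesis using A_br[OF assms(1) K0_G0[OF assms(2)]] A_Sym[OF assms(1)] by (simp add: A_def Sym_mat_act)
qed

text \<open>For a real number e there may be no scalar of valuation exactly e, so each monomial is
  divided by its own coefficient.\<close>

lemma A_vge:
  assumes "v \<in> Sym r UNIV" "vge e v"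
  shows "A e v"
proof -
  have *: "A e (const2 a * varx ^ i * vary ^ j)" if "ereal e \<le> \<nu> a" "i + j = r" for a i j
  proof -
    have v: "varx ^ i * vary ^ j \<in> Sym r (Zpbar \<nu>)" using that by (simp add: Sym_Zpbar_iff Sym_monom vge_monom)
    have "br (mat 1) (const2 a * (varx ^ i * vary ^ j)) \<in> LL e"
      by (rule LL_I[of e a "br (mat 1) (varx ^ i * vary ^ j)" "\<lambda>_. 0"])
        (use that v in \<open>auto simp: br_const2 T_0 IQ_0 intro!: br_IZ G0_1\<close>)
    thus ?thesis using that by (simp add: A_def Sym_const2_mult Sym_monom mult.assoc)
  qed
  show ?thesis
    by (subst Sym_decomp[OF assms(1)], rule A_sum) (use assms(2) in \<open>auto simp: vge_def intro!: *\<close>)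
qed

abbreviation hact :: "'f option \<Rightarrow> 'k poly poly \<Rightarrow> 'k poly poly" where
  "hact i \<equiv> act (adj2 (hrep i))"

lemma hact_Some: "hact (Some l) varx = varx"
    "hact (Some l) vary = const2 pk * vary - const2 (teich l) * varx"
  and hact_None: "hact None varx = const2 pk * varx" "hact None vary = vary"
  by (simp_all add: mat_act_simps adj2_def hrep_def const2_minus)

text \<open>In the quotient, \<open>ap\<close> [1, v] equals T [1, v], the sum of the brackets of
  the \<open>hact i v\<close>. Divisibility of all of these passes to \<open>ap\<close> v.\<close>

lemma A_hecke:
  assumes "v \<in> Sym r UNIV" "\<And>i. i \<in> hidx \<Longrightarrow> A e (hact i v)"
  shows "A e (const2 ap * v)"
proof -
  have "(\<lambda>x. (\<Sum>i\<in>hidx. br (hrep i) (hact i v) x)) \<in> LL e"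
    using assms by (intro LL_sum A_br hrep_G0)
  moreover have "(\<lambda>x. const2 (- 1) * (T (br (mat 1) v) x - const2 ap * br (mat 1) v x)) \<in> LL (e + 0)"
    using assms(1) nu_minus[of 1] by (intro LL_const2 LL_hecke br_IQ G0_1) (simp_all add: zero_ereal_def)
  ultimately have "(\<lambda>x. (\<Sum>i\<in>hidx. br (hrep i) (hact i v) x) + const2 (- 1) * (T (br (mat 1) v) x - const2 ap * br (mat 1) v x)) \<in> LL e"
    using LL_add_aux by simp
  moreover have "T (br (mat 1) v) x = (\<Sum>i\<in>hidx. br (hrep i) (hact i v) x)" for x
    using T_br[OF G0_1 assms(1)] by (simp add: hb_eq)
  ultimately have "br (mat 1) (const2 ap * v) \<in> LL e"
    by (simp add: const2_minus br_const2[abs_def])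
  thus ?thesis using assms(1) by (simp add: A_def Sym_const2_mult)
qed

text \<open>The same relation solved for a single term of the Hecke sum.\<close>

lemma A_hecke':
  assumes "v \<in> Sym r UNIV" "j \<in> hidx" "\<And>i. i \<in> hidx \<Longrightarrow> i \<noteq> j \<Longrightarrow> A e (hact i v)" "A e (const2 ap * v)"
  shows "A e (hact j v)"
proof -
  have "(\<lambda>x. (\<Sum>i\<in>hidx - {j}. br (hrep i) (hact i v) x)) \<in> LL e"
    using assms by (intro LL_sum A_br hrep_G0) auto
  hence "(\<lambda>x. const2 (- 1) * (\<Sum>i\<in>hidx - {j}. br (hrep i) (hact i v) x)) \<in> LL (e + 0)"
    by (rule LL_const2) (simp add: zero_ereal_def[symmetric])
  moreover have "(\<lambda>x. T (br (mat 1) v) x - const2 ap * br (mat 1) v x) \<in> LL e"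
    using assms(1) by (intro LL_hecke br_IQ G0_1)
  moreover have "br (mat 1) (const2 ap * v) \<in> LL e" using assms(4) by (simp add: A_def)
  ultimately have "(\<lambda>x. const2 (- 1) * (\<Sum>i\<in>hidx - {j}. br (hrep i) (hact i v) x) +
      ((T (br (mat 1) v) x - const2 ap * br (mat 1) v x) + br (mat 1) (const2 ap * v) x)) \<in> LL e"
    using LL_add_aux by simp
  moreover have "T (br (mat 1) v) x = br (hrep j) (hact j v) x + (\<Sum>i\<in>hidx - {j}. br (hrep i) (hact i v) x)" for x
    using T_br[OF G0_1 assms(1)] assms(2) by (simp add: hb_eq sum.remove)
  ultimately have "br (hrep j) (hact j v) \<in> LL e"
    by (simp add: const2_minus br_const2[abs_def])
  thus ?thesis using A_of_br hrep_G0 assms Sym_mat_act by blast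
qed

text \<open>The values of the valuation are dense, so there is no smallest positive exponent to fix.
  Finite sums stay inside by taking the minimum.\<close>

definition LLp :: "('k ^ 2 ^ 2 \<Rightarrow> 'k poly poly) set" where "LLp = (\<Union>e\<in>{0<..}. LL e)"

lemma LLp_sum:
  assumes "finite I" "\<And>i. i \<in> I \<Longrightarrow> f i \<in> LLp"
  shows "(\<lambda>x. \<Sum>i\<in>I. f i x) \<in> LLp"
  using assms
proof (induction I)
  case empty
  thus ?case using LL_0[of 1] by (auto simp: LLp_def)
next
  case (insert i I)
  obtain e e' where "f i \<in> LL e" "e > 0" "(\<lambda>x. \<Sum>i\<in>I. f i x) \<in> LL e'" "e' > 0"
    using insert.IH insert.prems unfolding LLp_def by (metis (no_types, lifting) UN_E greaterThan_iff insert_iff)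
  hence "(\<lambda>x. f i x + (\<Sum>i\<in>I. f i x)) \<in> LL (min e e')" "min e e' > 0" using LL_add by auto
  thus ?case using insert by (auto simp: LLp_def)
qed

definition Ap :: "'k poly poly \<Rightarrow> bool" where "Ap v \<longleftrightarrow> (\<exists>e>0. A e v)"

lemma Ap_br: "Ap v \<Longrightarrow> g \<in> G0 \<Longrightarrow> br g v \<in> LLp"
  using A_br by (auto simp: Ap_def LLp_def)

lemma Ap_add: "Ap v \<Longrightarrow> Ap w \<Longrightarrow> Ap (v + w)"
  unfolding Ap_def
proof safe
  fix e e' assume "0 < e" "A e v" "0 < e'" "A e' w"
  thus "\<exists>e>0. A e (v + w)" by (intro exI[of _ "min e e'"]) (auto intro!: A_add intro: A_mono)
qed

lemma Ap_0: "Ap 0"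
  using A_0[of 1] by (auto simp: Ap_def intro: exI[of _ 1])

lemma Ap_sum: "(\<And>i. i \<in> I \<Longrightarrow> Ap (f i)) \<Longrightarrow> Ap (sum f I)"
  by (induction I rule: infinite_finite_induct) (auto simp: Ap_0 intro: Ap_add)

lemma Ap_const2: "Ap v \<Longrightarrow> 0 \<le> \<nu> a \<Longrightarrow> Ap (const2 a * v)"
  using A_const2_0 by (auto simp: Ap_def)

lemma Ap_act: "Ap v \<Longrightarrow> k \<in> K0 \<Longrightarrow> Ap (act k v)"
  using A_act by (auto simp: Ap_def)

lemma Ap_red2_0:
  assumes "v \<in> Sym r UNIV" "vge 0 v" "red2 red v = 0"
  shows "Ap v"
proof -
  have pos: "0 < \<nu> (coeff (coeff v j) i)" for i j using assms red2_eq_0_iff by blast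
  have "Ap (const2 (coeff (coeff v j) (r - j)) * varx ^ (r - j) * vary ^ j)" if "j \<le> r" for j
  proof -
    obtain e :: real where e: "e > 0" "ereal e \<le> \<nu> (coeff (coeff v j) (r - j))"
      using pos[of j "r - j"] by (cases "\<nu> (coeff (coeff v j) (r - j))") (auto intro: that[of 1])
    have "vge e (const2 (coeff (coeff v j) (r - j)) * (varx ^ (r - j) * vary ^ j))"
      using e by (intro vge_mult0 vge_monom) (simp add: vge_const2)
    moreover have "const2 (coeff (coeff v j) (r - j)) * (varx ^ (r - j) * vary ^ j) \<in> Sym r UNIV"
      using that by (intro Sym_const2_mult Sym_monom) auto
    ultimately show ?thesis using A_vge e(1) by (auto simp: Ap_def mult.assoc)
  qed
  thus ?thesis by (subst Sym_decomp[OF assms(1)]) (auto intro!: Ap_sum)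
qed

end

section \<open>The quotient \<open>\<Theta>\<close> modulo the maximal ideal\<close>

context hecke_quotient
begin

abbreviation IG where "IG \<equiv> ind_group p \<nu> r"
abbreviation HI where "HI \<equiv> hecke_image p \<nu> red r ap"
abbreviation cls where "cls \<equiv> Theta_class p \<nu> red r ap"
abbreviation Th where "Th \<equiv> Theta p \<nu> red r ap"
abbreviation mTh where "mTh \<equiv> max_ideal_Theta p \<nu> red r ap"

lemma IG_simps [simp]: "carrier IG = IQ r" "mult IG = (\<lambda>f h g. f g + h g)" "one IG = (\<lambda>g. 0)"
  by (simp_all add: ind_group_def)

lemma comm_group_IG: "comm_group IG"
proof (rule comm_groupI)
  fix x assume "x \<in> carrier IG"
  thus "\<exists>y\<in>carrier IG. y \<otimes>\<^bsub>IG\<^esub> x = \<one>\<^bsub>IG\<^esub>" by (intro bexI[of _ "\<lambda>g. - x g"]) (auto intro: IQ_minus)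
qed (auto intro: IQ_add IQ_0 simp: add_ac)

lemma HI_E: "f \<in> HI \<Longrightarrow> \<exists>h\<in>IQ r. f = (\<lambda>g. T h g - const2 ap * h g)"
  by (auto simp: hecke_image_def)

lemma HI_I: "h \<in> IQ r \<Longrightarrow> (\<lambda>g. T h g - const2 ap * h g) \<in> HI"
  by (auto simp: hecke_image_def)

lemma HI_IQ: "f \<in> HI \<Longrightarrow> f \<in> IQ r"
  using HI_E[of f] by (auto intro!: IQ_diff T_IQ IQ_const2)

lemma HI_add: "f \<in> HI \<Longrightarrow> f' \<in> HI \<Longrightarrow> (\<lambda>g. f g + f' g) \<in> HI"
proof -
  assume "f \<in> HI" "f' \<in> HI"
  then obtain h h' where h: "h \<in> IQ r" "f = (\<lambda>g. T h g - const2 ap * h g)"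
    "h' \<in> IQ r" "f' = (\<lambda>g. T h' g - const2 ap * h' g)" using HI_E by meson
  hence "(\<lambda>g. T (\<lambda>g. h g + h' g) g - const2 ap * (h g + h' g)) \<in> HI" by (intro HI_I IQ_add)
  thus ?thesis using h by (simp add: T_add algebra_simps)
qed

lemma HI_minus: "f \<in> HI \<Longrightarrow> (\<lambda>g. - f g) \<in> HI"
proof -
  assume "f \<in> HI"
  then obtain h where h: "h \<in> IQ r" "f = (\<lambda>g. T h g - const2 ap * h g)" using HI_E by meson
  hence "(\<lambda>g. T (\<lambda>g. const2 (- 1) * h g) g - const2 ap * (const2 (- 1) * h g)) \<in> HI" by (intro HI_I IQ_const2)
  thus ?thesis unfolding T_const2[OF h(1)] by (simp add: h(2) const2_minus)
qed

lemma HI_0: "(\<lambda>_. 0) \<in> HI"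
  using HI_I[OF IQ_0] by (simp add: T_0)

lemma subgroup_HI: "subgroup HI IG"
proof -
  interpret comm_group IG by (rule comm_group_IG)
  have "inv\<^bsub>IG\<^esub> f = (\<lambda>g. - f g)" if "f \<in> IQ r" for f
    using that by (intro inv_equality) (auto intro: IQ_minus)
  thus ?thesis using HI_0 HI_IQ HI_minus HI_add by unfold_locales auto
qed

lemma normal_HI: "HI \<lhd> IG"
  using comm_group.normal_iff_subgroup[OF comm_group_IG] subgroup_HI by blast

lemma cls_mem: "f' \<in> cls f \<longleftrightarrow> (\<lambda>g. f' g - f g) \<in> HI"
proof -
  have "f' \<in> cls f \<longleftrightarrow> (\<exists>h\<in>HI. f' = (\<lambda>g. h g + f g))"
    by (auto simp: Theta_class_def r_coset_def)
  also have "\<dots> \<longleftrightarrow> (\<lambda>g. f' g - f g) \<in> HI"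
    by (auto intro!: bexI[of _ "\<lambda>g. f' g - f g"])
  finally show ?thesis .
qed

lemma cls_eqI:
  assumes "(\<lambda>g. f' g - f g) \<in> HI"
  shows "cls f' = cls f"
proof -
  have "(\<lambda>g. h g - f' g) \<in> HI \<longleftrightarrow> (\<lambda>g. h g - f g) \<in> HI" for h
    using HI_add[OF _ assms, of "\<lambda>g. h g - f' g"] HI_add[OF _ HI_minus[OF assms], of "\<lambda>g. h g - f g"] by auto
  thus ?thesis using cls_mem by auto
qed

lemma cls_mult: "f \<in> IQ r \<Longrightarrow> f' \<in> IQ r \<Longrightarrow> cls f <#>\<^bsub>IG\<^esub> cls f' = cls (\<lambda>g. f g + f' g)"
  unfolding Theta_class_def using normal.rcos_sum[OF normal_HI, of f f'] by simp

lemma Th_simps: "carrier Th = cls ` IZ r" "mult Th = set_mult IG" "one Th = HI"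
  by (simp_all add: Theta_def FactGroup_def)

lemma cls_0: "cls (\<lambda>_. 0) = HI"
  using cls_mem[of _ "\<lambda>_. 0"] by auto

text \<open>\<open>Theta\<close> is the quotient group with a smaller carrier, hence a group because
  the classes of integral functions form a subgroup.\<close>

lemma group_Th: "group Th"
proof -
  interpret F: group "IG Mod HI" by (rule normal.factorgroup_is_group[OF normal_HI])
  have c: "cls f \<in> carrier (IG Mod HI)" if "f \<in> IQ r" for f
    using that by (auto simp: carrier_FactGroup Theta_class_def)
  have m: "cls f \<otimes>\<^bsub>IG Mod HI\<^esub> cls f' = cls (\<lambda>g. f g + f' g)" if "f \<in> IQ r" "f' \<in> IQ r" for f f'
    using cls_mult that by simp
  have inv: "inv\<^bsub>IG Mod HI\<^esub> (cls f) = cls (\<lambda>g. - f g)" if "f \<in> IQ r" for f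
    using that m[of "\<lambda>g. - f g" f] by (intro F.inv_equality) (auto intro: c IQ_minus simp: cls_0)
  have "subgroup (cls ` IZ r) (IG Mod HI)"
  proof (rule F.subgroupI)
    show "cls ` IZ r \<subseteq> carrier (IG Mod HI)" using c IZ_IQ by auto
    show "cls ` IZ r \<noteq> {}" using IZ_0 by auto
  next
    fix X assume "X \<in> cls ` IZ r"
    then obtain f where "f \<in> IZ r" "X = cls f" by auto
    thus "inv\<^bsub>IG Mod HI\<^esub> X \<in> cls ` IZ r"
      using inv[OF IZ_IQ] IZ_diff[OF IZ_0] by simp
  next
    fix X Y assume "X \<in> cls ` IZ r" "Y \<in> cls ` IZ r"
    then obtain f f' where "f \<in> IZ r" "X = cls f" "f' \<in> IZ r" "Y = cls f'" by auto
    thus "X \<otimes>\<^bsub>IG Mod HI\<^esub> Y \<in> cls ` IZ r"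
      using m[OF IZ_IQ IZ_IQ] IZ_add by simp
  qed
  thus ?thesis using F.subgroup_imp_group by (simp add: Theta_def)
qed

lemma mTh_subgroup: "subgroup mTh Th"
  unfolding max_ideal_Theta_def
  by (rule group.generate_is_subgroup[OF group_Th])
    (auto simp: Th_simps intro!: IZ_const2 intro: less_imp_le simp: Zpbar_iff)

lemma mTh_cls: "0 < \<nu> a \<Longrightarrow> f \<in> IZ r \<Longrightarrow> cls (\<lambda>g. const2 a * f g) \<in> mTh"
  unfolding max_ideal_Theta_def by (rule generate.incl) blast

abbreviation bcls where "bcls f \<equiv> mTh #>\<^bsub>Th\<^esub> cls f"

text \<open>The bridge from \<open>LL\<close> to the reduction: in the expression from
  \<open>LLp\<close>, the part T h - \<open>ap\<close> h vanishes in \<open>Theta\<close>, and the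
  part with a scalar of positive valuation lies in the submodule that is factored out.\<close>

lemma bcls_eqI:
  assumes "f \<in> IZ r" "f' \<in> IZ r" "(\<lambda>g. f g - f' g) \<in> LLp"
  shows "bcls f = bcls f'"
proof -
  interpret Th: group Th by (rule group_Th)
  obtain e where e: "e > 0" "(\<lambda>g. f g - f' g) \<in> LL e" using assms(3) by (auto simp: LLp_def)
  obtain y g h where y: "ereal e \<le> \<nu> y" "g \<in> IZ r" "h \<in> IQ r"
    "(\<lambda>x. f x - f' x) = (\<lambda>x. const2 y * g x + (T h x - const2 ap * h x))" using LL_E[OF e(2)] .
  have y0: "0 < \<nu> y" using y(1) e(1) less_le_trans[of 0 "ereal e" "\<nu> y"] by simp
  have yg: "(\<lambda>x. const2 y * g x) \<in> IZ r" using y y0 by (intro IZ_const2) (auto simp: Zpbar_iff)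
  have "f x - (const2 y * g x + f' x) = T h x - const2 ap * h x" for x
    using fun_cong[OF y(4), of x] by (simp add: algebra_simps)
  hence "cls f = cls (\<lambda>x. const2 y * g x + f' x)"
    using HI_I[OF y(3)] by (intro cls_eqI) simp
  also have "\<dots> = cls (\<lambda>x. const2 y * g x) \<otimes>\<^bsub>Th\<^esub> cls f'"
    using cls_mult[OF IZ_IQ[OF yg] IZ_IQ[OF assms(2)]] by (simp add: Th_simps)
  finally have "bcls f = bcls (\<lambda>x. const2 y * g x) #>\<^bsub>Th\<^esub> cls f'"
    using assms(2) yg subgroup.subset[OF mTh_subgroup]
    by (subst Th.coset_mult_assoc) (auto simp: Th_simps)
  also have "bcls (\<lambda>x. const2 y * g x) = mTh"
    using mTh_cls[OF y0 y(2)] yg by (intro Th.coset_join2 mTh_subgroup) (auto simp: Th_simps)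
  finally show ?thesis .
qed

lemma bcls_0: "bcls (\<lambda>_. 0) = mTh"
proof -
  interpret Th: group Th by (rule group_Th)
  have "cls (\<lambda>_. 0) \<in> carrier Th" using IZ_0 by (auto simp: Th_simps)
  moreover have "cls (\<lambda>_. 0) \<in> mTh"
    using subgroup.one_closed[OF mTh_subgroup] by (simp add: cls_0 Th_simps)
  ultimately show ?thesis by (intro Th.coset_join2 mTh_subgroup)
qed

lemma LLp_br_sum:
  assumes f: "f \<in> IQ r" and Ap: "\<And>C. C \<in> cosets f \<Longrightarrow> Ap (f (matrix_inv (rep C)))"
  shows "f \<in> LLp"
proof -
  have "(\<lambda>x. \<Sum>C\<in>cosets f. br (rep C) (f (matrix_inv (rep C))) x) \<in> LLp"
    using Ap by (intro LLp_sum finite_cosets[OF f] Ap_br rep_G0)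
  thus ?thesis using c_ind_decomp[OF f] by simp
qed

text \<open>Two integral lifts differ by a function whose values reduce to 0, and such a function
  dies in the reduction. Hence the description in \<open>P_map\<close> has a unique
  solution.\<close>

lemma P_map_eq:
  assumes "F \<in> IZ r" "\<And>g. red2 red (F g) = f g"
  shows "P_map p \<nu> red r ap f = bcls F"
  unfolding P_map_def
proof (rule the_equality)
  show "\<exists>F'\<in>IZ r. (\<forall>g. map_poly (map_poly red) (F' g) = f g) \<and> bcls F = bcls F'"
    using assms by (auto simp: red2_def)
  fix X assume "\<exists>F\<in>IZ r. (\<forall>g. map_poly (map_poly red) (F g) = f g) \<and> X = bcls F"
  then obtain F' where F': "F' \<in> IZ r" "\<And>g. red2 red (F' g) = f g" "X = bcls F'" by (auto simp: red2_def)
  have "(\<lambda>g. F' g - F g) \<in> LLp"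
  proof (rule LLp_br_sum)
    show "(\<lambda>g. F' g - F g) \<in> IQ r" using F' assms IZ_diff IZ_IQ by blast
    fix C assume "C \<in> cosets (\<lambda>g. F' g - F g)"
    hence G: "matrix_inv (rep C) \<in> G0" by (rule rep_G0)
    have "F' (matrix_inv (rep C)) \<in> Sym r (Zpbar \<nu>)" "F (matrix_inv (rep C)) \<in> Sym r (Zpbar \<nu>)"
      using c_ind_value F'(1) assms(1) G by blast+
    thus "Ap (F' (matrix_inv (rep C)) - F (matrix_inv (rep C)))"
      using F'(2) assms(2) by (intro Ap_red2_0) (auto simp: Sym_Zpbar_iff Sym_diff vge_diff red2_diff)
  qed
  thus "X = bcls F" using bcls_eqI F' assms by blast
qed

text \<open>The lift is assembled from prescribed lifts at the coset representatives, so that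
  special lifts, such as those satisfying \<open>Ap\<close>, can be fed in.\<close>

lemma c_ind_lift:
  assumes f: "f \<in> c_ind p \<nu> red W" and W: "\<And>w. w \<in> W \<Longrightarrow> l w \<in> Sym r UNIV \<and> vge 0 (l w) \<and> red2 red (l w) = w"
  shows "\<exists>F\<in>IZ r. (\<forall>g. red2 red (F g) = f g) \<and>
     (F = (\<lambda>x. \<Sum>C\<in>cosets f. br (rep C) (l (f (matrix_inv (rep C)))) x))"
proof -
  define F where "F = (\<lambda>x. \<Sum>C\<in>cosets f. br (rep C) (l (f (matrix_inv (rep C)))) x)"
  have l: "l (f (matrix_inv (rep C))) \<in> Sym r (Zpbar \<nu>)" "red2 red (l (f (matrix_inv (rep C)))) = f (matrix_inv (rep C))"
    if "C \<in> cosets f" for C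
    using W[OF c_ind_value[OF f rep_G0(2)[OF that]]] by (auto simp: Sym_Zpbar_iff)
  have FZ: "F \<in> IZ r" unfolding F_def by (intro IZ_sum br_IZ l rep_G0)
  have "red2 red (F x) = f x" for x
  proof (cases "x \<in> G0")
    case False
    thus ?thesis using c_ind_outside[OF f] c_ind_outside[OF FZ] by simp
  next
    case True
    have "red2 red (F x) = (\<Sum>C\<in>cosets f. red2 red (br (rep C) (l (f (matrix_inv (rep C)))) x))"
      unfolding F_def
    proof (rule red2_sum)
      fix C assume "C \<in> cosets f"
      hence "br (rep C) (l (f (matrix_inv (rep C)))) x \<in> Sym r (Zpbar \<nu>)"
        using c_ind_value[OF br_IZ] True l rep_G0 by blast
      thus "vge 0 (br (rep C) (l (f (matrix_inv (rep C)))) x)" by (simp add: Sym_Zpbar_iff)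
    qed
    also have "\<dots> = f x"
    proof (rule sum_cosets[OF f _ True])
      fix C assume C: "C \<in> cosets f"
      show "red2 red (br (rep C) (l (f (matrix_inv (rep C)))) x) = f x" if "x ** rep C \<in> KZ \<nu>"
        using that l[OF C] c_ind_at_rep[OF f C True that] by (simp add: br_def red2_kzact[of _ _ r] Sym_Zpbar_iff)
      show "red2 red (br (rep C) (l (f (matrix_inv (rep C)))) x) = 0" if "x ** rep C \<notin> KZ \<nu>"
        using that by (simp add: br_def)
    qed (simp add: KZ_act_def)
    finally show ?thesis .
  qed
  thus ?thesis using FZ by (intro bexI[of _ F]) (simp_all add: F_def)
qed

text \<open>Reduces a statement about functions on G to one about single vectors. Stability under K
  enters because a bracket takes \<open>KZ\<close>-translates of its vector as values.\<close>

lemma P_induces_surjectionI: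
  assumes kill: "\<And>w. w \<in> V_theta p r n \<Longrightarrow> \<exists>v. v \<in> Sym r UNIV \<and> vge 0 v \<and> red2 red v = w \<and> Ap v"
    and gen: "\<And>v. v \<in> Sym r UNIV \<Longrightarrow> vge 0 v \<Longrightarrow>
       \<exists>u. u \<in> Sym r UNIV \<and> vge 0 u \<and> red2 red u \<in> V_theta p r m \<and> Ap (v - u)"
    and stable: "\<And>k w. k \<in> K0 \<Longrightarrow> w \<in> V_theta p r m \<Longrightarrow> mat_act red k w \<in> V_theta p r m"
  shows "P_induces_surjection p \<nu> red r ap m n"
  unfolding P_induces_surjection_def
proof (rule conjI; (rule ballI | rule equalityI; rule subsetI))
  fix f assume f: "f \<in> c_ind p \<nu> red (V_theta p r n)"
  from kill obtain l where l: "\<And>w. w \<in> V_theta p r n \<Longrightarrow> Ap (l w) \<and> l w \<in> Sym r UNIV \<and> vge 0 (l w) \<and> red2 red (l w) = w"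
    by metis
  obtain F where F: "F \<in> IZ r" "\<And>g. red2 red (F g) = f g"
    "F = (\<lambda>x. \<Sum>C\<in>cosets f. br (rep C) (l (f (matrix_inv (rep C)))) x)"
    using c_ind_lift[OF f, of l] l by blast
  have "F \<in> LLp" unfolding F(3)
    using l c_ind_value[OF f] by (intro LLp_sum finite_cosets[OF f] Ap_br rep_G0) (auto intro: rep_G0)
  hence "bcls F = bcls (\<lambda>_. 0)" using F(1) IZ_0 by (intro bcls_eqI) auto
  thus "P_map p \<nu> red r ap f = \<one>\<^bsub>Theta_bar p \<nu> red r ap\<^esub>"
    using P_map_eq[OF F(1,2)] by (simp add: bcls_0 Theta_bar_def)
next
  fix X assume "X \<in> P_map p \<nu> red r ap ` c_ind p \<nu> red (V_theta p r m)"
  then obtain f where f: "f \<in> c_ind p \<nu> red (V_theta p r m)" and X: "X = P_map p \<nu> red r ap f" by blast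
  have "\<forall>w\<in>V_theta p r m. \<exists>v. v \<in> Sym r UNIV \<and> vge 0 v \<and> red2 red v = w"
    using red2_lift by (auto simp: V_theta_def)
  then obtain l where l: "\<And>w. w \<in> V_theta p r m \<Longrightarrow> l w \<in> Sym r UNIV \<and> vge 0 (l w) \<and> red2 red (l w) = w"
    by metis
  obtain F where "F \<in> IZ r" "\<And>g. red2 red (F g) = f g"
    using c_ind_lift[OF f, of l] l by blast
  thus "X \<in> carrier (Theta_bar p \<nu> red r ap)"
    unfolding X using P_map_eq by (auto simp: Theta_bar_def carrier_FactGroup Th_simps)
next
  fix X assume "X \<in> carrier (Theta_bar p \<nu> red r ap)"
  then obtain F where F: "F \<in> IZ r" "X = bcls F"
    by (auto simp: Theta_bar_def carrier_FactGroup Th_simps)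
  from gen obtain l where l: "\<And>v. v \<in> Sym r (Zpbar \<nu>) \<Longrightarrow> l v \<in> Sym r UNIV \<and> vge 0 (l v) \<and> red2 red (l v) \<in> V_theta p r m \<and> Ap (v - l v)"
    unfolding Sym_Zpbar_iff by metis
  have v: "F (matrix_inv (rep C)) \<in> Sym r (Zpbar \<nu>)" if "C \<in> cosets F" for C
    using c_ind_value[OF F(1) rep_G0(2)[OF that]] .
  define F' where "F' = (\<lambda>x. \<Sum>C\<in>cosets F. br (rep C) (l (F (matrix_inv (rep C)))) x)"
  have lZ: "l (F (matrix_inv (rep C))) \<in> Sym r (Zpbar \<nu>)" if "C \<in> cosets F" for C
    using l[OF v[OF that]] by (simp add: Sym_Zpbar_iff)
  have F'Z: "F' \<in> IZ r" unfolding F'_def by (intro IZ_sum br_IZ rep_G0 lZ)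
  have "(\<lambda>x. F x - F' x) \<in> LLp"
  proof -
    have "(\<lambda>x. \<Sum>C\<in>cosets F. br (rep C) (F (matrix_inv (rep C)) - l (F (matrix_inv (rep C)))) x) \<in> LLp"
      using l v by (intro LLp_sum finite_cosets[OF F(1)] Ap_br rep_G0) auto
    moreover have "br g (v - w) x = br g v x - br g w x" for g v w x
      using br_add[of g "v - w" w x] by simp
    ultimately have *: "(\<lambda>x. (\<Sum>C\<in>cosets F. br (rep C) (F (matrix_inv (rep C))) x) - F' x) \<in> LLp"
      by (simp add: F'_def sum_subtractf)
    show ?thesis using * fun_cong[OF c_ind_decomp[OF F(1)], symmetric] by (simp only:)
  qed
  hence eq: "X = bcls F'" using F F'Z bcls_eqI by blast
  define f where "f = (\<lambda>x. red2 red (F' x))"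
  have sumV: "sum g I \<in> V_theta p r m" if "\<And>i. i \<in> I \<Longrightarrow> g i \<in> V_theta p r m" for g and I :: "('k ^ 2 ^ 2) set set"
    using that by (auto simp: V_theta_def intro!: Sym_sum dvd_sum)
  have fV: "f x \<in> V_theta p r m" for x
  proof -
    have "vge 0 (br (rep C) (l (F (matrix_inv (rep C)))) x)" if "C \<in> cosets F" for C
      using lZ[OF that] by (auto simp: br_def Sym_Zpbar_iff intro: vge_kzact)
    hence "f x = (\<Sum>C\<in>cosets F. red2 red (br (rep C) (l (F (matrix_inv (rep C)))) x))"
      unfolding f_def F'_def by (intro red2_sum)
    moreover have "red2 red (br (rep C) (l (F (matrix_inv (rep C)))) x) \<in> V_theta p r m" if C: "C \<in> cosets F" for C
    proof (cases "x ** rep C \<in> KZ \<nu>")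
      case True
      have "red2 red (br (rep C) (l (F (matrix_inv (rep C)))) x) =
          mat_act red (K_part p \<nu> (x ** rep C)) (red2 red (l (F (matrix_inv (rep C)))))"
        using lZ[OF C] True by (simp add: br_def red2_kzact[of _ _ r] Sym_Zpbar_iff) (simp add: KZ_act_def)
      thus ?thesis using l[OF v[OF C]] stable KZ_decomp[OF True] by simp
    qed (simp add: br_def V_theta_def Sym_0)
    ultimately show ?thesis by (simp only:) (rule sumV)
  qed
  have "f \<in> c_ind p \<nu> red (V_theta p r m)"
    unfolding c_ind_def
  proof (intro CollectI conjI allI ballI impI)
    show "f g = 0" if "g \<notin> G0" for g using c_ind_outside[OF F'Z that] by (simp add: f_def)
    show "f g \<in> V_theta p r m" for g by (rule fV)
    show "f (h ** g) = KZ_act p \<nu> red h (f g)" if "h \<in> KZ \<nu>" "g \<in> G0" for h g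
      using c_ind_equivariant[OF F'Z that] c_ind_value[OF F'Z that(2)] red2_kzact[OF that(1), of "F' g" r]
      by (simp add: f_def Sym_Zpbar_iff)
    obtain S where S: "finite S" "S \<subseteq> G0" "{x. F' x \<noteq> 0} \<subseteq> (\<Union>s\<in>S. {h ** s | h. h \<in> KZ \<nu>})"
      using F'Z unfolding c_ind_def by auto
    have "{x. f x \<noteq> 0} \<subseteq> {x. F' x \<noteq> 0}" by (auto simp: f_def)
    thus "\<exists>S. finite S \<and> S \<subseteq> G0 \<and> {x. f x \<noteq> 0} \<subseteq> (\<Union>s\<in>S. {h ** s | h. h \<in> KZ \<nu>})"
      using S(1,2) order_trans[OF _ S(3)] by (intro exI[of _ S]) simp
  qed
  moreover have "P_map p \<nu> red r ap f = X" unfolding eq by (rule P_map_eq[OF F'Z]) (simp add: f_def)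
  ultimately show "X \<in> P_map p \<nu> red r ap ` c_ind p \<nu> red (V_theta p r m)" by blast
qed

end

section \<open>The lattice spanned by sublattices of index \<open>p\<close>\<close>

text \<open>From (X - j) C(X, j) = (j + 1) C(X, j + 1), multiplying an integral combination of
  binomial polynomials by X - e = (X - j) + (j - e) keeps it integral.\<close>

lemma prod_diff_binomial_basis:
  fixes S :: "nat set"
  assumes "finite S"
  shows "\<exists>b :: nat \<Rightarrow> int. \<forall>X :: nat. (\<Prod>e\<in>S. int X - int e) = (\<Sum>j\<le>card S. b j * int (X choose j))"
  using assms
proof (induction S)
  case empty
  show ?case by (intro exI[of _ "\<lambda>_. 1"]) simp
next
  case (insert e S)
  then obtain b :: "nat \<Rightarrow> int" where b: "\<And>X :: nat. (\<Prod>e\<in>S. int X - int e) = (\<Sum>j\<le>card S. b j * int (X choose j))"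
    by blast
  define n where "n = card S"
  define b' :: "nat \<Rightarrow> int" where
    "b' k = (if k = 0 then 0 else int k * b (k - 1)) + (if k \<le> n then (int k - int e) * b k else 0)" for k
  have absorb: "(int X - int j) * int (X choose j) = int (Suc j) * int (X choose Suc j)" for X j
  proof (cases "j \<le> X")
    case True
    have "Suc j * (X choose Suc j) = (X choose j) * (X - j)"
      using binomial_absorb_comp[of X j] binomial_absorption[of j X] True
      by (metis Suc_times_binomial_add add_diff_inverse_nat binomial_eq_0_iff choose_mult_lemma linorder_not_less mult.commute)
    thus ?thesis using True by (metis mult.commute of_nat_diff of_nat_mult)
  next
    case False
    thus ?thesis by (simp add: binomial_eq_0)
  qed
  have "(\<Prod>e\<in>insert e S. int X - int e) = (\<Sum>j\<le>card (insert e S). b' j * int (X choose j))" for X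
  proof -
    have "(\<Prod>e\<in>insert e S. int X - int e) = (int X - int e) * (\<Sum>j\<le>n. b j * int (X choose j))"
      using insert b by (simp add: n_def)
    also have "\<dots> = (\<Sum>j\<le>n. b j * ((int X - int j) * int (X choose j)) + (int j - int e) * b j * int (X choose j))"
      unfolding sum_distrib_left by (intro sum.cong) (auto simp: algebra_simps)
    also have "\<dots> = (\<Sum>j\<le>n. int (Suc j) * b j * int (X choose Suc j)) + (\<Sum>j\<le>n. (int j - int e) * b j * int (X choose j))"
      unfolding absorb by (simp add: sum.distrib mult_ac)
    also have "(\<Sum>j\<le>n. int (Suc j) * b j * int (X choose Suc j)) = (\<Sum>j\<le>Suc n. (if j = 0 then 0 else int j * b (j - 1)) * int (X choose j))"
      by (subst sum.atMost_Suc_shift) simp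
    also have "(\<Sum>j\<le>n. (int j - int e) * b j * int (X choose j)) = (\<Sum>j\<le>Suc n. (if j \<le> n then (int j - int e) * b j else 0) * int (X choose j))"
      by simp
    finally show ?thesis
      using insert by (simp add: n_def[symmetric] b'_def sum.distrib algebra_simps del: sum.atMost_Suc)
  qed
  thus ?case by blast
qed

lemma card_progression:
  assumes "finite X" "\<And>e. e \<in> X \<Longrightarrow> a \<le> e \<and> e \<le> b" "\<And>e e'. e \<in> X \<Longrightarrow> e' \<in> X \<Longrightarrow> e mod q = e' mod (q :: nat)" "0 < q"
  shows "card X \<le> (b - a) div q + 1"
proof -
  have "inj_on (\<lambda>e. (e - a) div q) X"
  proof (rule inj_onI)
    fix e e' assume e: "e \<in> X" "e' \<in> X" "(e - a) div q = (e' - a) div q"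
    have "(e - a) mod q = (e' - a) mod q"
    proof -
      have "int e mod int q = int e' mod int q" using assms(3)[OF e(1,2)] by (metis zmod_int)
      hence "(int e - int a) mod int q = (int e' - int a) mod int q" by (rule mod_diff_cong) simp
      hence "int (e - a) mod int q = int (e' - a) mod int q" using assms(2) e by (simp add: of_nat_diff)
      thus ?thesis by (metis zmod_int of_nat_eq_iff)
    qed
    hence "e - a = e' - a" using e(3) by (metis div_mult_mod_eq)
    thus "e = e'" using assms(2) e by (metis le_add_diff_inverse)
  qed
  hence "card X = card ((\<lambda>e. (e - a) div q) ` X)" by (simp add: card_image)
  also have "\<dots> \<le> card {..(b - a) div q}"
    using assms(2) by (intro card_mono) (auto intro!: div_le_mono diff_le_mono)
  finally show ?thesis by simp
qed

context padic_alg_closure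
begin

lemma nu_fact: "n < p ^ 2 \<Longrightarrow> \<nu> (fact n) = ereal (real (n div p))"
proof (induction n)
  case (Suc n)
  have "\<nu> (of_nat (Suc n)) = ereal (if p dvd Suc n then 1 else 0)"
  proof (cases "p dvd Suc n")
    case True
    then obtain k where k: "Suc n = p * k" by auto
    have "0 < k" using k by (cases k) simp_all
    have "p * k < p * p" using Suc.prems k by (metis power2_eq_square)
    hence "k < p" by simp
    hence "\<nu> (of_nat k) = 0" using \<open>0 < k\<close> by (intro nu_of_nat_eq_0) (auto dest: dvd_imp_le)
    thus ?thesis using True unfolding k of_nat_mult val_mult val_p by (simp add: one_ereal_def)
  next
    case False
    thus ?thesis using nu_of_nat_eq_0[of "Suc n"] by (simp add: zero_ereal_def)
  qed
  moreover have "Suc n div p = (if p dvd Suc n then Suc (n div p) else n div p)"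
    by (simp add: div_Suc dvd_eq_mod_eq_0)
  moreover have "\<nu> (fact (Suc n)) = \<nu> (of_nat (Suc n)) + \<nu> (fact n)"
    unfolding fact_Suc val_mult ..
  ultimately show ?case using Suc by auto
qed (simp add: zero_ereal_def[symmetric])

text \<open>Below p^2 each multiple of p contributes exactly 1 to the valuation of a factorial. The
  right-hand side is the carry out of the last digit in e + (s - e) to base p.\<close>

lemma nu_binomial:
  assumes "s < p ^ 2" "e \<le> s"
  shows "\<nu> (of_nat (s choose e)) = ereal (real (s div p) - real (e div p) - real ((s - e) div p))"
proof -
  have "fact e * fact (s - e) * of_nat (s choose e) = (fact s :: 'k)"
    using binomial_fact_lemma[OF assms(2)] by (metis of_nat_mult of_nat_fact)
  hence "\<nu> (fact e) + \<nu> (fact (s - e)) + \<nu> (of_nat (s choose e)) = \<nu> (fact s)"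
    by (metis val_mult)
  moreover have "\<nu> (fact e) = ereal (real (e div p))" "\<nu> (fact (s - e)) = ereal (real ((s - e) div p))"
    "\<nu> (fact s) = ereal (real (s div p))"
    using assms by (auto intro!: nu_fact)
  ultimately show ?thesis by (cases "\<nu> (of_nat (s choose e))") auto
qed

end

text \<open>The sets in \<open>B_low\<close>, \<open>B_row\<close> and \<open>B_high\<close> are the weight vectors, for the torus of roots of unity, in
  the span of the translates \<open>p\<^sup>j k (x\<^bsup>s-j\<^esup> y\<^sup>j)\<close> with \<open>k\<close> in \<open>K\<close>. This span is the sum of
  the lattices \<open>Sym\<^sup>s \<Lambda>\<close> over the sublattices \<open>\<Lambda>\<close> of index \<open>p\<close> of the standard lattice.\<close>

locale row_span = padic_alg_closure p \<nu> red
  for p :: nat and \<nu> :: "'k::{alg_closed_field, field_char_0} \<Rightarrow> ereal" and red :: "'k \<Rightarrow> 'f::field" +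
  fixes s :: nat and B :: "'k poly poly \<Rightarrow> bool"
  assumes B_add: "B F \<Longrightarrow> B G \<Longrightarrow> B (F + G)"
    and B_const2: "B F \<Longrightarrow> 0 \<le> \<nu> a \<Longrightarrow> B (const2 a * F)"
    and B_0: "B 0"
    and B_row: "j \<le> s \<Longrightarrow> B (const2 (pk ^ j) *
      (\<Sum>e | j \<le> e \<and> e \<le> s \<and> e mod (p - 1) = c. const2 (of_nat ((s - j) choose (e - j))) * (varx ^ (s - e) * vary ^ e)))"
    and B_low: "e \<le> s \<Longrightarrow> B (const2 (pk ^ e) * (varx ^ (s - e) * vary ^ e))"
    and B_high: "e \<le> s \<Longrightarrow> B (const2 (pk ^ (s - e)) * (varx ^ (s - e) * vary ^ e))"
begin

abbreviation ms :: "nat \<Rightarrow> 'k poly poly" where "ms e \<equiv> varx ^ (s - e) * vary ^ e"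

lemma B_sum: "(\<And>i. i \<in> I \<Longrightarrow> B (f i)) \<Longrightarrow> B (sum f I)"
  by (induction I rule: infinite_finite_induct) (auto simp: B_0 intro: B_add)

lemma B_minus: "B F \<Longrightarrow> B (- F)"
  using B_const2[of F "- 1"] by (simp add: const2_minus)

lemma B_diff: "B F \<Longrightarrow> B G \<Longrightarrow> B (F - G)"
  using B_add[OF _ B_minus, of F G] by simp

definition cl :: "nat \<Rightarrow> nat set" where
  "cl e = {e'. e' \<le> s \<and> e' mod (p - 1) = e mod (p - 1)}"

lemma finite_cl [simp]: "finite (cl e)"
  unfolding cl_def by (rule finite_subset[of _ "{..s}"]) auto

text \<open>As \<open>C(s-j, e-j) C(s, j) = C(s, e) C(e, j)\<close>, combinations of the rows \<open>B_row\<close> realise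
  \<open>C(s, e)\<close> times any integral combination of the polynomials \<open>C(e, j)\<close> in \<open>e\<close>.\<close>

lemma B_interpolation:
  assumes S: "S \<subseteq> cl e" "card S \<le> s" and dvd: "\<And>j. j \<le> card S \<Longrightarrow> p ^ j dvd p ^ N * (s choose j)"
  shows "B (\<Sum>e'\<in>cl e. const2 (of_int (int (p ^ N * (s choose e')) * (\<Prod>e''\<in>S. int e' - int e''))) * ms e')"
proof -
  have fS: "finite S" using S(1) finite_cl finite_subset by blast
  obtain b :: "nat \<Rightarrow> int" where b: "\<And>X :: nat. (\<Prod>e\<in>S. int X - int e) = (\<Sum>j\<le>card S. b j * int (X choose j))"
    using prod_diff_binomial_basis[OF fS] by blast
  \<comment> \<open>The row with index j carries a factor p^j; \<open>u j\<close> is what it must be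
    multiplied by to give p^N C(s, j).\<close>
  from dvd obtain u where u: "\<And>j. j \<le> card S \<Longrightarrow> p ^ N * (s choose j) = p ^ j * u j"
    unfolding dvd_def by metis
  define R where "R j = const2 (pk ^ j) *
      (\<Sum>e' | j \<le> e' \<and> e' \<le> s \<and> e' mod (p - 1) = e mod (p - 1). const2 (of_nat ((s - j) choose (e' - j))) * ms e')" for j
  have R: "R j = (\<Sum>e'\<in>cl e. const2 (pk ^ j * (if j \<le> e' then of_nat ((s - j) choose (e' - j)) else 0)) * ms e')" for j
  proof -
    have "(\<Sum>e' | j \<le> e' \<and> e' \<le> s \<and> e' mod (p - 1) = e mod (p - 1). const2 (of_nat ((s - j) choose (e' - j))) * ms e') =
       (\<Sum>e'\<in>cl e. const2 (if j \<le> e' then of_nat ((s - j) choose (e' - j)) else 0) * ms e')"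
      by (intro sum.mono_neutral_cong_left) (auto simp: cl_def finite_cl[unfolded cl_def])
    thus ?thesis unfolding R_def by (simp add: sum_distrib_left const2_mult mult.assoc)
  qed
  have coeff: "(\<Sum>j\<le>card S. of_int (b j * int (u j)) * (pk ^ j * (if j \<le> e' then of_nat ((s - j) choose (e' - j)) else 0))) =
      (of_int (int (p ^ N * (s choose e')) * (\<Prod>e''\<in>S. int e' - int e'')) :: 'k)" if e': "e' \<le> s" for e'
  proof -
    have *: "int (u j) * (int (p ^ j) * (if j \<le> e' then int ((s - j) choose (e' - j)) else 0)) =
        int (p ^ N * (s choose e')) * int (e' choose j)" if j: "j \<le> card S" for j
    proof (cases "j \<le> e'")
      case True
      have "(s choose e') * (e' choose j) = (s choose j) * ((s - j) choose (e' - j))"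
        using choose_mult[OF True e'] by simp
      hence "u j * (p ^ j * ((s - j) choose (e' - j))) = p ^ N * (s choose e') * (e' choose j)"
        using u[OF j] by (metis mult.assoc mult.commute)
      hence "int (u j * (p ^ j * ((s - j) choose (e' - j)))) = int (p ^ N * (s choose e') * (e' choose j))"
        by (simp only:)
      thus ?thesis by (simp only: True of_nat_mult if_True)
    next
      case False
      thus ?thesis by (simp add: binomial_eq_0)
    qed
    have "(\<Sum>j\<le>card S. of_int (b j * int (u j)) * (pk ^ j * (if j \<le> e' then of_nat ((s - j) choose (e' - j)) else 0))) =
        (of_int (\<Sum>j\<le>card S. b j * (int (u j) * (int (p ^ j) * (if j \<le> e' then int ((s - j) choose (e' - j)) else 0)))) :: 'k)"
      by (simp add: mult.assoc if_distrib cong: if_cong)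
    also have "(\<Sum>j\<le>card S. b j * (int (u j) * (int (p ^ j) * (if j \<le> e' then int ((s - j) choose (e' - j)) else 0)))) =
      (\<Sum>j\<le>card S. int (p ^ N * (s choose e')) * (b j * int (e' choose j)))"
      by (intro sum.cong refl) (simp only: atMost_iff * mult.left_commute)
    finally show ?thesis by (simp only: b sum_distrib_left)
  qed
  have "B (\<Sum>j\<le>card S. const2 (of_int (b j * int (u j))) * R j)"
    unfolding R_def using S(2) by (intro B_sum B_const2 B_row nu_of_int_ge) auto
  also have "(\<Sum>j\<le>card S. const2 (of_int (b j * int (u j))) * R j) =
    (\<Sum>e'\<in>cl e. const2 (\<Sum>j\<le>card S. of_int (b j * int (u j)) * (pk ^ j * (if j \<le> e' then of_nat ((s - j) choose (e' - j)) else 0))) * ms e')"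
    unfolding R sum_distrib_left const2_sum sum_distrib_right
    by (subst sum.swap) (simp only: const2_mult mult.assoc)
  also have "\<dots> = (\<Sum>e'\<in>cl e. const2 (of_int (int (p ^ N * (s choose e')) * (\<Prod>e''\<in>S. int e' - int e''))) * ms e')"
    by (intro sum.cong refl) (simp only: coeff cl_def mem_Collect_eq)
  finally show ?thesis .
qed

text \<open>The interpolating product vanishes on S, the exponents outside S are subtracted by
  \<open>rest\<close>, and at e only p^N C(s, e) times a unit is left.\<close>

lemma B_isolate:
  assumes s: "s < p * (p - 1)"
    and S: "S \<subseteq> cl e - {e}" "card S \<le> s" "e \<le> s" and dvd: "\<And>j. j \<le> card S \<Longrightarrow> p ^ j dvd p ^ N * (s choose j)"
    and rest: "\<And>e'. e' \<in> cl e \<Longrightarrow> e' \<notin> S \<Longrightarrow> e' \<noteq> e \<Longrightarrow> B (const2 (of_nat (p ^ N * (s choose e'))) * ms e')"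
    and m: "\<nu> (of_nat (s choose e)) = ereal (real k)"
  shows "B (const2 (pk ^ (N + k)) * ms e)"
proof -
  have fS: "finite S" using S(1) finite_cl by (meson finite_Diff finite_subset)
  define D where "D e' = (\<Prod>e''\<in>S. int e' - int e'')" for e'
  have eE: "e \<in> cl e" using S(3) by (simp add: cl_def)
  have tot: "B (\<Sum>e'\<in>cl e. const2 (of_int (int (p ^ N * (s choose e')) * D e')) * ms e')"
    unfolding D_def using S dvd by (intro B_interpolation) auto
  have others: "B (const2 (of_int (int (p ^ N * (s choose e')) * D e')) * ms e')" if "e' \<in> cl e - {e}" for e'
  proof (cases "e' \<in> S")
    case True
    hence "D e' = 0" unfolding D_def using fS by (intro prod_zero) auto
    thus ?thesis by (simp add: B_0)
  next
    case False
    have "B (const2 (of_nat (p ^ N * (s choose e'))) * ms e')" using rest that False by blast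
    from B_const2[OF this nu_of_int_ge, of "D e'"] show ?thesis by (simp add: const2_mult mult_ac)
  qed
  have "B ((\<Sum>e'\<in>cl e. const2 (of_int (int (p ^ N * (s choose e')) * D e')) * ms e') -
      (\<Sum>e'\<in>cl e - {e}. const2 (of_int (int (p ^ N * (s choose e')) * D e')) * ms e'))"
    by (intro B_diff[OF tot] B_sum others)
  hence 1: "B (const2 (of_int (int (p ^ N * (s choose e)) * D e)) * ms e)"
    using eE by (simp add: sum.remove[of "cl e" e])
  \<comment> \<open>Exponents in one class differ by multiples of p - 1, so a factor divisible by p
    would be a nonzero multiple of p(p - 1), which exceeds s.\<close>
  have "\<not> int p dvd D e"
  proof
    assume "int p dvd D e"
    then obtain e'' where e'': "e'' \<in> S" "int p dvd int e - int e''"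
      unfolding D_def using prime_dvd_prod_iff[OF fS, of "int p"] prime_p by auto
    have "int e mod int (p - 1) = int e'' mod int (p - 1)"
      using e'' S(1) by (auto simp: cl_def simp flip: zmod_int)
    hence d: "int (p - 1) dvd int e - int e''" by (simp add: mod_eq_dvd_iff)
    have "coprime (int p) (int (p - 1))"
      using p_gt_1 by (metis coprime_int_iff coprime_diff_one_right_nat p_pos)
    hence "int p * int (p - 1) dvd int e - int e''" using e''(2) d by (simp add: divides_mult)
    moreover have "int e - int e'' \<noteq> 0" using e'' S by auto
    ultimately have "int p * int (p - 1) \<le> \<bar>int e - int e''\<bar>"
      by (metis abs_of_nat dvd_imp_le_int int_ops(7))
    moreover have "\<bar>int e - int e''\<bar> \<le> int s" using S e'' by (auto simp: cl_def)
    ultimately have "int (p * (p - 1)) \<le> int s" by simp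
    thus False using s by linarith
  qed
  hence D0: "\<nu> (of_int (D e)) = ereal 0" using nu_of_int_eq_0 by (simp add: zero_ereal_def)
  define a where "a = (of_int (int (p ^ N * (s choose e)) * D e) :: 'k)"
  have "\<nu> a = ereal (real N + real k)"
    by (simp add: a_def val_mult nu_p_power m D0)
  hence "a \<noteq> 0" and "0 \<le> \<nu> (pk ^ (N + k) / a)"
    using nu_divide[OF nu_p_power[of "N + k"]] by (auto simp: zero_ereal_def)
  have "B (const2 a * ms e)" using 1 by (simp only: a_def)
  hence "B (const2 (pk ^ (N + k) / a) * (const2 a * ms e))" by (rule B_const2) fact
  moreover have "const2 (pk ^ (N + k) / a) * const2 a = const2 (pk ^ (N + k))"
    using \<open>a \<noteq> 0\<close> by (simp flip: const2_mult)
  ultimately show ?thesis by (simp flip: mult.assoc)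
qed

lemma B_power_mono: "B (const2 (pk ^ i) * F) \<Longrightarrow> i \<le> j \<Longrightarrow> B (const2 (pk ^ j) * F)"
  using B_const2[of "const2 (pk ^ i) * F" "pk ^ (j - i)"]
  by (simp add: nu_p_power flip: mult.assoc const2_mult power_add)

lemma B_end: "e \<le> s \<Longrightarrow> e \<le> m \<or> s - e \<le> m \<Longrightarrow> B (const2 (pk ^ m) * ms e)"
  using B_low B_high B_power_mono by blast

text \<open>In the residue class of \<open>e\<close> modulo \<open>p - 1\<close>, at most \<open>m + 1\<close> exponents lie strictly between \<open>m\<close>
  and \<open>s - m\<close>, so that Lagrange interpolation of degree at most \<open>m\<close> isolates \<open>e\<close>. If \<open>p\<close> divides
  \<open>C(s, e)\<close>, only a factor \<open>p\<^bsup>m-1\<^esup>\<close> can be spent. This suffices: either \<open>p\<close> divides \<open>C(s, m)\<close>,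
  or the class has at most \<open>m\<close> members between \<open>m\<close> and \<open>s - m\<close>, as otherwise no carry
  occurs in the addition of \<open>e\<close> and \<open>s - e\<close> to base \<open>p\<close>.\<close>

theorem B_power_m:
  assumes s: "s < p * (p - 1)" and m: "m * (p + 1) \<le> s + 1" "s + 1 < (m + 1) * (p + 1)" and e: "e \<le> s"
  shows "B (const2 (pk ^ m) * ms e)"
proof -
  have s2: "s < p ^ 2" using s p_gt_1 unfolding power2_eq_square
    by (meson diff_le_self less_le_trans mult_le_mono2)
  have mp: "m < p"
  proof (rule ccontr)
    assume "\<not> m < p"
    hence "p * (p + 1) \<le> m * (p + 1)" by (intro mult_le_mono1) simp
    also have "\<dots> \<le> s + 1" by (rule m)
    also have "\<dots> \<le> p * (p - 1)" using s by simp
    also have "\<dots> < p * (p + 1)" using p_gt_1 by (intro mult_strict_left_mono) auto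
    finally show False by simp
  qed
  have ms: "m \<le> s"
  proof (cases "m = 0")
    case False
    hence "m + 1 \<le> m * (p + 1)" using p_gt_1 by (simp add: algebra_simps)
    thus ?thesis using m(1) by linarith
  qed simp
  show ?thesis
  proof (cases "e \<le> m \<or> s - e \<le> m")
    case True
    thus ?thesis using B_end e by blast
  next
    case False
    define E' where "E' = {e' \<in> cl e. m < e' \<and> m < s - e'}"
    \<comment> \<open>With only p^(m-1) to spend, \<open>B_end\<close> no longer covers the
      exponents m and s - m; \<open>E''\<close> adds these two end points to
      \<open>E'\<close>.\<close>
    define E'' where "E'' = {e' \<in> cl e. m \<le> e' \<and> m \<le> s - e'}"
    have eE: "e \<in> E'" "e \<in> E''" using False e by (auto simp: E'_def E''_def cl_def)
    have fin: "finite E'" "finite E''" by (auto simp: E'_def E''_def)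
    \<comment> \<open>The available interval has length s - 2(m + 1), which is less than (m + 1)(p +
      1) - 2(m + 1) = (m + 1)(p - 1).\<close>
    have cE': "card E' \<le> m + 1"
    proof -
      have "card E' \<le> (s - (m + 1) - (m + 1)) div (p - 1) + 1"
        using fin p_gt_1 by (intro card_progression) (auto simp: E'_def cl_def)
      moreover have "s - (m + 1) - (m + 1) < (m + 1) * (p - 1)"
      proof -
        define X Y where "X = (m + 1) * (p - 1)" and "Y = (m + 1) * (p + 1)"
        have "X + (m + 1) * 2 = Y"
          unfolding X_def Y_def using p_gt_1 by (simp flip: distrib_left)
        moreover have "s + 1 < Y" using m(2) by (simp only: Y_def)
        moreover have "2 * (m + 1) \<le> s" using False by arith
        ultimately have "s - (m + 1) - (m + 1) < X" by arith
        thus ?thesis by (simp only: X_def)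
      qed
      hence "(s - (m + 1) - (m + 1)) div (p - 1) < m + 1" using p_gt_1 by (simp add: less_mult_imp_div_less)
      ultimately show ?thesis by linarith
    qed
    have rest: "B (const2 (of_nat (p ^ m * (s choose e'))) * ms e')" if "e' \<in> cl e" "e' \<notin> E'" for e'
    proof -
      have "B (const2 (of_nat (s choose e')) * (const2 (pk ^ m) * ms e'))"
        using that by (intro B_const2 B_end nu_of_nat_ge) (auto simp: E'_def cl_def)
      thus ?thesis by (simp add: const2_mult mult_ac)
    qed
    have card1: "card (E' - {e}) \<le> m" using cE' eE fin by (simp add: card_Diff_singleton)
    \<comment> \<open>The carry out of the last base-p digit in e + (s - e), equal to the valuation
      of C(s, e); it is 0 or 1.\<close>
    define k where "k = s div p - e div p - (s - e) div p"
    have sdiv: "s div p = e div p + (s - e) div p + (e mod p + (s - e) mod p) div p"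
      using div_add1_eq[of e "s - e" p] e by simp
    hence "e div p + (s - e) div p \<le> s div p" by simp
    hence k: "\<nu> (of_nat (s choose e)) = ereal (real k)"
      using nu_binomial[OF s2 e] by (simp add: k_def)
    have "s div p \<le> e div p + (s - e) div p + 1"
    proof -
      have "(e mod p + (s - e) mod p) div p < 2"
        using mod_less_divisor[OF p_pos, of e] mod_less_divisor[OF p_pos, of "s - e"]
        by (intro less_mult_imp_div_less) linarith
      thus ?thesis using sdiv by linarith
    qed
    hence k1: "k \<le> 1" by (simp add: k_def)
    show ?thesis
    proof (cases "k = 0")
      case True
      have "B (const2 (pk ^ (m + k)) * ms e)"
      proof (rule B_isolate[OF s, of "E' - {e}"])
        show "p ^ j dvd p ^ m * (s choose j)" if "j \<le> card (E' - {e})" for j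
          using that card1 by (intro dvd_mult2 le_imp_power_dvd) linarith
        show "B (const2 (of_nat (p ^ m * (s choose e'))) * ms e')"
          if "e' \<in> cl e" "e' \<notin> E' - {e}" "e' \<noteq> e" for e'
          using that by (intro rest) auto
      qed (use k card1 ms e in \<open>auto simp: E'_def\<close>)
      thus ?thesis using True by simp
    next
      case False
      hence k: "\<nu> (of_nat (s choose e)) = ereal (real 1)" using k k1 by (simp add: le_Suc_eq)
      have m0: "0 < m" if "card E'' \<le> m" using that eE fin by (metis card_gt_0_iff empty_iff less_le_trans)
      have rest': "B (const2 (of_nat (p ^ (m - 1) * (s choose e'))) * ms e')" if "e' \<in> cl e" "e' \<notin> E''" for e'
      proof -
        have "B (const2 (of_nat (s choose e')) * (const2 (pk ^ (m - 1)) * ms e'))"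
          using that by (intro B_const2 B_end nu_of_nat_ge) (auto simp: E''_def cl_def)
        thus ?thesis by (simp add: const2_mult mult_ac)
      qed
      show ?thesis
      proof (cases "p dvd (s choose m)")
        case True
        hence m1: "1 \<le> m" using p_gt_1 by (cases m) auto
        \<comment> \<open>The factor p in C(s, m) = C(s, s - m) makes up for the missing power of p,
          both in the row j = m and at the end points m and s - m.\<close>
        have pm: "p ^ m dvd p ^ (m - 1) * (s choose m)"
          using True m1 mult_dvd_mono[OF dvd_refl True, of "p ^ (m - 1)"] by (simp flip: power_Suc2)
        have "B (const2 (pk ^ (m - 1 + 1)) * ms e)"
        proof (rule B_isolate[OF s, of "E' - {e}"])
          show "p ^ j dvd p ^ (m - 1) * (s choose j)" if "j \<le> card (E' - {e})" for j
          proof (cases "j = m")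
            case False
            hence "j \<le> m - 1" using that card1 by linarith
            thus ?thesis by (intro dvd_mult2 le_imp_power_dvd)
          qed (use pm in simp)
          show "B (const2 (of_nat (p ^ (m - 1) * (s choose e'))) * ms e')"
            if e': "e' \<in> cl e" "e' \<notin> E' - {e}" "e' \<noteq> e" for e'
          proof (cases "e' \<in> E''")
            case True
            hence "e' = m \<or> s - e' = m" "e' \<le> s" using e' by (auto simp: E'_def E''_def cl_def)
            hence "s choose e' = s choose m" using binomial_symmetric[of e' s] by auto
            then obtain w where w: "p ^ (m - 1) * (s choose e') = w * p ^ m" using pm by (metis dvd_def mult.commute)
            have "B (const2 (of_nat w) * (const2 (pk ^ m) * ms e'))"
              using \<open>e' = m \<or> s - e' = m\<close> \<open>e' \<le> s\<close> by (intro B_const2 B_end nu_of_nat_ge) auto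
            thus ?thesis unfolding w by (simp add: const2_mult mult_ac)
          qed (use rest' e' in auto)
        qed (use card1 ms e k in \<open>auto simp: E'_def\<close>)
        thus ?thesis using m1 by simp
      next
        case nd: False
        \<comment> \<open>Suppose there are m + 1 members, the least being a. Since p does not
          divide C(s, m), the digits of s are m and S0 with m \<le> S0, and the spacing gives m
          \<le> a \<le> S0. With e = a + l(p - 1) and l \<le> m, the digits of e are l, a - l and
          those of s - e are m - l, S0 - a + l. No carry occurs, against k = 1.\<close>
        have "card E'' \<le> m"
        proof (rule ccontr)
          assume c: "\<not> card E'' \<le> m"
          define a b where "a = Min E''" and "b = Max E''"
          have ab: "a \<in> E''" "b \<in> E''" and bnd: "\<And>x. x \<in> E'' \<Longrightarrow> a \<le> x \<and> x \<le> b"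
            using fin eE by (auto simp: a_def b_def intro: Min_in Max_in)
          have "card E'' \<le> (b - a) div (p - 1) + 1"
            using fin bnd p_gt_1 by (intro card_progression) (auto simp: E''_def cl_def)
          hence "m \<le> (b - a) div (p - 1)" using c by linarith
          hence mab: "m * (p - 1) \<le> b - a" using p_gt_1 by (simp add: less_eq_div_iff_mult_less_eq)
          define S0 S1 where "S0 = s mod p" and "S1 = s div p"
          have sS: "s = S1 * p + S0" "S0 < p" by (auto simp: S0_def S1_def)
          have mS0: "m \<le> S0"
          proof (rule ccontr)
            assume "\<not> m \<le> S0"
            have "\<nu> (of_nat (s choose m)) = ereal (real S1 - real ((s - m) div p))"
              using nu_binomial[OF s2 ms] mp by (simp add: S1_def)
            moreover have "(s - m) div p < S1"
              using \<open>\<not> m \<le> S0\<close> sS ms by (intro less_mult_imp_div_less) linarith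
            ultimately have "\<nu> (of_nat (s choose m)) \<noteq> 0" by (simp add: zero_ereal_def)
            thus False using nu_of_nat_eq_0[OF nd] by simp
          qed
          have S1m: "S1 = m"
          proof (rule antisym)
            show "S1 \<le> m"
            proof (rule ccontr)
              assume "\<not> S1 \<le> m"
              hence "(m + 1) * p \<le> S1 * p" by (intro mult_right_mono) auto
              thus False using m(2) sS mS0 by (simp add: algebra_simps)
            qed
            show "m \<le> S1"
            proof (rule ccontr)
              assume "\<not> m \<le> S1"
              hence "(S1 + 1) * p \<le> m * p" by (intro mult_right_mono) auto
              hence "S1 * p + p \<le> m * p" by (simp add: algebra_simps)
              thus False using m(1) sS mS0 \<open>\<not> m \<le> S1\<close> by (simp add: algebra_simps)
            qed
          qed
          have am: "m \<le> a" using ab by (simp add: E''_def)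
          have pm: "m * p = m * (p - 1) + m" using p_gt_1 by (simp add: diff_mult_distrib2)
          have sS': "s = m * (p - 1) + m + S0" using sS(1) pm S1m by simp
          have aS: "a \<le> S0"
          proof -
            have "b \<le> s" "m \<le> s - b" "a \<le> b" using ab bnd[OF ab(2)] by (auto simp: E''_def cl_def)
            thus ?thesis using mab sS' by linarith
          qed
          have ea: "a \<le> e" "e mod (p - 1) = a mod (p - 1)" using bnd[OF eE(2)] ab by (auto simp: E''_def cl_def)
          hence "(p - 1) dvd e - a" by (simp add: mod_eq_dvd_iff_nat)
          then obtain l where "e - a = (p - 1) * l" by auto
          hence l: "e = a + l * (p - 1)" using ea(1) by (simp add: mult.commute)
          have lm: "l \<le> m"
          proof (rule ccontr)
            assume "\<not> l \<le> m"
            hence "(m + 1) * (p - 1) \<le> l * (p - 1)" by (intro mult_right_mono) auto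
            hence "m * (p - 1) + (p - 1) \<le> l * (p - 1)" by (simp only: add_mult_distrib mult_1)
            moreover have "m < s - e" using eE by (simp add: E'_def)
            ultimately show False using l am sS(2) sS' by linarith
          qed
          have lp: "l * p = l * (p - 1) + l" using p_gt_1 by (simp add: diff_mult_distrib2)
          have "e = l * p + (a - l)" using l lp lm am by linarith
          hence d1: "e div p = l" using aS sS by (simp add: div_mult_self3)
          have "(m - l) * p + l * p = m * p" using lm by (simp flip: distrib_right)
          hence "s - e = (m - l) * p + (S0 - (a - l))"
            using l lp lm am aS sS' pm by linarith
          hence d2: "(s - e) div p = m - l" using sS by simp
          have "k = 0" using d1 d2 S1m lm by (simp add: k_def S1_def)
          thus False using \<open>k \<noteq> 0\<close> by simp
        qed
        note cE'' = this
        have c2: "card (E'' - {e}) \<le> m - 1" using cE'' eE fin by (simp add: card_Diff_singleton)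
        have "B (const2 (pk ^ (m - 1 + 1)) * ms e)"
        proof (rule B_isolate[OF s, of "E'' - {e}"])
          show "p ^ j dvd p ^ (m - 1) * (s choose j)" if "j \<le> card (E'' - {e})" for j
            using that c2 by (intro dvd_mult2 le_imp_power_dvd) linarith
        qed (use c2 ms e k rest' in \<open>auto simp: E''_def\<close>)
        thus ?thesis using m0[OF cE''] by simp
      qed
    qed
  qed
qed

end

section \<open>Congruences between the weights \<open>r\<close> and \<open>s\<close>\<close>

text \<open>The base 7 is the lower bound for p; the estimate makes n large enough for the auxiliary
  forms.\<close>

lemma square_le_power: "0 < t \<Longrightarrow> (t + 1) ^ 2 \<le> (7 :: nat) ^ t"
proof (induction t rule: nat_induct_non_zero)
  case (Suc t)
  have "(Suc t + 1) ^ 2 \<le> 7 * (t + 1) ^ 2" by (simp add: power2_eq_square algebra_simps)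
  also have "\<dots> \<le> 7 * 7 ^ t" using Suc by simp
  finally show ?case by simp
qed (simp add: power2_eq_square)

lemma (in padic_alg_closure) Zp_power: "z \<in> Zp \<nu> \<Longrightarrow> z ^ n \<in> Zp \<nu>"
  by (induction n) (auto intro: Zp_mult Zp_1)

text \<open>The common setting of (I) and (II): the cases of \<open>eps\<close> enter only through
  m, which \<open>m_le\<close> and \<open>m_ge\<close> fix as the quotient of s + 1 by p +
  1.\<close>

locale nearby_weight = hecke_quotient p \<nu> red r ap
  for p :: nat and \<nu> :: "'k::{alg_closed_field, field_char_0} \<Rightarrow> ereal" and red :: "'k \<Rightarrow> 'f::field"
    and r :: nat and ap :: 'k +
  fixes s t d m :: nat and v :: real
  assumes r_eq: "r = s + p ^ t * (p - 1) * d"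
    and d_pos: "0 < d" and p_ge: "7 \<le> p"
    and nu_ap: "\<nu> ap = ereal v" and s2v: "2 * v < real s" and t2v: "2 * v \<le> real t" and mv: "real m < v"
    and s_less: "s < p * (p - 1)" and m_le: "m * (p + 1) \<le> s + 1" and m_ge: "s + 1 < (m + 1) * (p + 1)"
begin

definition nn :: nat where "nn = p ^ t * (p - 1) * d"
text \<open>A multiple of p - 1 that is at least t: \<open>aa\<close>-th powers of p-adic units are
  1 modulo p, those of non-units are 0 modulo p^t. The degree \<open>qq\<close> belongs to (X^aa -
  Y^aa)^(t+1), where t + 1 factors divisible by p give p^t with one to spare for
  \<open>bump\<close>.\<close>

definition aa :: nat where "aa = (p - 1) * t"
definition qq :: nat where "qq = aa * (t + 1)"

lemma r_nn: "r = s + nn"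
  by (simp add: r_eq nn_def)

lemma v_pos: "0 < v"
  using mv by linarith

lemma t_pos: "0 < t"
  using v_pos t2v by (cases t) auto

lemma aa_ge: "t \<le> aa"
proof -
  have "1 * t \<le> (p - 1) * t" using p_ge by (intro mult_le_mono1) simp
  thus ?thesis by (simp add: aa_def)
qed

text \<open>Leaves an exponent of at least t + 1 for X in \<open>E1\<close>, enough to be 0 modulo
  p^t at non-units and to absorb powers of theta.\<close>

lemma qq_le: "qq + t + 1 \<le> nn"
proof -
  have "(t + 1) ^ 2 \<le> 7 ^ t" using square_le_power t_pos .
  also have "\<dots> \<le> p ^ t" using p_ge by (rule power_mono) simp
  finally have 1: "(t + 1) ^ 2 \<le> p ^ t" .
  have "qq + t + 1 \<le> (p - 1) * (t * (t + 1)) + (p - 1) * (t + 1)"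
  proof -
    have "t + 1 \<le> (p - 1) * (t + 1)" using p_ge mult_le_mono1[of 1 "p - 1" "t + 1"] by simp
    moreover have "qq = (p - 1) * (t * (t + 1))" by (simp only: qq_def aa_def mult.assoc)
    ultimately show ?thesis by linarith
  qed
  also have "\<dots> = (p - 1) * (t + 1) ^ 2"
    unfolding distrib_left[symmetric] by (simp add: power2_eq_square)
  also have "\<dots> \<le> (p - 1) * p ^ t * d" using 1 d_pos
    by (metis Suc_leI One_nat_def mult_le_mono mult_le_mono2 nat_mult_1_right)
  finally show ?thesis by (simp add: nn_def mult_ac)
qed

text \<open>On primitive vectors, \<open>E1 x y\<close> is modulo \<open>p\<^sup>t\<close> the indicator of the residue disc of the point
  \<open>y = 0\<close> of the projective line. The form \<open>hh\<close> is \<open>1\<close> modulo \<open>p\<^sup>t\<close> on all of them, hence invariant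
  under \<open>K\<close> modulo \<open>p\<^sup>t\<close>.\<close>

definition E1 :: "'a::comm_ring_1 \<Rightarrow> 'a \<Rightarrow> 'a" where
  "E1 X Y = X ^ (nn - qq) * (X ^ aa - Y ^ aa) ^ (t + 1)"

abbreviation h1 :: "'a::comm_ring_1 poly poly" where "h1 \<equiv> E1 varx vary"
abbreviation h2 :: "'a::comm_ring_1 poly poly" where "h2 \<equiv> E1 vary varx"
abbreviation hh :: "'a::comm_ring_1 poly poly" where "hh \<equiv> varx ^ nn + h2"

lemma mat_act_E1: "mat_act \<rho> g (E1 X Y) = E1 (mat_act \<rho> g X) (mat_act \<rho> g Y)"
  by (simp add: E1_def mat_act_simps)

lemma Sym_E1: "X \<in> Sym 1 UNIV \<Longrightarrow> Y \<in> Sym 1 UNIV \<Longrightarrow> E1 X Y \<in> Sym nn UNIV"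
proof -
  assume "X \<in> Sym 1 UNIV" "Y \<in> Sym 1 UNIV"
  hence "X ^ (nn - qq) * (X ^ aa - Y ^ aa) ^ (t + 1) \<in> Sym ((nn - qq) * 1 + (t + 1) * (aa * 1)) UNIV"
    by (intro Sym_mult Sym_power Sym_diff)
  moreover have "(nn - qq) * 1 + (t + 1) * (aa * 1) = nn" using qq_le by (simp add: qq_def mult.commute)
  ultimately show ?thesis by (simp only: E1_def)
qed

lemma Sym_hh: "hh \<in> Sym nn UNIV"
  using Sym_add[OF Sym_power[OF Sym_varx, of nn, simplified] Sym_E1[OF Sym_vary Sym_varx]] .

lemma Sym_nn_mult: "F \<in> Sym nn UNIV \<Longrightarrow> G \<in> Sym s UNIV \<Longrightarrow> F * G \<in> Sym r UNIV"
  using Sym_mult[of F nn G s] by (simp add: r_nn add.commute)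

lemma vge_E1: "vge 0 X \<Longrightarrow> vge 0 Y \<Longrightarrow> vge 0 (E1 X Y)"
  unfolding E1_def by (intro vge_intros)

lemma vge_hh: "vge 0 hh"
  by (intro vge_intros vge_E1)

lemma vge_ms: "vge 0 (varx ^ i * vary ^ j)"
  by (rule vge_monom)

section \<open>Values of the auxiliary forms on residue discs\<close>

text \<open>L stands for the image of a variable under a Hecke matrix, which modulo p is \<alpha>
  times a single variable Z. Fermat removes \<alpha> from the (p - 1)-st power modulo p, and the
  factor p^t of \<open>nn\<close> sharpens this to modulo p^t.\<close>

lemma unit_power:
  assumes "\<alpha> \<in> Zp \<nu>" "red \<alpha> \<noteq> 0" "vge 0 Z" "vge 1 (L - const2 \<alpha> * Z)"
  shows "vge 1 (L ^ aa - Z ^ aa)" "vge (real t) (L ^ nn - Z ^ nn)" "vge 0 L"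
proof -
  have c0: "vge 0 (const2 \<alpha>)" using assms(1) by (simp add: vge_const2 Zp_iff zero_ereal_def[symmetric])
  have "vge 0 (L - const2 \<alpha> * Z)" using vge_mono[OF assms(4)] by simp
  from vge_add[OF this vge_mult0[OF c0 assms(3)]] show L: "vge 0 L" by simp
  have "vge 1 (L ^ (p - 1) - (const2 \<alpha> * Z) ^ (p - 1))"
    using assms L c0 by (intro vge_power_diff vge_mult0)
  moreover have "vge 1 ((const2 \<alpha> * Z) ^ (p - 1) - Z ^ (p - 1))"
  proof -
    have "red \<alpha> ^ (p - 1) * red \<alpha> = 1 * red \<alpha>"
      using prime_field_power_p[OF red_Zp[OF assms(1)]] p_gt_1 by (simp flip: power_Suc2)
    hence "red (\<alpha> ^ (p - 1)) = red 1" using assms by (simp add: red_power Zp_Zpbar red_one)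
    hence "0 < \<nu> (\<alpha> ^ (p - 1) - 1)"
      using assms(1) Zpbar_1 by (subst (asm) red_eq_iff) (auto simp: Zpbar_power Zp_Zpbar)
    moreover have "\<alpha> ^ (p - 1) - 1 \<in> Qp \<nu>"
      using assms(1) by (intro Qp_diff Qp_1 Zp_Qp[OF Zp_power])
    ultimately have "ereal 1 \<le> \<nu> (\<alpha> ^ (p - 1) - 1)"
      using nu_Qp[of "\<alpha> ^ (p - 1) - 1"] by (cases "\<alpha> ^ (p - 1) - 1 = 0") auto
    hence "vge 1 (const2 (\<alpha> ^ (p - 1) - 1) * Z ^ (p - 1))"
      using assms(3) by (intro vge_mult0 vge_power0) (simp add: vge_const2)
    thus ?thesis by (simp add: power_mult_distrib const2_diff const2_power algebra_simps)
  qed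
  ultimately have 1: "vge 1 (L ^ (p - 1) - Z ^ (p - 1))" using vge_add by fastforce
  hence "vge 1 ((L ^ (p - 1)) ^ t - (Z ^ (p - 1)) ^ t)"
    by (rule vge_power_diff[OF vge_power0[OF L] vge_power0[OF assms(3)]])
  thus "vge 1 (L ^ aa - Z ^ aa)" by (simp add: aa_def power_mult)
  have "vge (real t + 1) ((L ^ (p - 1)) ^ (p ^ t) - (Z ^ (p - 1)) ^ (p ^ t))"
    using 1 L assms(3) by (intro vge_power_p_power_diff vge_power0)
  hence "vge (real t) ((L ^ (p - 1)) ^ (p ^ t) - (Z ^ (p - 1)) ^ (p ^ t))" by (rule vge_mono) simp
  hence "vge (real t) (((L ^ (p - 1)) ^ (p ^ t)) ^ d - ((Z ^ (p - 1)) ^ (p ^ t)) ^ d)"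
    by (rule vge_power_diff[OF vge_power0[OF vge_power0[OF L]] vge_power0[OF vge_power0[OF assms(3)]]])
  moreover have "(p - 1) * p ^ t * d = nn" by (simp add: nn_def mult_ac)
  ultimately show "vge (real t) (L ^ nn - Z ^ nn)" by (simp flip: power_mult)
qed

lemma nonunit_power:
  assumes "\<alpha> \<in> Zp \<nu>" "red \<alpha> = 0" "vge 0 Z" "vge 1 (L - const2 \<alpha> * Z)"
  shows "real e \<le> real n \<Longrightarrow> vge (real e) (L ^ n)" "vge 0 L"
proof -
  have "inverse pk * \<alpha> \<in> Zp \<nu>" using Zp_div_p assms by blast
  hence "ereal (1 + 0) \<le> \<nu> (pk * (inverse pk * \<alpha>))"
    by (intro nu_mult_ge) (auto simp: val_p one_ereal_def Zp_iff zero_ereal_def)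
  hence "vge 1 (const2 \<alpha> * Z)" using assms(3) by (intro vge_mult0) (simp_all add: vge_const2 field_simps)
  from vge_add[OF assms(4) this] have L: "vge 1 L" by simp
  thus "vge 0 L" using vge_mono by fastforce
  show "vge (real e) (L ^ n)" if "real e \<le> real n"
    using vge_mono[OF vge_power[OF L, of n]] that by simp
qed

lemma E1_unit_unit:
  assumes "vge 0 Z" "\<alpha> \<in> Zp \<nu>" "red \<alpha> \<noteq> 0" "vge 1 (L1 - const2 \<alpha> * Z)"
    "\<gamma> \<in> Zp \<nu>" "red \<gamma> \<noteq> 0" "vge 1 (L2 - const2 \<gamma> * Z)"
  shows "vge (real t) (E1 L1 L2)"
proof -
  note u = unit_power[OF assms(2,3,1,4)] unit_power[OF assms(5,6,1,7)]
  from vge_diff[OF u(1,4)] have "vge 1 (L1 ^ aa - L2 ^ aa)" by simp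
  hence "vge (real (t + 1) * 1) ((L1 ^ aa - L2 ^ aa) ^ (t + 1))" by (rule vge_power)
  hence "vge (real t) ((L1 ^ aa - L2 ^ aa) ^ (t + 1))" by (rule vge_mono) simp
  thus ?thesis unfolding E1_def using u by (intro vge_0mult vge_power0)
qed

lemma E1_unit_nonunit:
  assumes "vge 0 Z" "\<alpha> \<in> Zp \<nu>" "red \<alpha> \<noteq> 0" "vge 1 (L1 - const2 \<alpha> * Z)"
    "\<gamma> \<in> Zp \<nu>" "red \<gamma> = 0" "vge 1 (L2 - const2 \<gamma> * Z)"
  shows "vge (real t) (E1 L1 L2 - Z ^ nn)"
proof -
  note u = unit_power[OF assms(2,3,1,4)] nonunit_power[OF assms(5,6,1,7)]
  have "vge (real t) ((L1 ^ aa - L2 ^ aa) - L1 ^ aa)"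
    using vge_minus[OF u(4)[of t aa]] aa_ge by simp
  hence "vge (real t) ((L1 ^ aa - L2 ^ aa) ^ (t + 1) - (L1 ^ aa) ^ (t + 1))"
    by (rule vge_power_diff[OF vge_diff[OF vge_power0[OF u(3)] vge_power0[OF u(5)]] vge_power0[OF u(3)]])
  hence "vge (real t) (L1 ^ (nn - qq) * ((L1 ^ aa - L2 ^ aa) ^ (t + 1) - (L1 ^ aa) ^ (t + 1)))"
    using u by (intro vge_0mult vge_power0)
  moreover have "L1 ^ (nn - qq) * (L1 ^ aa) ^ (t + 1) = L1 ^ nn"
    unfolding power_mult[symmetric] power_add[symmetric] using qq_le by (simp only: qq_def[symmetric]) simp
  ultimately have "vge (real t) (E1 L1 L2 - L1 ^ nn)"
    by (simp only: E1_def right_diff_distrib)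
  from vge_add[OF this u(2)] show ?thesis by simp
qed

lemma E1_nonunit:
  assumes "vge 0 Z" "\<alpha> \<in> Zp \<nu>" "red \<alpha> = 0" "vge 1 (L1 - const2 \<alpha> * Z)" "vge 0 L2"
  shows "vge (real t) (E1 L1 L2)"
proof -
  note u = nonunit_power[OF assms(2,3,1,4)]
  have "vge (real t) (L1 ^ (nn - qq))" using qq_le by (intro u) linarith
  thus ?thesis unfolding E1_def using u assms(5) by (intro vge_mult0 vge_power0 vge_diff)
qed

text \<open>The term X^nn is 1 on all discs where X is a unit, and \<open>E1\<close> with exchanged
  arguments is 1 on the one disc where it is not.\<close>

lemma hh_value:
  assumes "vge 0 Z" "\<alpha> \<in> Zp \<nu>" "vge 1 (L1 - const2 \<alpha> * Z)"
    "\<gamma> \<in> Zp \<nu>" "vge 1 (L2 - const2 \<gamma> * Z)" "red \<alpha> \<noteq> 0 \<or> red \<gamma> \<noteq> 0"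
  shows "vge (real t) (L1 ^ nn + E1 L2 L1 - Z ^ nn)"
proof -
  consider "red \<alpha> \<noteq> 0" "red \<gamma> \<noteq> 0" | "red \<alpha> \<noteq> 0" "red \<gamma> = 0" | "red \<alpha> = 0" "red \<gamma> \<noteq> 0"
    using assms(6) by blast
  thus ?thesis
  proof cases
    case 1
    from vge_add[OF unit_power(2)[OF assms(2) 1(1) assms(1,3)]
        E1_unit_unit[OF assms(1,4) 1(2) assms(5,2) 1(1) assms(3)]]
    show ?thesis by (simp add: algebra_simps)
  next
    case 2
    from vge_add[OF unit_power(2)[OF assms(2) 2(1) assms(1,3)]
        E1_nonunit[OF assms(1,4) 2(2) assms(5) unit_power(3)[OF assms(2) 2(1) assms(1,3)]]]
    show ?thesis by (simp add: algebra_simps)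
  next
    case 3
    have "real t \<le> real nn" using qq_le by simp
    from vge_add[OF nonunit_power(1)[OF assms(2) 3(1) assms(1,3) this]
        E1_unit_nonunit[OF assms(1,4) 3(2) assms(5,2) 3(1) assms(3)]]
    show ?thesis by (simp add: algebra_simps)
  qed
qed

text \<open>The variable that survives modulo p under \<open>hact i\<close>, that is, the coordinate
  along the point i of the projective line.\<close>

definition zvar :: "'f option \<Rightarrow> 'k poly poly" where
  "zvar i = (case i of Some l \<Rightarrow> varx | None \<Rightarrow> vary)"

lemma vge_pk: "vge 1 (const2 pk)"
  by (simp add: vge_const2 val_p one_ereal_def)

text \<open>Modulo p both variables become multiples of \<open>zvar i\<close>. The two coefficients
  come from a row of k, or from a combination of its rows, and are not both 0 because det k is a
  unit. The limit form does not depend on k, which is the K-invariance of \<open>hh\<close>.\<close>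

lemma hact_act_hh:
  assumes "k \<in> K0" "i \<in> hidx"
  shows "vge (real t) (hact i (act k hh) - zvar i ^ nn)"
proof -
  have k: "k $ a $ b \<in> Zp \<nu>" for a b using assms(1) by (auto simp: GL2_def)
  have vk: "vge 0 (const2 (k $ a $ b))" for a b using k by (simp add: vge_const2 Zp_iff zero_ereal_def[symmetric])
  have "red (det k) \<noteq> 0" using nu_det_K0[OF assms(1)] k
    by (subst red_eq_0) (auto simp: Zpbar_iff)
  hence det: "red (k $ 1 $ 1) * red (k $ 2 $ 2) \<noteq> red (k $ 1 $ 2) * red (k $ 2 $ 1)"
    using k by (simp add: det_2 red_Zp_hom Zp_mult)
  have eq: "hact i (act k hh) = hact i (act k varx) ^ nn + E1 (hact i (act k vary)) (hact i (act k varx))"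
    by (simp add: mat_act_add mat_act_power mat_act_E1)
  show ?thesis
  proof (cases i)
    case None
    have "vge 1 (hact i (act k varx) - const2 (k $ 2 $ 1) * vary)" "vge 1 (hact i (act k vary) - const2 (k $ 2 $ 2) * vary)"
      using vge_mult0[OF vge_pk vge_mult0[OF vk vge_varx]]
      by (simp_all add: None mat_act_simps(1,2) mat_act_varx[of _ k] mat_act_vary[of _ k] hact_None mult_ac)
    moreover have "red (k $ 2 $ 1) \<noteq> 0 \<or> red (k $ 2 $ 2) \<noteq> 0" using det by auto
    ultimately show ?thesis unfolding eq using k None vge_vary by (simp only: zvar_def option.case) (rule hh_value)
  next
    case (Some l)
    hence l: "l \<in> prime_field" using assms(2) by (auto simp: hidx_def)
    define \<alpha> where "\<alpha> = k $ 1 $ 1 - teich l * k $ 2 $ 1"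
    define \<gamma> where "\<gamma> = k $ 1 $ 2 - teich l * k $ 2 $ 2"
    have Z: "\<alpha> \<in> Zp \<nu>" "\<gamma> \<in> Zp \<nu>" unfolding \<alpha>_def \<gamma>_def using l k by (auto intro!: Zp_diff Zp_mult teich_Zp)
    have e: "hact i (act k varx) = const2 \<alpha> * varx + const2 pk * (const2 (k $ 2 $ 1) * vary)"
      "hact i (act k vary) = const2 \<gamma> * varx + const2 pk * (const2 (k $ 2 $ 2) * vary)"
      by (simp_all add: Some mat_act_simps(1,2) mat_act_varx[of _ k] mat_act_vary[of _ k] hact_Some
          \<alpha>_def \<gamma>_def const2_diff const2_mult algebra_simps)
    have "vge 1 (hact i (act k varx) - const2 \<alpha> * varx)" "vge 1 (hact i (act k vary) - const2 \<gamma> * varx)"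
      unfolding e using vge_mult0[OF vge_pk vge_mult0[OF vk vge_vary]] by simp_all
    moreover have "red \<alpha> \<noteq> 0 \<or> red \<gamma> \<noteq> 0"
    proof (rule ccontr)
      assume "\<not> ?thesis"
      hence "red (k $ 1 $ 1) = l * red (k $ 2 $ 1)" "red (k $ 1 $ 2) = l * red (k $ 2 $ 2)"
        using l k by (simp_all add: \<alpha>_def \<gamma>_def red_Zp_hom Zp_mult teich_Zp red_teich)
      thus False using det by simp
    qed
    ultimately show ?thesis unfolding eq using Z Some vge_varx by (simp only: zvar_def option.case) (rule hh_value)
  qed
qed

lemma hact_nu: "i \<in> hidx \<Longrightarrow> 0 \<le> \<nu> (adj2 (hrep i) $ a $ b)"
  using hrep_Zp[of i, unfolded Zp_iff] exhaust_2[of a] exhaust_2[of b] by (auto simp: adj2_def)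

lemma vge_hact: "i \<in> hidx \<Longrightarrow> F \<in> Sym n UNIV \<Longrightarrow> vge e F \<Longrightarrow> vge e (hact i F)"
  using hact_nu by (intro vge_act) auto

lemma A_hact_vge:
  assumes "F \<in> Sym r UNIV" "\<And>i. i \<in> hidx \<Longrightarrow> vge e (hact i F)"
  shows "A (e - v) F"
proof -
  have "A e (const2 ap * F)" using assms by (intro A_hecke A_vge Sym_mat_act)
  thus ?thesis using nu_ap A_divide by blast
qed

text \<open>The invariance of \<open>hh\<close> is known only for the images under the
  \<open>hact i\<close>, so it is fed through the Hecke relation, which costs v.\<close>

lemma A_act_hh:
  assumes "k \<in> K0" "G \<in> Sym s UNIV" "vge 0 G"
  shows "A (real t - v) (act k (hh * G) - hh * act k G)"
proof -
  have eq: "act k (hh * G) - hh * act k G = (act k hh - hh) * act k G"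
    by (simp only: mat_act_mult left_diff_distrib)
  have "vge (real t) (hact i ((act k hh - hh) * act k G))" if i: "i \<in> hidx" for i
  proof -
    have "vge (real t) ((hact i (act k hh) - zvar i ^ nn) - (hact i (act (mat 1) hh) - zvar i ^ nn))"
      using assms i by (intro vge_diff hact_act_hh K0_1)
    hence "vge (real t) (hact i (act k hh - hh))" by (simp add: mat_act_mat_1 mat_act_diff)
    moreover have "vge 0 (hact i (act k G))"
      using assms i K0_nu by (intro vge_hact[of _ _ s] Sym_mat_act vge_act[of _ s]) auto
    ultimately show ?thesis by (simp only: mat_act_mult vge_mult0)
  qed
  thus ?thesis unfolding eq
    using assms by (intro A_hact_vge Sym_nn_mult Sym_diff Sym_hh Sym_mat_act)
qed

abbreviation ms :: "nat \<Rightarrow> 'k poly poly" where "ms j \<equiv> varx ^ (s - j) * vary ^ j"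

lemma Sym_ms: "j \<le> s \<Longrightarrow> ms j \<in> Sym s UNIV"
  by (rule Sym_monom) simp

lemma zero_hidx: "Some 0 \<in> hidx"
  by (simp add: hidx_def)

lemma hact_zero: "hact (Some 0) varx = varx" "hact (Some 0) vary = const2 pk * vary"
  by (simp_all add: hact_Some)

text \<open>Modulo p, \<open>hact (Some l)\<close> sends (x, y) to (x, -[l] x) and
  \<open>hact None\<close> sends it to (0, y). Only l = 0 meets the disc y = 0 that
  \<open>h1\<close> detects, and there y becomes p y, which produces p^j.\<close>

lemma hact_h1:
  assumes "j \<le> s"
  shows "i \<in> hidx \<Longrightarrow> i \<noteq> Some 0 \<Longrightarrow> vge (real t) (hact i (h1 * ms j))"
    and "vge (real t) (hact (Some 0) (h1 * ms j) - const2 (pk ^ j) * (varx ^ nn * ms j))"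
proof -
  have mi: "vge 0 (hact i (ms j))" if "i \<in> hidx" for i
    using that assms by (intro vge_hact[of _ _ s] Sym_ms vge_ms)
  show "vge (real t) (hact i (h1 * ms j))" if i: "i \<in> hidx" "i \<noteq> Some 0"
  proof -
    have "vge (real t) (E1 (hact i varx) (hact i vary))"
    proof (cases i)
      case None
      have "vge 1 (hact i varx - const2 0 * vary)"
        using vge_mult0[OF vge_pk vge_varx] by (simp add: None hact_None)
      thus ?thesis by (rule E1_nonunit[OF vge_vary Zp_0 red_0]) (simp add: None hact_None vge_vary)
    next
      case (Some l)
      hence l: "l \<in> prime_field" "l \<noteq> 0" using i by (auto simp: hidx_def)
      show ?thesis
      proof (rule E1_unit_unit[OF vge_varx Zp_1 _ _ Zp_minus[OF teich_Zp[OF l(1)]]])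
        show "vge 1 (hact i vary - const2 (- teich l) * varx)"
          using vge_mult0[OF vge_pk vge_vary] by (simp add: Some hact_Some const2_minus)
      qed (use l in \<open>simp_all add: Some hact_Some red_one red_minus teich_Zpbar red_teich\<close>)
    qed
    thus ?thesis unfolding mat_act_mult[of _ _ h1] mat_act_E1 using mi[OF i(1)] by (rule vge_mult0)
  qed
  have "vge (real t) (E1 (hact (Some 0) varx) (hact (Some 0) vary) - varx ^ nn)"
  proof (rule E1_unit_nonunit[OF vge_varx Zp_1 _ _ Zp_0 red_0])
    show "vge 1 (hact (Some 0) vary - const2 0 * varx)"
      using vge_mult0[OF vge_pk vge_vary] by (simp add: hact_Some)
  qed (simp_all add: hact_Some red_one)
  hence *: "vge (real t) ((E1 (hact (Some 0) varx) (hact (Some 0) vary) - varx ^ nn) * hact (Some 0) (ms j))"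
    using mi[OF zero_hidx] by (rule vge_mult0)
  have m: "hact (Some 0) (ms j) = const2 (pk ^ j) * ms j"
    by (simp add: mat_act_mult mat_act_power hact_zero power_mult_distrib const2_power mult_ac)
  have "hact (Some 0) (h1 * ms j) - const2 (pk ^ j) * (varx ^ nn * ms j) =
      (E1 (hact (Some 0) varx) (hact (Some 0) vary) - varx ^ nn) * hact (Some 0) (ms j)"
    unfolding mat_act_mult[of _ _ h1 "ms j"] mat_act_E1 m by (simp add: algebra_simps)
  thus "vge (real t) (hact (Some 0) (h1 * ms j) - const2 (pk ^ j) * (varx ^ nn * ms j))"
    using * by (simp only:)
qed

lemma Sym_h1: "j \<le> s \<Longrightarrow> h1 * ms j \<in> Sym r UNIV" and Sym_h2: "j \<le> s \<Longrightarrow> h2 * ms j \<in> Sym r UNIV"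
  and Sym_xm: "j \<le> s \<Longrightarrow> varx ^ nn * ms j \<in> Sym r UNIV"
  using Sym_power[OF Sym_varx, of nn]
  by (auto intro!: Sym_nn_mult Sym_E1 Sym_ms Sym_varx Sym_vary)

lemma A_monomial:
  assumes "j \<le> s"
  shows "A v (const2 (pk ^ j) * (varx ^ nn * ms j))"
proof -
  have vt: "v \<le> real t" using v_pos t2v by simp
  have "A v (const2 ap * (h1 * ms j))"
  proof (rule A_vge[OF Sym_const2_mult[OF Sym_h1[OF assms]]])
    have "vge v (const2 ap)" by (simp add: vge_const2 nu_ap)
    thus "vge v (const2 ap * (h1 * ms j))"
      by (rule vge_mult0[OF _ vge_mult0[OF vge_E1[OF vge_varx vge_vary] vge_ms]])
  qed
  moreover have "A v (hact i (h1 * ms j))" if "i \<in> hidx" "i \<noteq> Some 0" for i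
    by (rule A_vge[OF Sym_mat_act[OF Sym_h1[OF assms]] vge_mono[OF hact_h1(1)[OF assms that] vt]])
  ultimately have 1: "A v (hact (Some 0) (h1 * ms j))"
    by (intro A_hecke'[OF Sym_h1[OF assms] zero_hidx])
  have "A v (hact (Some 0) (h1 * ms j) - const2 (pk ^ j) * (varx ^ nn * ms j))"
    by (rule A_vge[OF Sym_diff[OF Sym_mat_act[OF Sym_h1[OF assms]] Sym_const2_mult[OF Sym_xm[OF assms]]]
          vge_mono[OF hact_h1(2)[OF assms] vt]])
  from A_diff[OF 1 this] show ?thesis by simp
qed

lemma A_h1:
  assumes "j \<le> s" "e \<le> real t" "A e (const2 (pk ^ j) * (varx ^ nn * ms j))"
  shows "A (e - v) (h1 * ms j)"
proof -
  have "A e (hact i (h1 * ms j))" if "i \<in> hidx" for i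
  proof (cases "i = Some 0")
    case False
    show ?thesis
      by (rule A_vge[OF Sym_mat_act[OF Sym_h1[OF assms(1)]] vge_mono[OF hact_h1(1)[OF assms(1) that False] assms(2)]])
  next
    case True
    have "A e (hact (Some 0) (h1 * ms j) - const2 (pk ^ j) * (varx ^ nn * ms j))"
      by (rule A_vge[OF Sym_diff[OF Sym_mat_act[OF Sym_h1[OF assms(1)]] Sym_const2_mult[OF Sym_xm[OF assms(1)]]]
            vge_mono[OF hact_h1(2)[OF assms(1)] assms(2)]])
    from A_add[OF this assms(3)] show ?thesis using True by simp
  qed
  hence "A e (const2 ap * (h1 * ms j))" by (intro A_hecke[OF Sym_h1[OF assms(1)]])
  thus ?thesis using nu_ap A_divide by blast
qed

text \<open>The disc x = 0 detected by \<open>h2\<close> is met only by \<open>hact None\<close>,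
  where x becomes p x and contributes p^(s-j); all other terms vanish modulo p^t. This form is the
  difference between \<open>hh * ms j\<close> and \<open>varx ^ nn * ms j\<close>.\<close>

lemma A_h2:
  assumes "j \<le> s"
  shows "A (min (real t) (real (s - j)) - v) (h2 * ms j)"
proof (rule A_hact_vge[OF Sym_h2[OF assms]])
  fix i assume i: "i \<in> hidx"
  have mi: "vge 0 (hact i (ms j))"
    using i assms by (intro vge_hact[of _ _ s] Sym_ms vge_ms)
  show "vge (min (real t) (real (s - j))) (hact i (h2 * ms j))"
  proof (cases i)
    case (Some l)
    hence l: "l \<in> prime_field" using i by (auto simp: hidx_def)
    have d: "vge 1 (hact i vary - const2 (- teich l) * varx)"
      using vge_mult0[OF vge_pk vge_vary] by (simp add: Some hact_Some const2_minus)
    have "vge (real t) (E1 (hact i vary) (hact i varx))"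
    proof (cases "l = 0")
      case True
      show ?thesis
        by (rule E1_nonunit[OF vge_varx Zp_minus[OF teich_Zp[OF l]] _ d]) (simp_all add: True Some hact_Some vge_varx)
    next
      case False
      show ?thesis
        by (rule E1_unit_unit[OF vge_varx Zp_minus[OF teich_Zp[OF l]] _ d Zp_1])
          (use False l in \<open>simp_all add: Some hact_Some red_one red_minus teich_Zpbar red_teich\<close>)
    qed
    hence "vge (real t) (hact i (h2 * ms j))"
      unfolding mat_act_mult[of _ _ h2] mat_act_E1 using mi by (rule vge_mult0)
    thus ?thesis by (rule vge_mono) simp
  next
    case None
    have "vge (real (s - j) * 1) ((const2 pk * varx) ^ (s - j))"
      by (intro vge_power vge_mult0 vge_pk vge_varx)
    hence "vge (real (s - j)) (hact i (ms j))"
      by (simp add: None mat_act_mult mat_act_power hact_None vge_mult0 vge_power0 vge_vary)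
    hence "vge (real (s - j)) (hact i (h2 * ms j))"
      unfolding mat_act_mult[of _ _ h2] mat_act_E1
      by (intro vge_0mult vge_E1) (simp_all add: None hact_None vge_vary vge_mult0[OF vge_mono[OF vge_pk]] vge_varx)
    thus ?thesis by (rule vge_mono) simp
  qed
qed

end

context nearby_weight
begin

section \<open>Divisibility of the multiples of \<open>hh\<close>\<close>

lemma Sym_pms: "j \<le> s \<Longrightarrow> const2 (pk ^ j) * ms j \<in> Sym s UNIV"
  by (intro Sym_const2_mult Sym_ms)

lemma vge_pms: "vge 0 (const2 (pk ^ j) * ms j)"
  by (intro vge_mult0 vge_ms) (simp add: vge_const2 nu_p_power)

text \<open>The correction by \<open>h2\<close> is divisible of order min(t, s - j) - v + j \<ge>
  min(t, s) - v, which is at least v since t \<ge> 2v and s > 2v.\<close>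

lemma A_hh_ms:
  assumes "j \<le> s"
  shows "A v (hh * (const2 (pk ^ j) * ms j))"
proof -
  have "A (min (real t) (real (s - j)) - v + real j) (const2 (pk ^ j) * (h2 * ms j))"
    using assms by (intro A_const2 A_h2) (simp_all add: nu_p_power)
  moreover have "v \<le> min (real t) (real (s - j)) - v + real j"
    using assms t2v s2v by (simp add: of_nat_diff)
  ultimately have "A v (const2 (pk ^ j) * (h2 * ms j))" by (rule A_mono)
  from A_add[OF A_monomial[OF assms] this] show ?thesis by (simp add: algebra_simps)
qed

lemma A_hh_act:
  assumes "A v (hh * G)" "G \<in> Sym s UNIV" "vge 0 G" "k \<in> K0"
  shows "A v (hh * act k G)"
proof -
  have "A v (act k (hh * G) - hh * act k G)"
    by (rule A_mono[OF A_act_hh[OF assms(4,2,3)]]) (use t2v in simp)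
  from A_diff[OF A_act[OF assms(1,4)] this] show ?thesis by simp
qed

lemma swap_K0: "mat2 0 1 1 0 \<in> K0"
  by (auto simp: GL2_iff Zp_0 Zp_1 det_2 intro!: bexI[of _ "-1"] Zp_minus)

lemma lower_K0: "z \<in> Zp \<nu> \<Longrightarrow> mat2 1 0 z 1 \<in> K0" and upper_K0: "z \<in> Zp \<nu> \<Longrightarrow> mat2 1 z 0 1 \<in> K0"
  by (auto simp: GL2_iff Zp_0 Zp_1 det_2 intro!: bexI[of _ 1])

lemma act_lower_ms:
  assumes "j \<le> s"
  shows "act (mat2 1 0 z 1) (ms j) = (\<Sum>e\<in>{j..s}. const2 (of_nat ((s - j) choose (e - j)) * z ^ (e - j)) * ms e)"
proof -
  have "act (mat2 1 0 z 1) (ms j) = (const2 z * vary + varx) ^ (s - j) * vary ^ j"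
    by (simp add: mat_act_mult mat_act_power mat_act_varx mat_act_vary add.commute)
  also have "\<dots> = (\<Sum>i\<le>s - j. const2 (of_nat ((s - j) choose i) * z ^ i) * ms (i + j))"
    unfolding binomial_ring sum_distrib_right
    by (intro sum.cong) (auto simp: power_mult_distrib power_add const2_mult const2_power const2_of_nat mult_ac add.commute)
  also have "\<dots> = (\<Sum>e\<in>{j..s}. const2 (of_nat ((s - j) choose (e - j)) * z ^ (e - j)) * ms e)"
    using assms by (intro sum.reindex_bij_witness[of _ "\<lambda>e. e - j" "\<lambda>i. i + j"]) auto
  finally show ?thesis .
qed

text \<open>Averaging the translates of p^j x^(s-j) y^j by lower unipotent matrices with
  Teichmueller entries against a character keeps one residue class of exponents modulo p - 1. The
  average carries the factor p - 1, a unit.\<close>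

lemma A_hh_row:
  assumes "j \<le> s"
  shows "A v (hh * (const2 (pk ^ j) *
    (\<Sum>e | j \<le> e \<and> e \<le> s \<and> e mod (p - 1) = c. const2 (of_nat ((s - j) choose (e - j))) * ms e)))"
proof (cases "c < p - 1")
  case False
  hence "{e. j \<le> e \<and> e \<le> s \<and> e mod (p - 1) = c} = {}"
    using p_gt_1 mod_less_divisor[of "p - 1"] by force
  thus ?thesis by (simp only: sum.empty mult_zero_right A_0)
next
  case True
  \<comment> \<open>In natural numbers (p - 2) c plays the part of -c modulo p - 1, so w + (e - j)
    is congruent to e - c.\<close>
  define w where "w = j + (p - 2) * c"
  define row where "row = (\<Sum>e | j \<le> e \<and> e \<le> s \<and> e mod (p - 1) = c. const2 (of_nat ((s - j) choose (e - j))) * ms e)"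
  have "A v (\<Sum>l\<in>prime_field - {0}. const2 (teich l ^ w) * (hh * act (mat2 1 0 (teich l) 1) (const2 (pk ^ j) * ms j)))"
    using assms teich_Zpbar
    by (intro A_sum A_const2_0 A_hh_act A_hh_ms Sym_pms vge_pms lower_K0 teich_Zp)
      (auto simp: Zpbar_iff[symmetric] intro: Zpbar_power)
  also have "(\<Sum>l\<in>prime_field - {0}. const2 (teich l ^ w) * (hh * act (mat2 1 0 (teich l) 1) (const2 (pk ^ j) * ms j))) =
      hh * (const2 (pk ^ j) * (\<Sum>l\<in>prime_field - {0}. const2 (teich l ^ w) * act (mat2 1 0 (teich l) 1) (ms j)))"
    unfolding sum_distrib_left mat_act_mult[of _ _ "const2 (pk ^ j)"] mat_act_const2
    by (intro sum.cong refl) (simp only: mult_ac)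
  also have "(\<Sum>l\<in>prime_field - {0}. const2 (teich l ^ w) * act (mat2 1 0 (teich l) 1) (ms j)) =
      (\<Sum>e\<in>{j..s}. const2 (of_nat ((s - j) choose (e - j)) * (\<Sum>l\<in>prime_field - {0}. teich l ^ (w + (e - j)))) * ms e)"
    unfolding act_lower_ms[OF assms] sum_distrib_left sum_distrib_right const2_sum
    by (subst sum.swap) (intro sum.cong refl, simp only: power_add const2_mult mult_ac)
  also have "\<dots> = (\<Sum>e\<in>{j..s}. if e mod (p - 1) = c then const2 (of_nat ((s - j) choose (e - j)) * of_nat (p - 1)) * ms e else 0)"
  proof (intro sum.cong refl)
    fix e assume e: "e \<in> {j..s}"
    have "w + (e - j) + c = e + (p - 1) * c"
    proof -
      have "(p - 2) * c + c = (p - 1) * c"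
        using p_ge by (simp add: diff_mult_distrib)
      thus ?thesis using e by (simp add: w_def)
    qed
    hence 1: "(w + (e - j) + c) mod (p - 1) = e mod (p - 1)" by simp
    have "(p - 1) dvd w + (e - j) \<longleftrightarrow> (w + (e - j) + c) mod (p - 1) = c"
    proof
      assume "(p - 1) dvd w + (e - j)"
      then obtain q where q: "w + (e - j) = (p - 1) * q" by auto
      show "(w + (e - j) + c) mod (p - 1) = c" unfolding q using True by simp
    next
      assume "(w + (e - j) + c) mod (p - 1) = c"
      hence "(w + (e - j) + c) mod (p - 1) = c mod (p - 1)" using True by simp
      thus "(p - 1) dvd w + (e - j)" by (subst (asm) mod_eq_dvd_iff_nat) auto
    qed
    hence "(p - 1) dvd w + (e - j) \<longleftrightarrow> e mod (p - 1) = c" unfolding 1 .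
    hence "(\<Sum>l\<in>prime_field - {0}. teich l ^ (w + (e - j))) = (if e mod (p - 1) = c then of_nat (p - 1) else 0)"
      using sum_teich_power_dvd sum_teich_power_not_dvd by metis
    thus "const2 (of_nat ((s - j) choose (e - j)) * (\<Sum>l\<in>prime_field - {0}. teich l ^ (w + (e - j)))) * ms e =
      (if e mod (p - 1) = c then const2 (of_nat ((s - j) choose (e - j)) * of_nat (p - 1)) * ms e else 0)"
      by simp
  qed
  also have "\<dots> = const2 (of_nat (p - 1)) * row"
    unfolding row_def sum_distrib_left
    by (intro sum.mono_neutral_cong_right) (auto simp: const2_mult mult_ac)
  finally have "A v (hh * (const2 (pk ^ j) * (const2 (of_nat (p - 1)) * row)))" .
  hence *: "A v (const2 (of_nat (p - 1)) * (hh * (const2 (pk ^ j) * row)))"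
    by (simp only: mult_ac)
  have "\<not> p dvd p - 1" using p_gt_1 by (auto dest: dvd_imp_le)
  hence "\<nu> (of_nat (p - 1)) = ereal 0" using nu_of_nat_eq_0 by (simp add: zero_ereal_def)
  from A_divide[OF * this] show ?thesis by (simp only: row_def[symmetric] diff_zero)
qed

lemma row_span_hh: "row_span p \<nu> red s (\<lambda>G. A v (hh * G))"
proof (unfold_locales, goal_cases)
  case (1 F G)
  thus ?case using A_add[of v "hh * F" "hh * G"] by (simp only: distrib_left)
next
  case (2 F a)
  thus ?case using A_const2_0[of v "hh * F" a] by (simp only: mult.left_commute)
next
  case 3
  show ?case by (simp add: A_0)
next
  case (4 j c)
  thus ?case by (rule A_hh_row)
next
  case (5 e)
  thus ?case by (rule A_hh_ms)
next
  case (6 e)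
  have "act (mat2 0 1 1 0) (const2 (pk ^ (s - e)) * ms (s - e)) = const2 (pk ^ (s - e)) * ms e"
    using 6 by (simp add: mat_act_simps mult_ac)
  thus ?case
    using A_hh_act[OF A_hh_ms[of "s - e"] Sym_pms[of "s - e"] vge_pms swap_K0] by simp
qed

lemma A_hh_monomial:
  assumes "e \<le> s"
  shows "A (v - real m) (hh * ms e)"
proof -
  have "A v (hh * (const2 (pk ^ m) * ms e))"
    by (rule row_span.B_power_m[OF row_span_hh s_less m_le m_ge assms])
  hence "A v (const2 (pk ^ m) * (hh * ms e))" by (simp only: mult.left_commute)
  from A_divide[OF this nu_p_power] show ?thesis .
qed

lemma Ap_hh:
  assumes "G \<in> Sym s UNIV" "vge 0 G"
  shows "Ap (hh * G)"
proof -
  have "A (v - real m) (const2 (coeff (coeff G j) (s - j)) * (hh * ms j))" if "j \<le> s" for j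
    using assms(2) that by (intro A_const2_0 A_hh_monomial) (auto simp: vge_def zero_ereal_def)
  hence "A (v - real m) (\<Sum>j\<le>s. const2 (coeff (coeff G j) (s - j)) * (hh * ms j))"
    by (intro A_sum) auto
  also have "(\<Sum>j\<le>s. const2 (coeff (coeff G j) (s - j)) * (hh * ms j)) = hh * G"
    by (subst (2) Sym_decomp[OF assms(1)], subst sum_distrib_left) (intro sum.cong refl, simp only: mult_ac)
  finally show ?thesis using mv by (auto simp: Ap_def intro!: exI[of _ "v - real m"])
qed

text \<open>By \<open>A_h1\<close> it suffices that p^i x^nn times the monomial, the difference of
  the \<open>hh\<close> and \<open>h2\<close> terms, is divisible of some order e > v.\<close>

lemma Ap_h1:
  assumes "m < i" "i \<le> s"
  shows "Ap (h1 * ms i)"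
proof -
  \<comment> \<open>The orders come from the congruences modulo p^t, from the \<open>hh\<close>
    term, and from the two cases of the \<open>h2\<close> term. All exceed v: the second because i >
    m, the others because t \<ge> 2v, i > 0 and s > 2v.\<close>
  define e where "e = min (real t) (min (real i + v - real m) (min (real i + real t - v) (real s - v)))"
  have e: "v < e" using assms t2v s2v mv v_pos by (auto simp: e_def)
  have "A (v - real m + real i) (const2 (pk ^ i) * (hh * ms i))"
    using assms by (intro A_const2 A_hh_monomial) (simp_all add: nu_p_power)
  hence 1: "A e (const2 (pk ^ i) * (hh * ms i))" by (rule A_mono) (simp add: e_def)
  have "A (min (real t) (real (s - i)) - v + real i) (const2 (pk ^ i) * (h2 * ms i))"
    using assms by (intro A_const2 A_h2) (simp_all add: nu_p_power)
  hence 2: "A e (const2 (pk ^ i) * (h2 * ms i))"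
    by (rule A_mono) (use assms in \<open>auto simp: e_def of_nat_diff min_def\<close>)
  have "A e (const2 (pk ^ i) * (varx ^ nn * ms i))"
    using A_diff[OF 1 2] by (simp add: algebra_simps)
  hence "A (e - v) (h1 * ms i)" using assms by (intro A_h1) (auto simp: e_def)
  thus ?thesis using e by (auto simp: Ap_def intro!: exI[of _ "e - v"])
qed

section \<open>Multiples of high powers of theta\<close>

lemma odd_p: "odd p"
  using prime_p p_ge prime_odd_nat by auto

text \<open>Modulo p, \<open>hact i\<close> evaluates at a point of the projective line over the
  prime field, where theta vanishes. For \<open>Some l\<close> the image L of y is compared with R =
  -[l] x, and theta vanishes at (x, R) on the nose because [l]^p = [l].\<close>

lemma vge_hact_theta:
  assumes "i \<in> hidx"
  shows "vge 1 (hact i (theta_poly p))"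
proof (cases i)
  case None
  have "vge 1 ((const2 pk * varx) ^ p)"
  proof -
    have "vge (real p * 1) ((const2 pk * varx) ^ p)" by (intro vge_power vge_mult0 vge_pk vge_varx)
    thus ?thesis by (rule vge_mono) (use p_ge in simp)
  qed
  moreover have "vge 1 (const2 pk * varx)" by (intro vge_mult0 vge_pk vge_varx)
  ultimately show ?thesis
    unfolding None theta_poly_def mat_act_simps(1-2) mat_act_diff mat_act_mult mat_act_power hact_None
    by (intro vge_diff vge_mult0[OF _ vge_vary] vge_mult0[OF _ vge_power0[OF vge_vary]])
next
  case (Some l)
  hence l: "l \<in> prime_field" using assms by (auto simp: hidx_def)
  define L where "L = const2 pk * vary - const2 (teich l) * varx"
  define R where "R = - (const2 (teich l) * varx)"
  have c0: "vge 0 (const2 (teich l))" using teich_Zpbar[OF l] by (simp add: vge_const2 Zpbar_iff zero_ereal_def)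
  have R0: "vge 0 R" unfolding R_def by (intro vge_minus vge_mult0 c0 vge_varx)
  have d: "vge 1 (L - R)" using vge_mult0[OF vge_pk vge_vary] by (simp add: L_def R_def)
  have L0: "vge 0 L" using vge_add[OF vge_mono[OF d, of 0] R0] by simp
  have Rp: "R ^ p = R * varx ^ (p - 1)"
  proof -
    have "R ^ p = - (const2 (teich l ^ p) * varx ^ p)"
      using odd_p by (simp add: R_def power_minus_odd power_mult_distrib const2_power)
    also have "varx ^ p = varx * varx ^ (p - 1)" using p_gt_1 by (simp flip: power_Suc)
    finally show ?thesis by (simp add: teich_power_p[OF l] R_def mult.assoc)
  qed
  have "hact i (theta_poly p) = varx ^ p * (L - R) - varx * (L ^ p - R ^ p) + (varx ^ p * R - varx * R ^ p)"
    by (simp add: theta_poly_def Some mat_act_diff mat_act_mult mat_act_power hact_Some L_def algebra_simps)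
  also have "varx ^ p * R - varx * R ^ p = 0"
  proof -
    have x: "varx ^ p = varx * (varx :: 'k poly poly) ^ (p - 1)" using p_gt_1 by (simp flip: power_Suc)
    have "varx ^ p * R = varx * R ^ p" unfolding Rp x by (simp only: mult_ac)
    thus ?thesis by (simp only: diff_self)
  qed
  finally have "hact i (theta_poly p) = varx ^ p * (L - R) - varx * (L ^ p - R ^ p)" by simp
  moreover have "vge 1 (varx ^ p * (L - R) - varx * (L ^ p - R ^ p))"
    by (intro vge_diff[OF vge_0mult[OF vge_power0[OF vge_varx] d] vge_0mult[OF vge_varx vge_power_diff[OF L0 R0 d]]])
  ultimately show ?thesis by simp
qed

lemma Sym_theta: "theta_poly p \<in> Sym (p + 1) UNIV"
  unfolding theta_poly_def
  using Sym_monom[of p 1 "p + 1"] Sym_monom[of 1 p "p + 1"] by (intro Sym_diff) auto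

lemma vge_theta: "vge 0 (theta_poly p)"
  unfolding theta_poly_def by (intro vge_intros)

text \<open>Every term of the Hecke sum is divisible by p^i, and division by \<open>ap\<close>
  leaves order i - v > 0.\<close>

lemma Ap_theta:
  assumes "v < real i" "i * (p + 1) \<le> r" "G \<in> Sym (r - i * (p + 1)) UNIV" "vge 0 G"
  shows "Ap (theta_poly p ^ i * G)"
proof -
  have S: "theta_poly p ^ i * G \<in> Sym r UNIV"
    using Sym_mult[OF Sym_power[OF Sym_theta, of i] assms(3)] assms(2) by simp
  have "vge (real i) (hact j (theta_poly p ^ i * G))" if "j \<in> hidx" for j
  proof -
    have "vge (real i * 1 + 0) (hact j (theta_poly p) ^ i * hact j G)"
      using that assms by (intro vge_mult vge_power vge_hact_theta vge_hact) auto
    thus ?thesis by (simp add: mat_act_mult mat_act_power)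
  qed
  hence "A (real i - v) (theta_poly p ^ i * G)" by (intro A_hact_vge S)
  thus ?thesis using assms(1) by (auto simp: Ap_def intro!: exI[of _ "real i - v"])
qed

end

section \<open>The filtration by powers of \<open>\<theta>\<close>\<close>

lemma coeff_varx_power_mult:
  fixes F :: "'a::comm_ring_1 poly poly"
  shows "a < i \<Longrightarrow> coeff (coeff (varx ^ i * F) j) a = 0"
proof -
  assume "a < i"
  have "varx ^ i = [:monom (1 :: 'a) i:]" using monom2[of 1 i 0] by (simp add: monom_0)
  thus ?thesis using \<open>a < i\<close> by (simp add: coeff_monom_mult)
qed

context nearby_weight
begin

section \<open>The filtration in terms of dehomogenised forms\<close>

abbreviation XX :: "'f poly" where "XX \<equiv> [:0, 1:]"
text \<open>The polynomial theta at x = 1. Its roots are the finite points of the projective line;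
  the zero of theta at infinity shows only in the degree.\<close>

definition qx :: "'f poly" where "qx = XX - XX ^ p"

lemma XX_power: "XX ^ n = monom 1 n"
  by (simp add: monom_altdef)

lemma degree_qx: "degree qx = p"
proof -
  have "degree (XX + - monom 1 p) = degree (- monom (1 :: 'f) p)"
    by (rule degree_add_eq_right) (use p_gt_1 in \<open>simp add: degree_monom_eq\<close>)
  thus ?thesis by (simp add: qx_def XX_power degree_monom_eq)
qed

lemma qx_nz [simp]: "qx \<noteq> 0"
  using degree_qx p_gt_1 by force

lemma dehom_theta: "dehom (theta_poly p :: 'f poly poly) = qx"
  by (simp add: theta_poly_def qx_def dehom_simps)

lemma dehom_E1: "dehom (E1 F G) = E1 (dehom F) (dehom G)"
  by (simp add: E1_def dehom_simps)

lemma Sym_theta_res: "(theta_poly p :: 'f poly poly) \<in> Sym (p + 1) UNIV"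
  unfolding theta_poly_def
  using Sym_monom[of p 1 "p + 1"] Sym_monom[of 1 p "p + 1"] by (intro Sym_diff) auto

text \<open>Divisibility by theta^i splits into divisibility by \<open>qx ^ i\<close> at the finite
  points and, at infinity, divisibility by x^i, that is, degree at most r - i.\<close>

lemma V_thetaD:
  assumes "w \<in> V_theta p r i"
  shows "w \<in> Sym r UNIV" "qx ^ i dvd dehom w" "\<And>j. r < i + j \<Longrightarrow> coeff (dehom w) j = 0"
proof -
  from assms obtain G where G: "w = theta_poly p ^ i * G" and S: "w \<in> Sym r UNIV"
    by (auto simp: V_theta_def)
  show "w \<in> Sym r UNIV" by fact
  show "qx ^ i dvd dehom w" unfolding G by (simp add: dehom_simps dehom_theta)
  have "theta_poly p = varx * (varx ^ (p - 1) * vary - vary ^ p :: 'f poly poly)"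
    using p_gt_1 by (simp add: theta_poly_def algebra_simps flip: power_Suc)
  hence w: "w = varx ^ i * ((varx ^ (p - 1) * vary - vary ^ p) ^ i * G)"
    by (simp add: G power_mult_distrib mult.assoc)
  show "coeff (dehom w) j = 0" if "r < i + j" for j
  proof -
    have "coeff (coeff w j) (r - j) = 0" if "j \<le> r"
      by (subst w, rule coeff_varx_power_mult) (use \<open>r < i + j\<close> that in linarith)
    thus ?thesis by (simp add: coeff_dehom[OF S])
  qed
qed

text \<open>Comparing degrees shows that the cofactor of \<open>qx ^ i\<close> has degree at most r
  - i(p + 1), so it homogenises to a cofactor of theta^i. The homogeneous cofactor is needed to lift
  w to a multiple of theta^i in characteristic 0.\<close>

lemma V_thetaI:
  assumes "w \<in> Sym r UNIV" "qx ^ i dvd dehom w" "\<And>j. r < i + j \<Longrightarrow> coeff (dehom w) j = 0"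
  shows "w = 0 \<or> i * (p + 1) \<le> r \<and> (\<exists>G. G \<in> Sym (r - i * (p + 1)) UNIV \<and> w = theta_poly p ^ i * G)"
    and "w \<in> V_theta p r i"
proof -
  show *: "w = 0 \<or> i * (p + 1) \<le> r \<and> (\<exists>G. G \<in> Sym (r - i * (p + 1)) UNIV \<and> w = theta_poly p ^ i * G)"
  proof (cases "dehom w = 0")
    case True
    thus ?thesis using dehom_inject[OF assms(1) Sym_0] by simp
  next
    case False
    from assms(2) obtain g where g: "dehom w = qx ^ i * g" by auto
    hence g0: "g \<noteq> 0" using False by auto
    have "coeff (dehom w) (degree (dehom w)) \<noteq> 0" using False by simp
    hence "i + degree (dehom w) \<le> r" using assms(3) not_le by blast
    moreover have "degree (dehom w) = i * p + degree g"
      using g0 by (simp add: g degree_mult_eq degree_power_eq degree_qx)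
    ultimately have d: "i * (p + 1) + degree g \<le> r" by (simp add: algebra_simps)
    define G where "G = homog (r - i * (p + 1)) g"
    have "theta_poly p ^ i * G \<in> Sym (i * (p + 1) + (r - i * (p + 1))) UNIV"
      unfolding G_def by (intro Sym_mult Sym_power Sym_theta_res Sym_homog)
    hence "theta_poly p ^ i * G \<in> Sym r UNIV" using d by simp
    moreover have "dehom (theta_poly p ^ i * G) = dehom w"
      using d by (simp add: dehom_simps dehom_theta G_def dehom_homog g)
    ultimately have "w = theta_poly p ^ i * G" using dehom_inject[OF assms(1)] by metis
    thus ?thesis using d Sym_homog G_def by auto
  qed
  show "w \<in> V_theta p r i" using * assms(1) by (auto simp: V_theta_def)
qed

lemma red_K0: "k \<in> K0 \<Longrightarrow> red (k $ i $ j) \<in> prime_field"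
  by (auto simp: GL2_def intro: red_Zp)

text \<open>Up to sign, theta is the determinant with rows (x, y) and (x^p, y^p). Frobenius fixes
  the entries of the reduced matrix, so both rows transform alike and c is its determinant.\<close>

lemma mat_act_theta:
  assumes "k \<in> K0"
  shows "\<exists>c. mat_act red k (theta_poly p) = const2 c * theta_poly p"
proof -
  have frob: "(const2 a * varx + const2 c * vary) ^ p = const2 a * varx ^ p + const2 c * vary ^ p"
    if "a \<in> prime_field" "c \<in> prime_field" for a c :: 'f
  proof -
    have "(const2 a * varx + const2 c * vary) ^ p = (const2 a * varx) ^ p + (const2 c * vary) ^ p"
      by (rule freshmans_dream) (simp_all add: CHAR_res prime_p)
    thus ?thesis using prime_field_power_p that by (simp add: power_mult_distrib flip: const2_power)
  qed
  show ?thesis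
    by (rule exI[of _ "red (k $ 1 $ 1) * red (k $ 2 $ 2) - red (k $ 1 $ 2) * red (k $ 2 $ 1)"])
      (simp add: theta_poly_def mat_act_simps frob red_K0[OF assms] const2_diff const2_mult, simp add: algebra_simps)
qed

lemma V_theta_stable:
  assumes "k \<in> K0" "w \<in> V_theta p r i"
  shows "mat_act red k w \<in> V_theta p r i"
proof -
  obtain c where "mat_act red k (theta_poly p) = const2 c * theta_poly p" using mat_act_theta[OF assms(1)] by blast
  moreover from assms(2) obtain G where "w = theta_poly p ^ i * G" "w \<in> Sym r UNIV" by (auto simp: V_theta_def)
  moreover have "mat_act red k w \<in> Sym r UNIV"
    using assms(2) by (intro Sym_mat_act) (simp add: V_theta_def)
  ultimately have "mat_act red k w = theta_poly p ^ i * (const2 c ^ i * mat_act red k G)" "mat_act red k w \<in> Sym r UNIV"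
    by (simp_all only: mat_act_mult mat_act_power power_mult_distrib mult_ac)
  thus ?thesis unfolding V_theta_def by (metis (mono_tags, lifting) CollectI dvdI)
qed

text \<open>Some integral lift of w is divisible by a scalar of positive valuation, so that
  \<open>P\<close> sends [1, w] to 0. By \<open>Ap_red2_0\<close> it does not matter which lift is
  taken.\<close>

definition killed :: "'f poly poly \<Rightarrow> bool" where
  "killed w \<longleftrightarrow> (\<exists>z. z \<in> Sym r UNIV \<and> vge 0 z \<and> red2 red z = w \<and> Ap z)"

lemma killedI: "z \<in> Sym r UNIV \<Longrightarrow> vge 0 z \<Longrightarrow> Ap z \<Longrightarrow> killed (red2 red z)"
  by (auto simp: killed_def)

lemma killed_0: "killed 0"
  using killedI[OF Sym_0 vge_0 Ap_0] by simp

lemma killed_add: "killed w \<Longrightarrow> killed w' \<Longrightarrow> killed (w + w')"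
  unfolding killed_def by (metis Sym_add vge_add Ap_add red2_add)

lemma killed_const2:
  assumes "killed w"
  shows "killed (const2 a * w)"
proof -
  obtain z where z: "z \<in> Sym r UNIV" "vge 0 z" "red2 red z = w" "Ap z" using assms by (auto simp: killed_def)
  obtain x where x: "x \<in> Zpbar \<nu>" "red x = a" using red_surj by (metis UNIV_I imageE)
  hence "vge 0 (const2 x)" by (simp add: vge_const2 Zpbar_iff zero_ereal_def)
  hence "killed (red2 red (const2 x * z))"
    using z x by (intro killedI Sym_const2_mult vge_mult0 Ap_const2) (auto simp: Zpbar_iff)
  thus ?thesis using z x \<open>vge 0 (const2 x)\<close> by (simp add: red2_mult)
qed

lemma killed_sum: "(\<And>i. i \<in> I \<Longrightarrow> killed (f i)) \<Longrightarrow> killed (sum f I)"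
  by (induction I rule: infinite_finite_induct) (auto simp: killed_0 intro: killed_add)

lemma killed_act:
  assumes "killed w" "k \<in> K0"
  shows "killed (mat_act red k w)"
proof -
  obtain z where z: "z \<in> Sym r UNIV" "vge 0 z" "red2 red z = w" "Ap z" using assms by (auto simp: killed_def)
  have "killed (red2 red (act k z))"
    using z assms K0_nu by (intro killedI Sym_mat_act Ap_act vge_act[of _ r]) auto
  thus ?thesis using red2_act[OF z(1,2) assms(2)] z(3) by simp
qed

lemma red2_E1: "vge 0 F \<Longrightarrow> vge 0 G \<Longrightarrow> red2 red (E1 F G) = E1 (red2 red F) (red2 red G)"
  by (simp add: E1_def red2_mult red2_power red2_diff vge_power0 vge_diff del: power_Suc)

lemma killed_hh:
  assumes "G \<in> Sym s UNIV"
  shows "killed (hh * G)"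
proof -
  obtain z where z: "z \<in> Sym s UNIV" "vge 0 z" "red2 red z = G" using red2_lift[OF assms] by blast
  have "killed (red2 red (hh * z))"
    using z by (intro killedI Sym_nn_mult Sym_hh vge_mult0 vge_hh Ap_hh)
  thus ?thesis using z
    by (simp add: red2_mult red2_add red2_power red2_E1 vge_hh vge_E1 vge_power0 vge_varx vge_vary)
qed

lemma killed_h1:
  assumes "m < i" "i \<le> s"
  shows "killed (h1 * (varx ^ (s - i) * vary ^ i))"
proof -
  have "killed (red2 red (h1 * ms i))"
    using assms by (intro killedI Sym_h1 vge_mult0 vge_E1 vge_varx vge_vary vge_ms Ap_h1)
  thus ?thesis
    by (simp add: red2_mult red2_power red2_E1 vge_ms vge_E1 vge_power0 vge_varx vge_vary)
qed

lemma red2_theta: "red2 red (theta_poly p) = theta_poly p"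
  by (simp add: theta_poly_def red2_diff red2_mult red2_power vge_intros)

lemma killed_V_theta_large:
  assumes "v < real i" "w \<in> V_theta p r i"
  shows "killed w"
proof -
  from V_thetaI(1)[OF V_thetaD[OF assms(2)]] consider "w = 0" |
     G where "i * (p + 1) \<le> r" "G \<in> Sym (r - i * (p + 1)) UNIV" "w = theta_poly p ^ i * G" by auto
  thus ?thesis
  proof cases
    case 1
    thus ?thesis using killed_0 by simp
  next
    case 2
    obtain z where z: "z \<in> Sym (r - i * (p + 1)) UNIV" "vge 0 z" "red2 red z = G" using red2_lift[OF 2(2)] by blast
    have "theta_poly p ^ i * z \<in> Sym r UNIV"
      using Sym_mult[OF Sym_power[OF Sym_theta, of i] z(1)] 2(1) by simp
    hence "killed (red2 red (theta_poly p ^ i * z))"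
      using z 2 assms(1) by (intro killedI vge_mult0 vge_power0 vge_theta Ap_theta)
    thus ?thesis using z 2 by (simp add: red2_mult red2_power red2_theta vge_theta vge_power0)
  qed
qed

section \<open>Values at the points of the projective line over the prime field\<close>

lemma qx_shift:
  assumes "l \<in> prime_field"
  shows "qx = (XX - [:l:]) - (XX - [:l:]) ^ p"
proof -
  have "(XX + - [:l:]) ^ p = XX ^ p + (- [:l:]) ^ p"
    by (rule freshmans_dream) (simp_all add: CHAR_res prime_p)
  also have "(- [:l:]) ^ p = - ([:l:] ^ p)" using odd_p by (rule power_minus_odd)
  also have "[:l:] ^ p = [:l:]" using prime_field_power_p[OF assms] by (simp add: poly_const_pow)
  finally show ?thesis by (simp add: qx_def)
qed

lemma qx_dvd_of_roots:
  assumes "\<And>l. l \<in> prime_field \<Longrightarrow> poly g l = 0"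
  shows "qx dvd g"
proof (rule ccontr)
  assume "\<not> qx dvd g"
  define h where "h = g mod qx"
  have h0: "h \<noteq> 0" using \<open>\<not> qx dvd g\<close> by (simp add: h_def mod_eq_0_iff_dvd)
  hence deg: "degree h < p" using degree_mod_less[of qx g] degree_qx by (auto simp: h_def)
  have "poly h l = 0" if l: "l \<in> prime_field" for l
  proof -
    have "poly qx l = 0" using prime_field_power_p[OF l] by (simp add: qx_def)
    moreover have "g = qx * (g div qx) + h" by (simp add: h_def)
    ultimately show ?thesis using assms[OF l] by (metis add_0 mult_zero_left poly_add poly_mult)
  qed
  hence "prime_field \<subseteq> {x. poly h x = 0}" by auto
  hence "p \<le> card {x. poly h x = 0}" using card_mono[OF poly_roots_finite[OF h0]] card_prime_field by metis
  thus False using card_poly_roots_bound[OF h0] deg by simp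
qed

text \<open>Up to sign, \<open>qx\<close> is y times y^(p-1) - 1. The second factor divides y^aa -
  1, and both exponents in \<open>E1\<close> are at least t + 1.\<close>

lemma qx_power_dvd_E1:
  assumes "i \<le> t + 1"
  shows "qx ^ i dvd E1 XX 1"
proof -
  have q: "qx = - (XX * (XX ^ (p - 1) - 1))"
    using p_gt_1 by (simp add: qx_def algebra_simps flip: power_Suc)
  have "qx ^ i = (- 1) ^ i * (XX * (XX ^ (p - 1) - 1)) ^ i" unfolding q by (rule power_minus)
  hence "qx ^ i dvd (XX * (XX ^ (p - 1) - 1)) ^ i" by (simp add: minus_one_power_iff)
  also have "(XX * (XX ^ (p - 1) - 1)) ^ i = XX ^ i * (XX ^ (p - 1) - 1) ^ i" by (rule power_mult_distrib)
  also have "\<dots> dvd XX ^ (nn - qq) * (XX ^ aa - 1) ^ (t + 1)"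
  proof (rule mult_dvd_mono)
    show "XX ^ i dvd XX ^ (nn - qq)" using assms qq_le by (intro le_imp_power_dvd) linarith
    have "XX ^ (p - 1) - 1 dvd (XX ^ (p - 1)) ^ t - 1 ^ t"
    proof (cases t)
      case (Suc t')
      thus ?thesis unfolding Suc power_Suc_diff by simp
    qed simp
    hence "XX ^ (p - 1) - 1 dvd XX ^ aa - 1" by (simp add: aa_def power_mult)
    hence "(XX ^ (p - 1) - 1) ^ (t + 1) dvd (XX ^ aa - 1) ^ (t + 1)" by (rule dvd_power_same)
    thus "(XX ^ (p - 1) - 1) ^ i dvd (XX ^ aa - 1) ^ (t + 1)"
      using dvd_trans[OF le_imp_power_dvd[OF assms]] by blast
  qed
  finally show ?thesis by (simp add: E1_def)
qed

lemma aa_pos: "0 < aa"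
  using t_pos aa_ge by simp

lemma E1_XX:
  shows "degree (E1 XX 1) = nn" "lead_coeff (E1 XX 1) = 1"
proof -
  have "degree (monom 1 aa + - 1 :: 'f poly) = degree (monom 1 aa :: 'f poly)"
    by (rule degree_add_eq_left) (use aa_pos in \<open>simp add: degree_monom_eq\<close>)
  hence d: "degree (XX ^ aa - 1) = aa" by (simp add: XX_power degree_monom_eq)
  have l: "lead_coeff (XX ^ aa - 1) = 1" unfolding d using aa_pos by (simp add: XX_power)
  hence nz: "XX ^ aa - 1 \<noteq> 0" by auto
  have "degree (E1 XX 1) = (nn - qq) + (t + 1) * aa"
  proof -
    have "degree (E1 XX 1) = degree (XX ^ (nn - qq)) + degree ((XX ^ aa - 1) ^ (t + 1))"
      unfolding E1_def power_one by (rule degree_mult_eq) (use nz in \<open>auto simp: XX_power\<close>)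
    also have "degree ((XX ^ aa - 1) ^ (t + 1)) = (t + 1) * aa" unfolding degree_power_eq[OF nz] d ..
    finally show ?thesis by (simp add: XX_power degree_monom_eq)
  qed
  thus "degree (E1 XX 1) = nn" using qq_le by (simp add: qq_def mult.commute)
  show "lead_coeff (E1 XX 1) = 1"
    unfolding E1_def power_one lead_coeff_mult lead_coeff_power l by (simp add: XX_power degree_monom_eq)
qed

lemma prime_field_diff:
  assumes "a \<in> prime_field" "b \<in> prime_field"
  shows "a - b \<in> (prime_field :: 'f set)"
proof -
  have "red (teich a - teich b) \<in> prime_field" using assms by (intro red_Zp Zp_diff teich_Zp)
  thus ?thesis using assms by (simp add: red_diff teich_Zpbar red_teich)
qed

text \<open>A translate of the form \<open>h1 x\<^bsup>s-i\<^esup> y\<^sup>i\<close> reduces, in \<open>V\<^sup>(\<^sup>i\<^sup>) / V\<^sup>(\<^sup>i\<^sup>+\<^sup>1\<^sup>)\<close> viewed as functions on the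
  projective line over the prime field, to the indicator of a single point.\<close>

lemma bump:
  assumes "l \<in> prime_field" "i \<le> t"
  shows "\<exists>c. E1 1 (XX - [:l:]) * (XX - [:l:]) ^ i = qx ^ i * c \<and>
     (\<forall>\<mu>\<in>prime_field. poly c \<mu> = (if \<mu> = l then 1 else 0))"
proof -
  define Y where "Y = XX - [:l:]"
  define Z where "Z = Y ^ (p - 1)"
  define \<sigma> where "\<sigma> = (\<Sum>j<t. Z ^ j)"
  have Y: "qx = Y * (1 - Z)"
    unfolding qx_shift[OF assms(1)] Y_def[symmetric] Z_def using p_gt_1 by (simp add: algebra_simps flip: power_Suc)
  have aa: "1 - Y ^ aa = (1 - Z) * \<sigma>"
    unfolding aa_def power_mult Z_def[symmetric] \<sigma>_def by (rule one_diff_power_eq)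
  \<comment> \<open>The remaining exponent t + 1 - i is at least 1, so c vanishes at the points
    other than l. At l both factors take the value 1.\<close>
  define c where "c = \<sigma> ^ i * (1 - Y ^ aa) ^ (t + 1 - i)"
  have "E1 1 Y * Y ^ i = (1 - Y ^ aa) ^ (i + (t + 1 - i)) * Y ^ i"
    using assms(2) by (simp add: E1_def)
  also have "\<dots> = ((1 - Z) * \<sigma>) ^ i * (1 - Y ^ aa) ^ (t + 1 - i) * Y ^ i"
    unfolding power_add by (simp only: aa)
  also have "\<dots> = qx ^ i * c" unfolding Y c_def by (simp add: power_mult_distrib mult_ac)
  finally have 1: "E1 1 Y * Y ^ i = qx ^ i * c" .
  have "poly c \<mu> = (if \<mu> = l then 1 else 0)" if \<mu>: "\<mu> \<in> prime_field" for \<mu>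
  proof (cases "\<mu> = l")
    case True
    have Y0: "poly Y \<mu> = 0" by (simp add: Y_def True)
    have "poly Z \<mu> = 0" using p_gt_1 by (simp add: Z_def Y0)
    hence "poly \<sigma> \<mu> = (\<Sum>j<t. 0 ^ j)" by (simp add: \<sigma>_def poly_sum)
    also have "\<dots> = 1" using t_pos by (cases t) (simp_all add: sum.lessThan_Suc_shift del: sum.lessThan_Suc)
    finally have "poly \<sigma> \<mu> = 1" .
    thus ?thesis using True Y0 aa_pos by (simp add: c_def zero_power)
  next
    case False
    define \<delta> where "\<delta> = \<mu> - l"
    have "\<delta> \<in> prime_field" "\<delta> \<noteq> 0" using prime_field_diff[OF \<mu> assms(1)] False by (auto simp: \<delta>_def)
    have "\<delta> ^ (p - 1) * \<delta> = 1 * \<delta>"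
      using prime_field_power_p[OF \<open>\<delta> \<in> prime_field\<close>] p_gt_1 by (simp flip: power_Suc2)
    hence "\<delta> ^ (p - 1) = 1" using \<open>\<delta> \<noteq> 0\<close> by simp
    hence "\<delta> ^ aa = 1" by (simp add: aa_def power_mult)
    hence "poly (1 - Y ^ aa) \<mu> = 0" by (simp add: Y_def \<delta>_def)
    thus ?thesis using False assms(2) by (simp add: c_def)
  qed
  thus ?thesis using 1 unfolding Y_def by blast
qed

text \<open>The degree stays so far below r - i that the translates at finite points contribute
  nothing at infinity.\<close>

lemma degree_bump: "degree (E1 1 (XX - [:l:]) * (XX - [:l:]) ^ i) \<le> qq + i"
proof -
  define Y where "Y = XX - [:l:]"
  have dY: "degree (Y ^ j) \<le> j" for j
    using degree_power_le[of Y j] by (simp add: Y_def)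
  have "degree (1 - Y ^ aa) \<le> aa"
    using dY[of aa] by (intro degree_diff_le) auto
  hence "degree ((1 - Y ^ aa) ^ (t + 1)) \<le> aa * (t + 1)"
    using degree_power_le[of "1 - Y ^ aa" "t + 1"] by (meson le_trans mult_le_mono1)
  hence "degree ((1 - Y ^ aa) ^ (t + 1) * Y ^ i) \<le> qq + i"
    unfolding qq_def using dY[of i] by (intro order_trans[OF degree_mult_le] add_mono)
  thus ?thesis by (simp add: E1_def Y_def)
qed

text \<open>A class in V^(i)/V^(i+1) is given by p + 1 values: the coefficient in degree r - i for
  the point at infinity, and the values of the quotient by \<open>qx ^ i\<close> at the elements of
  the prime field. Subtracting killed translates of e with these coefficients lands in
  V^(i+1).\<close>

lemma killed_V_theta_step:
  assumes i: "m < i" "i \<le> s" "i \<le> t"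
    and IH: "\<And>w. w \<in> V_theta p r (i + 1) \<Longrightarrow> killed w"
    and w: "w \<in> V_theta p r i"
  shows "killed w"
proof -
  note wD = V_thetaD[OF w]
  define e where "e = h1 * (varx ^ (s - i) * vary ^ i :: 'f poly poly)"
  have ke: "killed e" unfolding e_def using i by (intro killed_h1)
  have Se: "e \<in> Sym r UNIV" unfolding e_def
    using i by (intro Sym_nn_mult Sym_E1 Sym_varx Sym_vary Sym_monom) auto
  \<comment> \<open>The translate at infinity. It is subtracted before the values of g are read off,
    because it also changes the quotient at the finite points.\<close>
  define einf where "einf = mat_act red (mat2 0 1 1 0) e"
  have kinf: "killed einf" unfolding einf_def by (intro killed_act ke swap_K0)
  have Sinf: "einf \<in> Sym r UNIV" unfolding einf_def by (intro Sym_mat_act Se)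
  have dinf: "dehom einf = E1 XX 1 * XX ^ (s - i)"
    by (simp add: einf_def e_def mat_act_mult mat_act_power mat_act_E1 mat_act_varx mat_act_vary red_one dehom_mult dehom_E1 dehom_power)
  have einf_nz: "E1 XX 1 \<noteq> 0" using E1_XX(2) by auto
  have ri: "r - i = nn + (s - i)" using i r_nn by simp
  have deg_inf: "degree (dehom einf) = r - i" unfolding dinf ri
    using einf_nz by (subst degree_mult_eq) (simp_all add: E1_XX XX_power degree_monom_eq)
  have lc_inf: "coeff (dehom einf) (r - i) = 1"
    unfolding deg_inf[symmetric] unfolding dinf lead_coeff_mult unfolding E1_XX(2)
    by (simp add: XX_power degree_monom_eq)
  define c where "c = coeff (dehom w) (r - i)"
  define w1 where "w1 = w - const2 c * einf"
  have Sw1: "w1 \<in> Sym r UNIV" unfolding w1_def by (intro Sym_diff wD(1) Sym_const2_mult Sinf)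
  have "qx ^ i dvd dehom einf"
    unfolding dinf using i by (intro dvd_mult2 qx_power_dvd_E1) simp
  have dw1: "dehom w1 = dehom w - [:c:] * dehom einf" by (simp add: w1_def dehom_simps)
  have "qx ^ i dvd dehom w1" unfolding dw1 using wD(2) \<open>qx ^ i dvd dehom einf\<close> by (intro dvd_diff dvd_mult)
  then obtain g where g: "dehom w1 = qx ^ i * g" by auto
  have cw1: "coeff (dehom w1) j = 0" if j: "r < i + 1 + j" for j
  proof (cases "j = r - i")
    case True
    thus ?thesis using lc_inf by (simp add: dw1 c_def)
  next
    case False
    hence "r < i + j" using j i r_nn by linarith
    moreover from this have "degree (dehom einf) < j" using deg_inf i(2) r_nn by linarith
    ultimately show ?thesis using wD(3) by (simp add: dw1 coeff_eq_0)
  qed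
  define k where "k l = mat2 1 (- teich l) 0 1" for l
  define el where "el l = mat_act red (k l) e" for l
  have kK: "k l \<in> K0" if "l \<in> prime_field" for l
    unfolding k_def using that by (intro upper_K0 Zp_minus teich_Zp)
  have del: "dehom (el l) = E1 1 (XX - [:l:]) * (XX - [:l:]) ^ i" if "l \<in> prime_field" for l
    using that by (simp add: el_def k_def e_def mat_act_mult mat_act_power mat_act_E1 mat_act_varx mat_act_vary
        red_one red_minus teich_Zpbar red_teich dehom_mult dehom_E1 dehom_power dehom_add)
  have Sel: "el l \<in> Sym r UNIV" for l unfolding el_def by (intro Sym_mat_act Se)
  define w2 where "w2 = w1 - (\<Sum>l\<in>prime_field. const2 (poly g l) * el l)"
  have "\<forall>l\<in>prime_field. \<exists>c. dehom (el l) = qx ^ i * c \<and> (\<forall>\<mu>\<in>prime_field. poly c \<mu> = (if \<mu> = l then 1 else 0))"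
    using bump i(3) del by simp
  then obtain b where b: "\<And>l. l \<in> prime_field \<Longrightarrow> dehom (el l) = qx ^ i * b l"
    "\<And>l \<mu>. l \<in> prime_field \<Longrightarrow> \<mu> \<in> prime_field \<Longrightarrow> poly (b l) \<mu> = (if \<mu> = l then 1 else 0)" by metis
  have "dehom w2 = qx ^ i * g - (\<Sum>l\<in>prime_field. [:poly g l:] * (qx ^ i * b l))"
    by (simp add: w2_def dehom_simps g b(1) cong: sum.cong)
  also have "\<dots> = qx ^ i * (g - (\<Sum>l\<in>prime_field. [:poly g l:] * b l))"
    by (simp add: right_diff_distrib sum_distrib_left mult.left_commute)
  finally have dw2: "dehom w2 = qx ^ i * (g - (\<Sum>l\<in>prime_field. [:poly g l:] * b l))" .
  have "qx dvd g - (\<Sum>l\<in>prime_field. [:poly g l:] * b l)"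
  proof (rule qx_dvd_of_roots)
    fix \<mu> :: 'f assume \<mu>: "\<mu> \<in> prime_field"
    have "(\<Sum>l\<in>prime_field. poly ([:poly g l:] * b l) \<mu>) = (\<Sum>l\<in>prime_field. if l = \<mu> then poly g \<mu> else 0)"
      using b(2) \<mu> by (intro sum.cong) auto
    thus "poly (g - (\<Sum>l\<in>prime_field. [:poly g l:] * b l)) \<mu> = 0"
      using \<mu> by (simp add: poly_sum)
  qed
  hence "qx ^ (i + 1) dvd dehom w2" unfolding dw2 by (simp add: mult.commute mult_dvd_mono)
  moreover have "w2 \<in> Sym r UNIV" unfolding w2_def by (intro Sym_diff Sw1 Sym_sum Sym_const2_mult Sel)
  moreover have "coeff (dehom w2) j = 0" if j: "r < i + 1 + j" for j
  proof -
    have "coeff (dehom (el l)) j = 0" if "l \<in> prime_field" for l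
    proof (rule coeff_eq_0)
      have "degree (dehom (el l)) \<le> qq + i" unfolding del[OF that] by (rule degree_bump)
      thus "degree (dehom (el l)) < j" using j i qq_le r_nn by linarith
    qed
    thus ?thesis using cw1[OF j] by (simp add: w2_def dehom_simps coeff_sum)
  qed
  ultimately have "killed w2" by (intro IH V_thetaI(2))
  moreover have "w = w2 + (const2 c * einf + (\<Sum>l\<in>prime_field. const2 (poly g l) * el l))"
    by (simp add: w2_def w1_def)
  ultimately show ?thesis
    using kinf ke kK unfolding el_def
    by (simp only:) (intro killed_add killed_const2 killed_sum killed_act)
qed

lemma killed_V_theta:
  assumes "w \<in> V_theta p r (m + 1)"
  shows "killed w"
proof -
  \<comment> \<open>The first integer above v, where the direct argument applies. Every i below M
    satisfies i \<le> v, which gives the bounds i \<le> s and i \<le> t required by the descending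
    step.\<close>
  define M where "M = nat \<lfloor>v\<rfloor> + 1"
  have M: "v < real M" "real M \<le> v + 1" using v_pos unfolding M_def by linarith+
  have "\<forall>w\<in>V_theta p r i. killed w" if "m + 1 \<le> i" "i \<le> M" for i
    using that(2,1)
  proof (induction rule: inc_induct)
    case base
    show ?case using killed_V_theta_large M by blast
  next
    case (step i)
    have "real i \<le> v" using step.hyps M by linarith
    hence il: "i \<le> s" "i \<le> t" using s2v t2v v_pos by linarith+
    have "m < i" using step.prems by simp
    show ?case
    proof
      fix w :: "'f poly poly" assume w: "w \<in> V_theta p r i"
      have "killed w'" if "w' \<in> V_theta p r (i + 1)" for w'
        using step.IH step.prems that by simp
      thus "killed w" by (rule killed_V_theta_step[OF \<open>m < i\<close> il _ w])
    qed
  qed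
  moreover have "m + 1 \<le> M" using mv M by linarith
  ultimately show ?thesis using assms by blast
qed

text \<open>After the leading monomial there is a gap of length \<open>aa\<close>, at least m. So
  the top m coefficients of \<open>E1 XX 1 * g\<close> are those of g, shifted by
  \<open>nn\<close>.\<close>

lemma degree_E1_XX_diff: "degree (E1 XX 1 - XX ^ nn) \<le> nn - aa"
proof -
  define P where "P = XX ^ aa - 1"
  define S where "S = (\<Sum>j<Suc t. P ^ j * (XX ^ aa) ^ (t - j))"
  have dP: "degree P \<le> aa" unfolding P_def by (intro degree_diff_le) (simp_all add: XX_power degree_monom_eq)
  have qn: "nn = (nn - qq) + aa * Suc t" using qq_le by (simp add: qq_def)
  have "XX ^ nn = XX ^ (nn - qq) * (XX ^ aa) ^ Suc t"
    by (subst qn) (simp only: power_add power_mult)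
  hence "E1 XX 1 - XX ^ nn = XX ^ (nn - qq) * (P ^ Suc t - (XX ^ aa) ^ Suc t)"
    by (simp only: E1_def P_def power_one right_diff_distrib Suc_eq_plus1)
  also have "P ^ Suc t - (XX ^ aa) ^ Suc t = - S"
    unfolding power_Suc_diff S_def by (simp add: P_def)
  finally have eq: "E1 XX 1 - XX ^ nn = XX ^ (nn - qq) * - S" .
  have "degree (P ^ j * (XX ^ aa) ^ (t - j)) \<le> aa * t" if "j < Suc t" for j
  proof -
    have "degree (P ^ j * (XX ^ aa) ^ (t - j)) \<le> aa * j + aa * (t - j)"
    proof (intro order_trans[OF degree_mult_le] add_mono)
      show "degree (P ^ j) \<le> aa * j"
        using degree_power_le[of P j] mult_le_mono1[OF dP, of j] by (rule order_trans)
      show "degree ((XX ^ aa) ^ (t - j)) \<le> aa * (t - j)"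
        unfolding power_mult[symmetric] unfolding XX_power by (simp add: degree_monom_eq)
    qed
    also have "\<dots> = aa * t" using that by (simp flip: distrib_left)
    finally show ?thesis .
  qed
  hence "degree S \<le> aa * t" unfolding S_def by (intro degree_sum_le) auto
  hence "degree (E1 XX 1 - XX ^ nn) \<le> (nn - qq) + aa * t"
    unfolding eq by (intro order_trans[OF degree_mult_le] add_mono) (simp_all add: XX_power degree_monom_eq)
  also have "\<dots> = nn - aa" using qn by simp
  finally show ?thesis .
qed

text \<open>For G = \<open>homog s g\<close>, \<open>hh * G\<close> dehomogenises to g +
  \<open>E1 XX 1 * g\<close>: the first summand decides the condition modulo \<open>qx ^ m\<close>,
  the second the top coefficients. So g takes its top m coefficients from f through W and is
  adjusted by a remainder of degree below m p. The two choices do not interfere because m p \<le> s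
  + 1 - m.\<close>

lemma surjective_mod_V_theta:
  fixes w :: "'f poly poly"
  assumes w: "w \<in> Sym r UNIV"
  shows "\<exists>G. G \<in> Sym s UNIV \<and> w - hh * G \<in> V_theta p r m"
proof -
  define f where "f = dehom w"
  define W where "W = (\<Sum>j = s + 1 - m..s. monom (coeff f (nn + j)) j)"
  define g where "g = W + (f - W) mod qx ^ m"
  have mt: "m \<le> t" using mv t2v v_pos by linarith
  have ms: "m * p + m \<le> s + 1" using m_le by (simp add: algebra_simps)
  have cW: "coeff W j = (if j \<in> {s + 1 - m..s} then coeff f (nn + j) else 0)" for j
    by (simp add: W_def coeff_sum)
  have cmod: "coeff ((f - W) mod qx ^ m) j = 0" if "m * p \<le> j" for j
  proof (cases "(f - W) mod qx ^ m = 0")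
    case False
    hence "degree ((f - W) mod qx ^ m) < degree (qx ^ m)" by (intro degree_mod_less') auto
    thus ?thesis using that by (intro coeff_eq_0) (simp add: degree_power_eq degree_qx)
  qed simp
  have cg: "coeff g j = coeff W j" if "s + 1 - m \<le> j" for j
    using that ms cmod[of j] by (simp add: g_def)
  have dg: "degree g \<le> s"
    by (rule degree_le) (use cg cW in auto)
  define G where "G = homog s g"
  have SG: "G \<in> Sym s UNIV" unfolding G_def by (rule Sym_homog)
  have dG: "dehom (hh * G) = g + E1 XX 1 * g"
    using dg by (simp add: dehom_simps dehom_E1 G_def dehom_homog algebra_simps)
  have "w - hh * G \<in> V_theta p r m"
  proof (rule V_thetaI(2))
    show "w - hh * G \<in> Sym r UNIV" by (intro Sym_diff w Sym_nn_mult Sym_hh SG)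
    have "f - g = qx ^ m * ((f - W) div qx ^ m)"
      unfolding g_def by (simp add: minus_mod_eq_mult_div[symmetric] algebra_simps)
    hence "qx ^ m dvd f - g" by simp
    moreover have "qx ^ m dvd E1 XX 1 * g" using mt by (intro dvd_mult2 qx_power_dvd_E1) simp
    ultimately have "qx ^ m dvd (f - g) - E1 XX 1 * g" by (rule dvd_diff)
    moreover have dd: "dehom (w - hh * G) = (f - g) - E1 XX 1 * g" by (simp only: dehom_diff dG f_def) simp
    ultimately show "qx ^ m dvd dehom (w - hh * G)" by simp
    fix j assume j: "r < m + j"
    show "coeff (dehom (w - hh * G)) j = 0"
    proof -
      have nj: "nn + (s + 1 - m) \<le> j" using j r_nn ms by linarith
      have "coeff g j = 0" using dg nj qq_le mt m_le by (intro coeff_eq_0) linarith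
      moreover have "coeff (E1 XX 1 * g) j = coeff g (j - nn)"
      proof -
        have "E1 XX 1 * g = XX ^ nn * g + (E1 XX 1 - XX ^ nn) * g" by (simp add: algebra_simps)
        moreover have "coeff ((E1 XX 1 - XX ^ nn) * g) j = 0"
        proof (rule coeff_eq_0)
          have "degree ((E1 XX 1 - XX ^ nn) * g) \<le> (nn - aa) + s"
            by (intro order_trans[OF degree_mult_le] add_mono degree_E1_XX_diff dg)
          moreover have "aa \<le> nn" using qq_le by (simp add: qq_def)
          ultimately show "degree ((E1 XX 1 - XX ^ nn) * g) < j" using nj aa_ge mt ms by linarith
        qed
        ultimately show ?thesis using nj by (simp add: XX_power coeff_monom_mult)
      qed
      moreover have "coeff f j = coeff g (j - nn)"
      proof (cases "j \<le> r")
        case True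
        hence "j - nn \<in> {s + 1 - m..s}" using nj r_nn by auto
        thus ?thesis using cg[of "j - nn"] cW[of "j - nn"] nj by simp
      next
        case False
        have "coeff f j = 0" unfolding f_def using False by (simp add: coeff_dehom[OF w])
        moreover have "coeff g (j - nn) = 0" using False dg r_nn by (intro coeff_eq_0) linarith
        ultimately show ?thesis by simp
      qed
      ultimately show ?thesis unfolding dd by simp
    qed
  qed
  thus ?thesis using SG by blast
qed

theorem P_surjection: "P_induces_surjection p \<nu> red r ap m (m + 1)"
proof (rule P_induces_surjectionI)
  fix w :: "'f poly poly" assume "w \<in> V_theta p r (m + 1)"
  thus "\<exists>z. z \<in> Sym r UNIV \<and> vge 0 z \<and> red2 red z = w \<and> Ap z"
    using killed_V_theta by (auto simp: killed_def)
next
  fix z assume z: "z \<in> Sym r UNIV" "vge 0 z"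
  obtain G where G: "G \<in> Sym s UNIV" "red2 red z - hh * G \<in> V_theta p r m"
    using surjective_mod_V_theta[OF Sym_red2[OF z(1)]] by blast
  obtain y where y: "y \<in> Sym r UNIV" "vge 0 y" "red2 red y = hh * G" "Ap y"
    using killed_hh[OF G(1)] by (auto simp: killed_def)
  show "\<exists>u. u \<in> Sym r UNIV \<and> vge 0 u \<and> red2 red u \<in> V_theta p r m \<and> Ap (z - u)"
    using z y G(2) by (intro exI[of _ "z - y"]) (simp add: Sym_diff vge_diff red2_diff)
qed (rule V_theta_stable)

end

theorem theorem5p3:
  fixes p b c s r t d :: nat
    and \<nu> :: "'k::{alg_closed_field, field_char_0} \<Rightarrow> ereal"
    and red :: "'k \<Rightarrow> 'f::field"
    and ap :: 'k
  assumes "padic_alg_closure p \<nu> red"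
    and "prime p" and "7 \<le> p"
    and "2 \<le> b" and "b \<le> p" and "c \<le> p - 2"
    and "s = b + c * (p - 1)"
    and "0 < t" and "0 < d" and "\<not> p dvd d"
    and "r = s + p ^ t * (p - 1) * d"
    and "2 * \<nu> ap < ereal (real s)"
    and "ereal (real c) < \<nu> ap"
    and "\<nu> ap < ereal (min (real p / 2 + real c - real (eps p b c)) (real p - 1))"
    and "2 * int c - 1 \<le> int b \<longrightarrow> 2 * \<nu> ap \<le> ereal (real t)"
    and "int b \<le> 2 * int c - 2 \<longrightarrow> 2 * \<nu> ap + ereal (real (eps p b c)) - 1 < ereal (real t)"
  shows "((b, c) \<noteq> (p, 0) \<longrightarrow>
            P_induces_surjection p \<nu> red r ap (c - eps p b c) (c + 1 - eps p b c)) \<and>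
         ((b, c) = (p, 0) \<and> 1 < \<nu> ap \<longrightarrow>
            P_induces_surjection p \<nu> red r ap 1 2)"
proof -
  obtain v where v: "\<nu> ap = ereal v" using assms(13,14) by (cases "\<nu> ap") auto
  have s2v: "2 * v < real s" using assms(12) v by simp
  have cv: "real c < v" using assms(13) v by simp
  have eps_cases: "eps p b c = 0 \<and> 2 * int c - 1 \<le> int b \<or>
      eps p b c = 1 \<and> 2 * (int c - 1) - int p \<le> int b \<and> int b \<le> 2 * int c - 2 \<or>
      eps p b c = 2 \<and> int b < 2 * (int c - 1) - int p"
    using assms(5) by (auto simp: eps_def)
  \<comment> \<open>In the second case \<open>eps\<close> is at least 1, so t > 2v +
    \<open>eps\<close> - 1 contains t \<ge> 2v.\<close>
  have t2v: "2 * v \<le> real t"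
  proof (cases "2 * int c - 1 \<le> int b")
    case True
    thus ?thesis using assms(15) v by simp
  next
    case False
    hence "1 \<le> eps p b c" using eps_cases by auto
    thus ?thesis using assms(16) v False by (simp add: one_ereal_def)
  qed
  define cp where "cp = c * p"
  have c_le: "c + 2 \<le> p" using assms(3,6) by linarith
  have s_eq: "s + c = b + cp"
  proof -
    have "c * (p - 1) + c = c * (p - 1 + 1)" by (simp only: distrib_left mult_1_right)
    also have "p - 1 + 1 = p" using assms(3) by linarith
    finally show ?thesis unfolding assms(7) cp_def by linarith
  qed
  have s_less: "s < p * (p - 1)"
  proof -
    have "c * (p - 1) \<le> (p - 2) * (p - 1)" using assms(6) by (intro mult_le_mono1)
    hence "s + (p - 1) \<le> p + (p - 2) * (p - 1) + (p - 1)" using assms(5,7) by linarith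
    also have "\<dots> = p + (p - 2 + 1) * (p - 1)" by (simp add: distrib_right)
    also have "p - 2 + 1 = p - 1" using assms(3) by linarith
    also have "p + (p - 1) * (p - 1) = p * (p - 1) + 1"
      using assms(3) by (cases p) auto
    finally show ?thesis using assms(3) by linarith
  qed
  have main: "P_induces_surjection p \<nu> red r ap m (m + 1)"
    if "m * (p + 1) \<le> s + 1" "s + 1 < (m + 1) * (p + 1)" "real m < v" for m
  proof -
    have "nearby_weight p \<nu> red r ap s t d m v"
      using assms(1,3,9,11) that s2v t2v v s_less
      by (intro nearby_weight.intro hecke_quotient.intro nearby_weight_axioms.intro) auto
    thus ?thesis by (rule nearby_weight.P_surjection)
  qed
  show ?thesis
  proof (intro conjI impI)
    assume bc: "(b, c) = (p, 0) \<and> 1 < \<nu> ap"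
    \<comment> \<open>Here s = p, so s + 1 = p + 1 and m = 1, one more than c - \<open>eps\<close>;
      m < v is then the extra assumption on \<open>ap\<close>.\<close>
    have "P_induces_surjection p \<nu> red r ap 1 (1 + 1)"
      using bc v assms(3,7) by (intro main) (auto simp: one_ereal_def)
    thus "P_induces_surjection p \<nu> red r ap 1 2" by (simp add: numeral_2_eq_2)
  next
    assume bc: "(b, c) \<noteq> (p, 0)"
    define m where "m = c - eps p b c"
    \<comment> \<open>In each case \<open>eps\<close> is at most c, so the truncated subtraction is
      exact.\<close>
    have em: "m + eps p b c = c" using eps_cases assms(4,5) unfolding m_def by auto
    have "real m < v" using cv by (simp add: m_def)
    \<comment> \<open>The remainder s + 1 - m(p + 1) equals b + 1 - 2c + \<open>eps\<close> (p + 1),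
      and the cases of \<open>eps\<close> are those that put it between 0 and p. The pair (p, 0)
      would give p + 1.\<close>
    moreover have "m * (p + 1) \<le> s + 1 \<and> s + 1 < (m + 1) * (p + 1)"
    proof -
      have cpm: "cp = m * p + eps p b c * p" using em by (metis cp_def add_mult_distrib)
      have "m * (p + 1) = m * p + m" "(m + 1) * (p + 1) = m * p + m + p + 1" by simp_all
      moreover have "b < p \<or> 1 \<le> c" using bc assms(5) by auto
      ultimately show ?thesis
        using eps_cases s_eq cpm em assms(3,4,5) c_le by auto
    qed
    ultimately have "P_induces_surjection p \<nu> red r ap m (m + 1)" by (intro main) auto
    moreover have "m + 1 = c + 1 - eps p b c" using em by linarith
    ultimately show "P_induces_surjection p \<nu> red r ap (c - eps p b c) (c + 1 - eps p b c)"
      by (simp add: m_def)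
  qed
qed

end
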